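(* Let $H$ be a CQG algebra. The assignments $A\mapsto H_A:=H/HA^+$ and $C\mapsto {}^C H$ are mutually inverse bijections between the set of right coideal $*$-subalgebras $A\subseteq H$ and the set of quotient left module $*$-coalgebras $\pi:H\to C$.
   Context: All objects are over $\mathbb{C}$. A Hopf $*$-algebra is a complex Hopf algebra that is also a $*$-algebra, such that the comultiplication $\Delta$ and counit $\varepsilon$ are $*$-algebra maps; $S$ denotes the antipode. For a finite-dimensional right $H$-comodule $M$ (coaction $m\mapsto m_0\otimes m_1$), let $M^*$ be its dual comodule (coaction determined by $\langle f_0,m\rangle f_1=\langle f,m_0\rangle S(m_1)$) and $\overline{M}$ the complex conjugate vector space with coaction $m\mapsto m_0\otimes m_1^*$. An inner product on $M$ (regarded as a linear map $\overline{M}\to M^*$) is compatible if this map is a map of $H$-comodules. A CQG algebra is a Hopf $*$-algebra for which every finite-dimensional right comodule admits a compatible inner product. A right coideal $*$-subalgebra is a unital subalgebra $A\subseteq H$ closed under $*$ with $\Delta(A)\subseteq A\otimes H$; put $A^+=A\cap\ker\varepsilon$. Then $HA^+$ is a left ideal and coideal of $H$, so $H_A=H/HA^+$ is a quotient left $H$-module coalgebra. In general a quotient left module coalgebra of $H$ is a surjection $\pi:H\to C$ which is a map of coalgebras and of left $H$-modules (quotients being identified when they have the same kernel); for such $\pi$ set ${}^C H=\{x\in H : \pi(x_1)\otimes x_2=\pi(1)\otimes x\}$ (Sweedler notation $\Delta(x)=x_1\otimes x_2$). A $*$-coalgebra is a complex coalgebra equipped with an involutive, conjugate-linear, comultiplication-reversing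 map $*$. A quotient left module $*$-coalgebra of $H$ is a quotient left module coalgebra $\pi:H\to C$ such that $C$ is a $*$-coalgebra and $\pi$ intertwines the map $x\mapsto (Sx)^*$ on $H$ with the $*$-structure of $C$ (equivalently, $x\mapsto (Sx)^*$ descends to $C$). *)

theory Defs
  imports Complex_Main "HOL-Library.Function_Algebras" "HOL-Algebra.Module" "HOL-Algebra.RingHom"
begin

section \<open>Complex vector spaces\<close>

text \<open>
  Vector spaces are modules in the sense of HOL-Algebra over the ring below; the
  record fields \<^const>\<open>mult\<close> and \<^const>\<open>one\<close> are only meaningful for algebras.
\<close>

definition complex_ring :: "complex ring" where
  "complex_ring = \<lparr>carrier = UNIV, mult = (*), one = 1, zero = 0, add = (+)\<rparr>"

definition complex_space :: "(complex, complex) module" where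
  "complex_space =
     \<lparr>carrier = UNIV, mult = (*), one = 1, zero = 0, add = (+), smult = (*)\<rparr>"

abbreviation cvector_space :: "(complex, 'a, 'm) module_scheme \<Rightarrow> bool" where
  "cvector_space V \<equiv> module complex_ring V"

definition finite_dim :: "(complex, 'a, 'm) module_scheme \<Rightarrow> bool" where
  "finite_dim V \<longleftrightarrow>
     (\<exists>B. finite B \<and> B \<subseteq> carrier V \<and>
        (\<forall>x\<in>carrier V. \<exists>c. x = (\<Oplus>\<^bsub>V\<^esub>b\<in>B. c b \<odot>\<^bsub>V\<^esub> b)))"

definition linear_between ::
  "(complex, 'a, 'm) module_scheme \<Rightarrow> (complex, 'b, 'n) module_scheme \<Rightarrow> ('a \<Rightarrow> 'b) \<Rightarrow> bool" where
  "linear_between V W f \<longleftrightarrow>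
     f \<in> carrier V \<rightarrow> carrier W \<and>
     (\<forall>x\<in>carrier V. \<forall>y\<in>carrier V. f (x \<oplus>\<^bsub>V\<^esub> y) = f x \<oplus>\<^bsub>W\<^esub> f y) \<and>
     (\<forall>c. \<forall>x\<in>carrier V. f (c \<odot>\<^bsub>V\<^esub> x) = c \<odot>\<^bsub>W\<^esub> f x)"

definition antilinear_between ::
  "(complex, 'a, 'm) module_scheme \<Rightarrow> (complex, 'b, 'n) module_scheme \<Rightarrow> ('a \<Rightarrow> 'b) \<Rightarrow> bool" where
  "antilinear_between V W f \<longleftrightarrow>
     f \<in> carrier V \<rightarrow> carrier W \<and>
     (\<forall>x\<in>carrier V. \<forall>y\<in>carrier V. f (x \<oplus>\<^bsub>V\<^esub> y) = f x \<oplus>\<^bsub>W\<^esub> f y) \<and>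
     (\<forall>c. \<forall>x\<in>carrier V. f (c \<odot>\<^bsub>V\<^esub> x) = cnj c \<odot>\<^bsub>W\<^esub> f x)"

abbreviation linear_form :: "(complex, 'a, 'm) module_scheme \<Rightarrow> ('a \<Rightarrow> complex) \<Rightarrow> bool" where
  "linear_form V f \<equiv> linear_between V complex_space f"

definition bilinear_form ::
  "(complex, 'a, 'm) module_scheme \<Rightarrow> (complex, 'b, 'n) module_scheme \<Rightarrow>
   ('a \<Rightarrow> 'b \<Rightarrow> complex) \<Rightarrow> bool" where
  "bilinear_form V W \<beta> \<longleftrightarrow>
     (\<forall>y\<in>carrier W. linear_form V (\<lambda>x. \<beta> x y)) \<and> (\<forall>x\<in>carrier V. linear_form W (\<beta> x))"


section \<open>Algebraic tensor products\<close>

text \<open>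
  Bilinear forms separate the points of an algebraic tensor product of vector spaces, so
  \<open>V \<otimes> W\<close> is modelled inside the dual of the space of bilinear forms on \<open>V \<times> W\<close>: the elementary
  tensor of \<open>x\<close> and \<open>y\<close> is evaluation at \<open>(x, y)\<close>, and \<open>V \<otimes> W\<close> consists of the finite sums of
  elementary tensors. The universal property is lemma \<open>tensor_lift_sum\<close> below.
\<close>

type_synonym ('a, 'b) tensor = "('a \<Rightarrow> 'b \<Rightarrow> complex) \<Rightarrow> complex"

definition elem_tensor ::
  "(complex, 'a, 'm) module_scheme \<Rightarrow> (complex, 'b, 'n) module_scheme \<Rightarrow>
   'a \<Rightarrow> 'b \<Rightarrow> ('a, 'b) tensor" where
  "elem_tensor V W x y = (\<lambda>\<beta>. if bilinear_form V W \<beta> then \<beta> x y else 0)"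

definition tensor_of_list ::
  "(complex, 'a, 'm) module_scheme \<Rightarrow> (complex, 'b, 'n) module_scheme \<Rightarrow>
   ('a \<times> 'b) list \<Rightarrow> ('a, 'b) tensor" where
  "tensor_of_list V W xs = (\<Sum>(x, y)\<leftarrow>xs. elem_tensor V W x y)"

text \<open>The subspace \<open>A \<otimes> B\<close> of \<open>V \<otimes> W\<close>, for subspaces \<open>A\<close> of \<open>V\<close> and \<open>B\<close> of \<open>W\<close>.\<close>

definition subtensor ::
  "(complex, 'a, 'm) module_scheme \<Rightarrow> (complex, 'b, 'n) module_scheme \<Rightarrow>
   'a set \<Rightarrow> 'b set \<Rightarrow> ('a, 'b) tensor set" where
  "subtensor V W A B = {tensor_of_list V W xs | xs. set xs \<subseteq> A \<times> B}"

text \<open>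
  The linear map on \<open>V \<otimes> W\<close> induced by a balanced biadditive map \<open>b\<close> (for instance a bilinear one,
  or one that is antilinear in both arguments); its value is computed on an arbitrarily chosen
  representation as a sum of elementary tensors.
\<close>

definition tensor_lift ::
  "(complex, 'a, 'm) module_scheme \<Rightarrow> (complex, 'b, 'n) module_scheme \<Rightarrow>
   ('a \<Rightarrow> 'b \<Rightarrow> 'u::comm_monoid_add) \<Rightarrow> ('a, 'b) tensor \<Rightarrow> 'u" where
  "tensor_lift V W b t =
     (let xs = (SOME xs. set xs \<subseteq> carrier V \<times> carrier W \<and> t = tensor_of_list V W xs)
      in \<Sum>(x, y)\<leftarrow>xs. b x y)"

text \<open>The fields \<^const>\<open>mult\<close> and \<^const>\<open>one\<close> make this the tensor product algebra if \<open>V\<close> and \<open>W\<close> are algebras.\<close>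

definition tensor_space ::
  "(complex, 'a, 'm) module_scheme \<Rightarrow> (complex, 'b, 'n) module_scheme \<Rightarrow>
   (complex, ('a, 'b) tensor) module" where
  "tensor_space V W =
     \<lparr>carrier = subtensor V W (carrier V) (carrier W),
      mult = (\<lambda>s t. tensor_lift V W (\<lambda>a b.
                tensor_lift V W (\<lambda>c d. elem_tensor V W (a \<otimes>\<^bsub>V\<^esub> c) (b \<otimes>\<^bsub>W\<^esub> d)) t) s),
      one = elem_tensor V W \<one>\<^bsub>V\<^esub> \<one>\<^bsub>W\<^esub>,
      zero = 0,
      add = (+),
      smult = (\<lambda>c t \<beta>. c * t \<beta>)\<rparr>"

definition tensor_map ::
  "(complex, 'a, 'm) module_scheme \<Rightarrow> (complex, 'b, 'n) module_scheme \<Rightarrow>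
   (complex, 'c, 'o) module_scheme \<Rightarrow> (complex, 'd, 'p) module_scheme \<Rightarrow>
   ('a \<Rightarrow> 'c) \<Rightarrow> ('b \<Rightarrow> 'd) \<Rightarrow> ('a, 'b) tensor \<Rightarrow> ('c, 'd) tensor" where
  "tensor_map V W V' W' f g = tensor_lift V W (\<lambda>x y. elem_tensor V' W' (f x) (g y))"

definition tensor_assoc ::
  "(complex, 'a, 'm) module_scheme \<Rightarrow> (complex, 'b, 'n) module_scheme \<Rightarrow>
   (complex, 'c, 'o) module_scheme \<Rightarrow>
   (('a, 'b) tensor, 'c) tensor \<Rightarrow> ('a, ('b, 'c) tensor) tensor" where
  "tensor_assoc U V W =
     tensor_lift (tensor_space U V) W (\<lambda>t w.
       tensor_lift U V (\<lambda>u v. elem_tensor U (tensor_space V W) u (elem_tensor V W v w)) t)"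

lemma elem_tensor_biadditive:
  assumes "x \<in> carrier V" "x' \<in> carrier V" "y \<in> carrier W" "y' \<in> carrier W"
  shows "elem_tensor V W (x \<oplus>\<^bsub>V\<^esub> x') y = elem_tensor V W x y + elem_tensor V W x' y"
    and "elem_tensor V W x (y \<oplus>\<^bsub>W\<^esub> y') = elem_tensor V W x y + elem_tensor V W x y'"
  using assms
  by (auto simp: elem_tensor_def bilinear_form_def linear_between_def complex_space_def fun_eq_iff)

lemma elem_tensor_scale:
  assumes "x \<in> carrier V" "y \<in> carrier W"
  shows "elem_tensor V W (c \<odot>\<^bsub>V\<^esub> x) y = (\<lambda>\<beta>. c * elem_tensor V W x y \<beta>)"
    and "elem_tensor V W x (c \<odot>\<^bsub>W\<^esub> y) = (\<lambda>\<beta>. c * elem_tensor V W x y \<beta>)"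
  using assms
  by (auto simp: elem_tensor_def bilinear_form_def linear_between_def complex_space_def fun_eq_iff)

lemma tensor_of_list_apply:
  "bilinear_form V W \<beta> \<Longrightarrow> tensor_of_list V W xs \<beta> = (\<Sum>(x, y)\<leftarrow>xs. \<beta> x y)"
  by (induction xs) (auto simp: tensor_of_list_def elem_tensor_def)

lemma tensor_lift_sum:
  fixes scale :: "complex \<Rightarrow> 'u::ab_group_add \<Rightarrow> 'u"
  assumes "vector_space scale"
    and "\<And>x x' y. x \<in> carrier V \<Longrightarrow> x' \<in> carrier V \<Longrightarrow> y \<in> carrier W \<Longrightarrow>
           b (x \<oplus>\<^bsub>V\<^esub> x') y = b x y + b x' y"
    and "\<And>x y y'. x \<in> carrier V \<Longrightarrow> y \<in> carrier W \<Longrightarrow> y' \<in> carrier W \<Longrightarrow>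
           b x (y \<oplus>\<^bsub>W\<^esub> y') = b x y + b x y'"
    and "\<And>c x y. x \<in> carrier V \<Longrightarrow> y \<in> carrier W \<Longrightarrow> b (c \<odot>\<^bsub>V\<^esub> x) y = scale c (b x y)"
    and "\<And>c x y. x \<in> carrier V \<Longrightarrow> y \<in> carrier W \<Longrightarrow> b x (c \<odot>\<^bsub>W\<^esub> y) = scale c (b x y)"
    and xs: "set xs \<subseteq> carrier V \<times> carrier W"
  shows "tensor_lift V W b (tensor_of_list V W xs) = (\<Sum>(x, y)\<leftarrow>xs. b x y)"
proof -
  interpret U: vector_space scale by fact
  interpret C: vector_space "(*) :: complex \<Rightarrow> complex \<Rightarrow> complex"
    by unfold_locales (auto simp: algebra_simps)
  interpret UC: vector_space_pair scale "(*) :: complex \<Rightarrow> complex \<Rightarrow> complex" ..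
  define ys where
    "ys = (SOME ys. set ys \<subseteq> carrier V \<times> carrier W \<and> tensor_of_list V W xs = tensor_of_list V W ys)"
  have ys: "set ys \<subseteq> carrier V \<times> carrier W" "tensor_of_list V W xs = tensor_of_list V W ys"
    unfolding atomize_conj ys_def by (rule someI[of _ xs]) (use xs in auto)
  define d where "d = (\<Sum>(x, y)\<leftarrow>ys. b x y) - (\<Sum>(x, y)\<leftarrow>xs. b x y)"
  have "d = 0"
  proof (rule ccontr)
    assume "d \<noteq> 0"
    then have "U.independent {d}"
      by (simp add: U.dependent_single)
    then obtain g where g: "Vector_Spaces.linear scale (*) g" "g d = 1"
      using UC.linear_independent_extend[of "{d}" "\<lambda>_. 1"] by auto
    interpret g: Vector_Spaces.linear scale "(*) :: complex \<Rightarrow> complex \<Rightarrow> complex" g by fact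
    have bil: "bilinear_form V W (\<lambda>x y. g (b x y))"
      using assms by (auto simp: bilinear_form_def linear_between_def complex_space_def g.add g.scale)
    have "g (\<Sum>(x, y)\<leftarrow>zs. b x y) = (\<Sum>(x, y)\<leftarrow>zs. g (b x y))" for zs
      by (induction zs) (auto simp: g.add g.zero)
    then have "g (\<Sum>(x, y)\<leftarrow>ys. b x y) = g (\<Sum>(x, y)\<leftarrow>xs. b x y)"
      using ys(2) tensor_of_list_apply[OF bil] by metis
    then show False
      using g(2) by (simp add: d_def g.diff)
  qed
  then show ?thesis
    unfolding tensor_lift_def Let_def ys_def[symmetric] d_def by simp
qed


section \<open>Coalgebras and Hopf *-algebras\<close>

record 'c coalgebra = "(complex, 'c) module" +
  comult :: "'c \<Rightarrow> ('c, 'c) tensor"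
  counit :: "'c \<Rightarrow> complex"

text \<open>In the counit axioms \<open>C\<close> is identified with \<open>\<complex> \<otimes> C\<close> and with \<open>C \<otimes> \<complex>\<close>.\<close>

definition is_coalgebra :: "('c, 'm) coalgebra_scheme \<Rightarrow> bool" where
  "is_coalgebra C \<longleftrightarrow>
     cvector_space C \<and>
     linear_between C (tensor_space C C) (comult C) \<and>
     linear_form C (counit C) \<and>
     (\<forall>x\<in>carrier C.
        tensor_assoc C C C (tensor_map C C (tensor_space C C) C (comult C) id (comult C x)) =
        tensor_map C C C (tensor_space C C) id (comult C) (comult C x)) \<and>
     (\<forall>x\<in>carrier C.
        tensor_map C C complex_space C (counit C) id (comult C x) =
          elem_tensor complex_space C 1 x \<and>
        tensor_map C C C complex_space id (counit C) (comult C x) =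
          elem_tensor C complex_space x 1)"

definition coalgebra_map ::
  "('c, 'm) coalgebra_scheme \<Rightarrow> ('d, 'n) coalgebra_scheme \<Rightarrow> ('c \<Rightarrow> 'd) \<Rightarrow> bool" where
  "coalgebra_map C D f \<longleftrightarrow>
     linear_between C D f \<and>
     (\<forall>x\<in>carrier C. comult D (f x) = tensor_map C C D D f f (comult C x)) \<and>
     (\<forall>x\<in>carrier C. counit D (f x) = counit C x)"

record 'h hopf_star_algebra = "'h coalgebra" +
  antipode :: "'h \<Rightarrow> 'h"
  star :: "'h \<Rightarrow> 'h"

text \<open>
  The underlying ring of a Hopf *-algebra is a whole type of class \<^class>\<open>ring_1\<close>, and the ring
  operations in the record are those of the type.
\<close>

definition is_algebra :: "(complex, 'h::ring_1, 'm) module_scheme \<Rightarrow> bool" where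
  "is_algebra H \<longleftrightarrow>
     carrier H = UNIV \<and> mult H = (*) \<and> one H = 1 \<and> zero H = 0 \<and> add H = (+) \<and>
     cvector_space H \<and>
     (\<forall>c x y. c \<odot>\<^bsub>H\<^esub> (x * y) = (c \<odot>\<^bsub>H\<^esub> x) * y \<and> c \<odot>\<^bsub>H\<^esub> (x * y) = x * (c \<odot>\<^bsub>H\<^esub> y))"

definition is_hopf_algebra :: "('h::ring_1, 'm) hopf_star_algebra_scheme \<Rightarrow> bool" where
  "is_hopf_algebra H \<longleftrightarrow>
     is_algebra H \<and> is_coalgebra H \<and>
     comult H 1 = one (tensor_space H H) \<and>
     (\<forall>x y. comult H (x * y) = comult H x \<otimes>\<^bsub>tensor_space H H\<^esub> comult H y) \<and>
     counit H 1 = 1 \<and>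
     (\<forall>x y. counit H (x * y) = counit H x * counit H y) \<and>
     linear_between H H (antipode H) \<and>
     (\<forall>x. tensor_lift H H (\<lambda>a b. antipode H a * b) (comult H x) = counit H x \<odot>\<^bsub>H\<^esub> 1 \<and>
          tensor_lift H H (\<lambda>a b. a * antipode H b) (comult H x) = counit H x \<odot>\<^bsub>H\<^esub> 1)"

definition is_hopf_star_algebra :: "('h::ring_1, 'm) hopf_star_algebra_scheme \<Rightarrow> bool" where
  "is_hopf_star_algebra H \<longleftrightarrow>
     is_hopf_algebra H \<and>
     antilinear_between H H (star H) \<and>
     (\<forall>x. star H (star H x) = x) \<and>
     (\<forall>x y. star H (x * y) = star H y * star H x) \<and>
     (\<forall>x. comult H (star H x) =
          tensor_lift H H (\<lambda>a b. elem_tensor H H (star H a) (star H b)) (comult H x)) \<and>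
     (\<forall>x. counit H (star H x) = cnj (counit H x))"


section \<open>Comodules and CQG algebras\<close>

record ('h, 'm) comodule = "(complex, 'm) module" +
  coact :: "'m \<Rightarrow> ('m, 'h) tensor"

definition right_comodule ::
  "('h, 'n) coalgebra_scheme \<Rightarrow> ('h, 'm) comodule \<Rightarrow> bool" where
  "right_comodule H M \<longleftrightarrow>
     cvector_space M \<and>
     linear_between M (tensor_space M H) (coact M) \<and>
     (\<forall>m\<in>carrier M.
        tensor_assoc M H H (tensor_map M H (tensor_space M H) H (coact M) id (coact M m)) =
        tensor_map M H M (tensor_space H H) id (comult H) (coact M m)) \<and>
     (\<forall>m\<in>carrier M.
        tensor_map M H M complex_space id (counit H) (coact M m) = elem_tensor M complex_space m 1)"

definition comodule_map ::
  "('h, 'n) coalgebra_scheme \<Rightarrow> ('h, 'm) comodule \<Rightarrow> ('h, 'k) comodule \<Rightarrow> ('m \<Rightarrow> 'k) \<Rightarrow> bool" where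
  "comodule_map H M N f \<longleftrightarrow>
     linear_between M N f \<and>
     (\<forall>m\<in>carrier M. coact N (f m) = tensor_map M H N H f id (coact M m))"

text \<open>Linear forms are extended by 0 outside the carrier, so that equality of forms is equality of functions.\<close>

definition dual_space ::
  "(complex, 'm, 'n) module_scheme \<Rightarrow> (complex, 'm \<Rightarrow> complex) module" where
  "dual_space M =
     \<lparr>carrier = {f. linear_form M f \<and> (\<forall>x. x \<notin> carrier M \<longrightarrow> f x = 0)},
      mult = undefined, one = undefined,
      zero = 0, add = (+), smult = (\<lambda>c f x. c * f x)\<rparr>"

definition dual_comodule ::
  "('h::ring_1, 'n) hopf_star_algebra_scheme \<Rightarrow> ('h, 'm) comodule \<Rightarrow>
   ('h, 'm \<Rightarrow> complex) comodule" where
  "dual_comodule H M = 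
     \<lparr>carrier = carrier (dual_space M), mult = mult (dual_space M), one = one (dual_space M),
      zero = zero (dual_space M), add = add (dual_space M), smult = smult (dual_space M),
      coact = (\<lambda>f. THE t. t \<in> carrier (tensor_space (dual_space M) H) \<and>
        (\<forall>m\<in>carrier M.
           tensor_lift (dual_space M) H (\<lambda>f\<^sub>0 f\<^sub>1. f\<^sub>0 m \<odot>\<^bsub>H\<^esub> f\<^sub>1) t =
           tensor_lift M H (\<lambda>m\<^sub>0 m\<^sub>1. f m\<^sub>0 \<odot>\<^bsub>H\<^esub> antipode H m\<^sub>1) (coact M m)))\<rparr>"

definition conj_space :: "('h, 'm) comodule \<Rightarrow> ('h, 'm) comodule" where
  "conj_space M = M\<lparr>smult := (\<lambda>c. smult M (cnj c))\<rparr>"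

definition conj_comodule ::
  "('h, 'n) hopf_star_algebra_scheme \<Rightarrow> ('h, 'm) comodule \<Rightarrow> ('h, 'm) comodule" where
  "conj_comodule H M =
     (conj_space M)\<lparr>coact := (\<lambda>m.
        tensor_lift M H (\<lambda>m\<^sub>0 m\<^sub>1. elem_tensor (conj_space M) H m\<^sub>0 (star H m\<^sub>1)) (coact M m))\<rparr>"

text \<open>Inner products are linear in the first variable.\<close>

definition inner_product ::
  "(complex, 'm, 'n) module_scheme \<Rightarrow> ('m \<Rightarrow> 'm \<Rightarrow> complex) \<Rightarrow> bool" where
  "inner_product M ip \<longleftrightarrow>
     (\<forall>y\<in>carrier M. linear_form M (\<lambda>x. ip x y)) \<and>
     (\<forall>x\<in>carrier M. \<forall>y\<in>carrier M. ip y x = cnj (ip x y)) \<and>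
     (\<forall>x\<in>carrier M. x \<noteq> \<zero>\<^bsub>M\<^esub> \<longrightarrow> Re (ip x x) > 0)"

definition compatible_inner_product ::
  "('h::ring_1, 'n) hopf_star_algebra_scheme \<Rightarrow> ('h, 'm) comodule \<Rightarrow>
   ('m \<Rightarrow> 'm \<Rightarrow> complex) \<Rightarrow> bool" where
  "compatible_inner_product H M ip \<longleftrightarrow>
     inner_product M ip \<and>
     comodule_map H (conj_comodule H M) (dual_comodule H M)
       (\<lambda>y x. if x \<in> carrier M then ip x y else 0)"

text \<open>
  Every finite-dimensional complex vector space is isomorphic to one whose carrier is a set of
  complex sequences, so the quantifier over \<open>M\<close> ranges over all finite-dimensional comodules up
  to isomorphism.
\<close>

definition cqg_algebra :: "('h::ring_1, 'n) hopf_star_algebra_scheme \<Rightarrow> bool" where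
  "cqg_algebra H \<longleftrightarrow>
     is_hopf_star_algebra H \<and>
     (\<forall>M :: ('h, nat \<Rightarrow> complex) comodule. right_comodule H M \<and> finite_dim M \<longrightarrow>
        (\<exists>ip. compatible_inner_product H M ip))"


section \<open>Right coideal *-subalgebras\<close>

definition right_coideal_star_subalgebra ::
  "('h::ring_1, 'n) hopf_star_algebra_scheme \<Rightarrow> 'h set \<Rightarrow> bool" where
  "right_coideal_star_subalgebra H A \<longleftrightarrow>
     1 \<in> A \<and>
     (\<forall>x\<in>A. \<forall>y\<in>A. x + y \<in> A \<and> x * y \<in> A) \<and>
     (\<forall>c. \<forall>x\<in>A. c \<odot>\<^bsub>H\<^esub> x \<in> A) \<and>
     (\<forall>x\<in>A. star H x \<in> A) \<and>
     (\<forall>x\<in>A. comult H x \<in> subtensor H H A UNIV)"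

definition right_coideal_star_subalgebras ::
  "('h::ring_1, 'n) hopf_star_algebra_scheme \<Rightarrow> 'h set set" where
  "right_coideal_star_subalgebras H = {A. right_coideal_star_subalgebra H A}"

definition augmentation_part :: "('h, 'n) coalgebra_scheme \<Rightarrow> 'h set \<Rightarrow> 'h set" where
  "augmentation_part H A = {a \<in> A. counit H a = 0}"

text \<open>The left ideal \<open>HA\<^sup>+\<close>.\<close>

definition left_ideal_of ::
  "('h::ring_1, 'n) hopf_star_algebra_scheme \<Rightarrow> 'h set \<Rightarrow> 'h set" where
  "left_ideal_of H A = {\<Sum>(h, a)\<leftarrow>xs. h * a | xs. set xs \<subseteq> UNIV \<times> augmentation_part H A}"


section \<open>Quotient left module *-coalgebras\<close>

record ('h, 'c) module_star_coalgebra = "'c coalgebra" +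
  act :: "'h \<Rightarrow> 'c \<Rightarrow> 'c"
  costar :: "'c \<Rightarrow> 'c"

definition left_module_coalgebra ::
  "('h::ring_1, 'n) coalgebra_scheme \<Rightarrow> ('h, 'c) module_star_coalgebra \<Rightarrow> bool" where
  "left_module_coalgebra H C \<longleftrightarrow>
     is_coalgebra C \<and>
     (\<forall>h. linear_between C C (act C h)) \<and>
     (\<forall>c\<in>carrier C. linear_between H C (\<lambda>h. act C h c)) \<and>
     (\<forall>c\<in>carrier C. act C 1 c = c) \<and>
     (\<forall>h k. \<forall>c\<in>carrier C. act C (h * k) c = act C h (act C k c)) \<and>
     (\<forall>h. \<forall>c\<in>carrier C.
        comult C (act C h c) =
          tensor_lift H H (\<lambda>h\<^sub>1 h\<^sub>2.
            tensor_map C C C C (act C h\<^sub>1) (act C h\<^sub>2) (comult C c)) (comult H h)) \<and>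
     (\<forall>h. \<forall>c\<in>carrier C. counit C (act C h c) = counit H h * counit C c)"

definition star_coalgebra :: "('h, 'c) module_star_coalgebra \<Rightarrow> bool" where
  "star_coalgebra C \<longleftrightarrow>
     is_coalgebra C \<and>
     antilinear_between C C (costar C) \<and>
     (\<forall>x\<in>carrier C. costar C (costar C x) = x) \<and>
     (\<forall>x\<in>carrier C. comult C (costar C x) =
        tensor_lift C C (\<lambda>a b. elem_tensor C C (costar C b) (costar C a)) (comult C x))"

definition quotient_left_module_coalgebra ::
  "('h::ring_1, 'n) coalgebra_scheme \<Rightarrow> ('h, 'c) module_star_coalgebra \<Rightarrow> ('h \<Rightarrow> 'c) \<Rightarrow> bool" where
  "quotient_left_module_coalgebra H C \<pi> \<longleftrightarrow>
     left_module_coalgebra H C \<and>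
     \<pi> ` carrier H = carrier C \<and>
     coalgebra_map H C \<pi> \<and>
     (\<forall>h x. \<pi> (h * x) = act C h (\<pi> x))"

definition quotient_left_module_star_coalgebra ::
  "('h::ring_1, 'n) hopf_star_algebra_scheme \<Rightarrow> ('h, 'c) module_star_coalgebra \<Rightarrow>
   ('h \<Rightarrow> 'c) \<Rightarrow> bool" where
  "quotient_left_module_star_coalgebra H C \<pi> \<longleftrightarrow>
     quotient_left_module_coalgebra H C \<pi> \<and>
     star_coalgebra C \<and>
     (\<forall>x. \<pi> (star H (antipode H x)) = costar C (\<pi> x))"

text \<open>The space \<open>\<^sup>CH\<close> of left coinvariants.\<close>

definition coinvariants ::
  "('h::ring_1, 'n) coalgebra_scheme \<Rightarrow> (complex, 'c, 'o) module_scheme \<Rightarrow> ('h \<Rightarrow> 'c) \<Rightarrow> 'h set" where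
  "coinvariants H C \<pi> =
     {x. tensor_map H H C H \<pi> id (comult H x) = elem_tensor C H (\<pi> 1) x}"


subsection \<open>The quotient by a subspace\<close>

text \<open>
  The structure maps of \<open>H/K\<close> are obtained from maps on \<open>H\<close> that are constant on cosets; \<open>descend f X\<close>
  is the common value of \<open>f\<close> on \<open>X\<close>.
\<close>

definition descend :: "('h \<Rightarrow> 'b) \<Rightarrow> 'h set \<Rightarrow> 'b" where
  "descend f X = the_elem (f ` X)"

definition quotient_space ::
  "(complex, 'h, 'n) module_scheme \<Rightarrow> 'h set \<Rightarrow> (complex, 'h set) module" where
  "quotient_space H K =
     \<lparr>carrier = a_rcosets\<^bsub>H\<^esub> K,
      mult = undefined, one = undefined,
      zero = K,
      add = (\<lambda>X Y. X <+>\<^bsub>H\<^esub> Y),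
      smult = (\<lambda>c. descend (\<lambda>x. K +>\<^bsub>H\<^esub> (c \<odot>\<^bsub>H\<^esub> x)))\<rparr>"

definition quotient_coalgebra ::
  "('h::ring_1, 'n) hopf_star_algebra_scheme \<Rightarrow> 'h set \<Rightarrow> ('h, 'h set) module_star_coalgebra" where
  "quotient_coalgebra H K =
     \<lparr>carrier = carrier (quotient_space H K), mult = mult (quotient_space H K), one = one (quotient_space H K),
      zero = zero (quotient_space H K), add = add (quotient_space H K), smult = smult (quotient_space H K),
        comult = descend (\<lambda>x.
          tensor_map H H (quotient_space H K) (quotient_space H K)
            (\<lambda>y. K +>\<^bsub>H\<^esub> y) (\<lambda>y. K +>\<^bsub>H\<^esub> y) (comult H x)),
        counit = descend (counit H),
        act = (\<lambda>h. descend (\<lambda>x. K +>\<^bsub>H\<^esub> (h * x))),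
        costar = descend (\<lambda>x. K +>\<^bsub>H\<^esub> star H (antipode H x))\<rparr>"

text \<open>\<open>H\<^sub>A = H/HA\<^sup>+\<close>, together with the projection \<open>H \<rightarrow> H\<^sub>A\<close>.\<close>

definition quotient_of ::
  "('h::ring_1, 'n) hopf_star_algebra_scheme \<Rightarrow> 'h set \<Rightarrow>
   ('h, 'h set) module_star_coalgebra \<times> ('h \<Rightarrow> 'h set)" where
  "quotient_of H A =
     (quotient_coalgebra H (left_ideal_of H A), \<lambda>x. left_ideal_of H A +>\<^bsub>H\<^esub> x)"


subsection \<open>Quotients up to equality of kernels\<close>

text \<open>
  Every quotient of \<open>H\<close> is isomorphic to one whose elements are cosets, so it suffices to collect the
  quotients \<open>C\<close> with carrier in the type \<open>'h set\<close>.
\<close>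

definition quotients ::
  "('h::ring_1, 'n) hopf_star_algebra_scheme \<Rightarrow>
   (('h, 'h set) module_star_coalgebra \<times> ('h \<Rightarrow> 'h set)) set" where
  "quotients H = {(C, \<pi>). quotient_left_module_star_coalgebra H C \<pi>}"

definition same_kernel ::
  "('h::ring_1, 'n) hopf_star_algebra_scheme \<Rightarrow>
   (('h, 'h set) module_star_coalgebra \<times> ('h \<Rightarrow> 'h set)) rel" where
  "same_kernel H =
     {((C, \<pi>), (D, \<rho>)). (C, \<pi>) \<in> quotients H \<and> (D, \<rho>) \<in> quotients H \<and>
                          a_kernel H C \<pi> = a_kernel H D \<rho>}"

definition quotient_classes ::
  "('h::ring_1, 'n) hopf_star_algebra_scheme \<Rightarrow>
   (('h, 'h set) module_star_coalgebra \<times> ('h \<Rightarrow> 'h set)) set set" where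
  "quotient_classes H = quotients H // same_kernel H"

definition quotient_class_of ::
  "('h::ring_1, 'n) hopf_star_algebra_scheme \<Rightarrow> 'h set \<Rightarrow>
   (('h, 'h set) module_star_coalgebra \<times> ('h \<Rightarrow> 'h set)) set" where
  "quotient_class_of H A = same_kernel H `` {quotient_of H A}"

definition coinvariants_of_class ::
  "('h::ring_1, 'n) hopf_star_algebra_scheme \<Rightarrow>
   (('h, 'h set) module_star_coalgebra \<times> ('h \<Rightarrow> 'h set)) set \<Rightarrow> 'h set" where
  "coinvariants_of_class H X = the_elem ((\<lambda>(C, \<pi>). coinvariants H C \<pi>) ` X)"

end

theory Submission
  imports Defs
begin

text \<open>
  Write \<open>\<tau>(x) = (S x)\<^sup>*\<close> and, for a linear form \<open>\<phi>\<close> on \<open>H\<close>, \<open>L \<phi> x = \<phi>(x\<^sub>1) x\<^sub>2\<close> and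
  \<open>R \<phi> x = x\<^sub>1 \<phi>(x\<^sub>2)\<close>. Linear forms separate points, so every structure in sight is visible
  through these operators: a subspace is a right coideal iff it is stable under all \<open>R \<psi>\<close>, and \<open>x\<close>
  is coinvariant for \<open>H/K\<close> iff \<open>R \<psi> x - \<psi>(x) 1 \<in> K\<close> for all \<open>\<psi>\<close> (\<open>coinv\<close>). A quotient left module
  *-coalgebra is determined by its kernel, and the kernels are the left ideals \<open>K\<close> that are
  coideals and stable under \<open>\<tau>\<close> (\<open>quotient_kernel\<close>, \<open>kernel_of_quotient\<close>,
  \<open>quotient_coalgebra_of_kernel\<close>). The theorem therefore says that \<open>A \<mapsto> HA\<^sup>+\<close> and \<open>K \<mapsto> coinv K\<close> are
  mutually inverse. That both maps are well defined is a computation with the antipode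
  (\<open>left_ideal_quotient_kernel\<close>, \<open>coinv_star_coideal_algebra\<close>); the two identities are where the
  CQG condition does its work.

  The condition enters as follows (\<open>compatible_form\<close>): every finite-dimensional right coideal \<open>V\<close>
  has an inner product with \<open>L (\<cdot>,x) y = \<tau>(L (\<cdot>,y) x)\<close> for \<open>x, y \<in> V\<close>. For an orthonormal basis \<open>e\<close>
  this says that the matrix \<open>u\<^sub>i\<^sub>j = L (\<cdot>,e\<^sub>i) e\<^sub>j\<close> of \<open>V\<close> satisfies \<open>\<tau>(u\<^sub>i\<^sub>j) = u\<^sub>j\<^sub>i\<close>, so that it
  is unitary. Such coefficients span \<open>H\<close>, which also yields the standard properties of the
  antipode at once.

  \<open>K \<subseteq> H (coinv K)\<^sup>+\<close> (\<open>left_ideal_coinv\<close>): let \<open>V\<close> be a finite-dimensional subcoalgebra and choose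
  the orthonormal basis such that \<open>e\<^sub>i\<close>, \<open>i < r\<close>, is a basis of \<open>V \<inter> K\<close>. As \<open>K\<close> is a coideal and
  \<open>\<tau>\<close>-stable, \<open>u\<close> is block diagonal modulo \<open>K\<close>. With \<open>P\<close> the projection onto the first \<open>r\<close> coordinates,
  the entries of \<open>a = u\<^sup>* P u\<close> therefore lie in \<open>coinv K\<close>, and \<open>\<epsilon>(a) = P\<close>. Unitarity gives
  \<open>P u - u P = u (a - \<epsilon>(a))\<close>, whose entries are in \<open>H (coinv K)\<^sup>+\<close>; so the off-diagonal blocks of
  \<open>u\<close> are. Finally \<open>e\<^sub>l = \<Sum>\<^sub>m \<epsilon>(e\<^sub>m) u\<^sub>m\<^sub>l\<close> and \<open>\<epsilon>\<close> vanishes on \<open>K\<close>, so \<open>e\<^sub>l\<close> with \<open>l < r\<close> only involves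
  an off-diagonal block.

  \<open>coinv (HA\<^sup>+) \<subseteq> A\<close> (\<open>coinv_left_ideal\<close>): the Haar functional \<open>h\<close> exists (\<open>right_invariant_exists\<close>)
  and \<open>h(x y\<^sup>*)\<close> is positive definite (\<open>haar_form_positive\<close>). With respect to it \<open>H = A \<oplus> A\<^sup>\<bottom>\<close>
  (\<open>coideal_decomposition\<close>), where \<open>A\<^sup>\<bottom>\<close> is stable under right multiplication by \<open>A\<close> and under all
  \<open>R \<psi>\<close>; hence \<open>HA\<^sup>+ \<subseteq> A\<^sup>+ + A\<^sup>\<bottom>\<close>. If \<open>y \<in> A\<^sup>\<bottom>\<close> is coinvariant, then
  \<open>\<psi>(y) 1 \<in> A\<^sup>\<bottom> + HA\<^sup>+ \<subseteq> A\<^sup>\<bottom> + A\<^sup>+\<close>, which forces \<open>\<psi>(y) = 0\<close> for all \<open>\<psi>\<close>, that is \<open>y = 0\<close>.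
\<close>

section \<open>Tensors as functionals on bilinear forms\<close>

abbreviation tens :: "(complex, 'a, 'm) module_scheme \<Rightarrow> (complex, 'b, 'n) module_scheme \<Rightarrow> ('a, 'b) tensor set"
  where "tens V W \<equiv> subtensor V W (carrier V) (carrier W)"

lemma cspace_closed:
  assumes "cvector_space V"
  shows "x \<in> carrier V \<Longrightarrow> y \<in> carrier V \<Longrightarrow> x \<oplus>\<^bsub>V\<^esub> y \<in> carrier V"
    and "x \<in> carrier V \<Longrightarrow> c \<odot>\<^bsub>V\<^esub> x \<in> carrier V"
    and "\<zero>\<^bsub>V\<^esub> \<in> carrier V"
proof -
  interpret module complex_ring V by fact
  show "x \<in> carrier V \<Longrightarrow> y \<in> carrier V \<Longrightarrow> x \<oplus>\<^bsub>V\<^esub> y \<in> carrier V" by simp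
  show "x \<in> carrier V \<Longrightarrow> c \<odot>\<^bsub>V\<^esub> x \<in> carrier V"
    by (rule smult_closed) (auto simp: complex_ring_def)
  show "\<zero>\<^bsub>V\<^esub> \<in> carrier V" by simp
qed

lemma cspace_smult_zero:
  assumes "cvector_space V" "x \<in> carrier V"
  shows "0 \<odot>\<^bsub>V\<^esub> x = \<zero>\<^bsub>V\<^esub>"
proof -
  interpret module complex_ring V by fact
  show ?thesis using smult_l_null[OF assms(2)] by (simp add: complex_ring_def)
qed

lemma cspace_complex_ring: "cring complex_ring"
proof -
  have "\<exists>y. x + y = 0" for x :: complex by (rule exI[of _ "-x"]) simp
  then show ?thesis
    by unfold_locales
      (auto simp: complex_ring_def Units_def algebra_simps intro!: exI[of _ "- _"])
qed

lemma cspaceI: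
  assumes "abelian_group V"
    and "\<And>a x. x \<in> carrier V \<Longrightarrow> a \<odot>\<^bsub>V\<^esub> x \<in> carrier V"
    and "\<And>a b x. x \<in> carrier V \<Longrightarrow> (a + b) \<odot>\<^bsub>V\<^esub> x = a \<odot>\<^bsub>V\<^esub> x \<oplus>\<^bsub>V\<^esub> b \<odot>\<^bsub>V\<^esub> x"
    and "\<And>a x y. x \<in> carrier V \<Longrightarrow> y \<in> carrier V \<Longrightarrow>
           a \<odot>\<^bsub>V\<^esub> (x \<oplus>\<^bsub>V\<^esub> y) = a \<odot>\<^bsub>V\<^esub> x \<oplus>\<^bsub>V\<^esub> a \<odot>\<^bsub>V\<^esub> y"
    and "\<And>a b x. x \<in> carrier V \<Longrightarrow> (a * b) \<odot>\<^bsub>V\<^esub> x = a \<odot>\<^bsub>V\<^esub> (b \<odot>\<^bsub>V\<^esub> x)"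
    and "\<And>x. x \<in> carrier V \<Longrightarrow> 1 \<odot>\<^bsub>V\<^esub> x = x"
  shows "cvector_space V"
  by (rule moduleI[OF cspace_complex_ring assms(1)]) (use assms in \<open>auto simp: complex_ring_def\<close>)

lemma vector_space_functions:
  "vector_space (\<lambda>c (t :: 'a \<Rightarrow> complex) \<beta>. c * t \<beta>)"
  "vector_space (\<lambda>c (t :: 'a \<Rightarrow> complex) \<beta>. cnj c * t \<beta>)"
  by unfold_locales (auto simp: algebra_simps fun_eq_iff)

lemma vector_space_complex: "vector_space ((*) :: complex \<Rightarrow> complex \<Rightarrow> complex)"
  by unfold_locales (auto simp: algebra_simps)

lemma complex_space_simps [simp]:
  "carrier complex_space = UNIV" "add complex_space = (+)" "smult complex_space = (*)"
  by (auto simp: complex_space_def)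

lemma linear_form_iff:
  "linear_form V f \<longleftrightarrow>
     (\<forall>x\<in>carrier V. \<forall>y\<in>carrier V. f (x \<oplus>\<^bsub>V\<^esub> y) = f x + f y) \<and>
     (\<forall>c. \<forall>x\<in>carrier V. f (c \<odot>\<^bsub>V\<^esub> x) = c * f x)"
  by (auto simp: linear_between_def complex_space_def)

lemma bilinear_form_iff:
  "bilinear_form V W \<beta> \<longleftrightarrow>
     (\<forall>x\<in>carrier V. \<forall>x'\<in>carrier V. \<forall>y\<in>carrier W. \<beta> (x \<oplus>\<^bsub>V\<^esub> x') y = \<beta> x y + \<beta> x' y) \<and>
     (\<forall>x\<in>carrier V. \<forall>y\<in>carrier W. \<forall>y'\<in>carrier W. \<beta> x (y \<oplus>\<^bsub>W\<^esub> y') = \<beta> x y + \<beta> x y') \<and>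
     (\<forall>c. \<forall>x\<in>carrier V. \<forall>y\<in>carrier W. \<beta> (c \<odot>\<^bsub>V\<^esub> x) y = c * \<beta> x y) \<and>
     (\<forall>c. \<forall>x\<in>carrier V. \<forall>y\<in>carrier W. \<beta> x (c \<odot>\<^bsub>W\<^esub> y) = c * \<beta> x y)"
  by (auto simp: bilinear_form_def linear_form_iff)

definition trilinear_form where
  "trilinear_form U V W \<gamma> \<longleftrightarrow>
     (\<forall>v\<in>carrier V. \<forall>w\<in>carrier W. linear_form U (\<lambda>u. \<gamma> u v w)) \<and>
     (\<forall>u\<in>carrier U. bilinear_form V W (\<gamma> u))"

lemma tensor_of_list_simps [simp]:
  "tensor_of_list V W [] = 0"
  "tensor_of_list V W (p # xs) = elem_tensor V W (fst p) (snd p) + tensor_of_list V W xs"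
  "tensor_of_list V W (xs @ ys) = tensor_of_list V W xs + tensor_of_list V W ys"
  by (auto simp: tensor_of_list_def split: prod.splits)

lemma subtensorE:
  assumes "t \<in> subtensor V W A B"
  obtains xs where "set xs \<subseteq> A \<times> B" "t = tensor_of_list V W xs"
  using assms by (auto simp: subtensor_def)

lemma elem_tensor_in_subtensor: "x \<in> A \<Longrightarrow> y \<in> B \<Longrightarrow> elem_tensor V W x y \<in> subtensor V W A B"
  by (auto simp: subtensor_def intro!: exI[of _ "[(x, y)]"])

lemma zero_in_subtensor: "0 \<in> subtensor V W A B"
  by (auto simp: subtensor_def intro!: exI[of _ "[]"])

lemma add_in_subtensor:
  assumes "s \<in> subtensor V W A B" "t \<in> subtensor V W A B" shows "s + t \<in> subtensor V W A B"
proof -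
  obtain xs ys where "set xs \<subseteq> A \<times> B" "s = tensor_of_list V W xs" "set ys \<subseteq> A \<times> B" "t = tensor_of_list V W ys"
    using assms by (auto elim!: subtensorE)
  then show ?thesis
    by (auto simp: subtensor_def intro!: exI[of _ "xs @ ys"])
qed

lemma sum_in_subtensor:
  "(\<And>i. i \<in> I \<Longrightarrow> f i \<in> subtensor V W A B) \<Longrightarrow> sum f I \<in> subtensor V W A B"
  by (induction I rule: infinite_finite_induct) (auto intro: zero_in_subtensor add_in_subtensor)

lemma sum_fun_apply: "(\<Sum>i\<in>I. f i) x = (\<Sum>i\<in>I. f i x)" for f :: "'i \<Rightarrow> 'a \<Rightarrow> 'b::comm_monoid_add"
  by (induction I rule: infinite_finite_induct) auto

lemma tensor_nonbilinear: "t \<in> subtensor V W A B \<Longrightarrow> \<not> bilinear_form V W \<beta> \<Longrightarrow> t \<beta> = 0"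
proof (elim subtensorE)
  fix xs assume "t = tensor_of_list V W xs" "\<not> bilinear_form V W \<beta>"
  then show "t \<beta> = 0" by (induction xs arbitrary: t) (auto simp: elem_tensor_def)
qed

lemma tensor_eqI:
  assumes "s \<in> subtensor V W A B" "t \<in> subtensor V W A' B'"
    and "\<And>\<beta>. bilinear_form V W \<beta> \<Longrightarrow> s \<beta> = t \<beta>"
  shows "s = t"
proof
  fix \<beta> show "s \<beta> = t \<beta>"
    using assms(3)[of \<beta>] tensor_nonbilinear[OF assms(1), of \<beta>] tensor_nonbilinear[OF assms(2), of \<beta>]
    by (cases "bilinear_form V W \<beta>") auto
qed

lemma scale_in_tens:
  assumes "cvector_space V" "t \<in> tens V W" shows "(\<lambda>\<beta>. c * t \<beta>) \<in> tens V W"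
proof -
  obtain xs where xs: "set xs \<subseteq> carrier V \<times> carrier W" "t = tensor_of_list V W xs"
    using assms by (auto elim: subtensorE)
  show ?thesis unfolding xs(2) using xs(1)
  proof (induction xs)
    case Nil then show ?case using zero_in_subtensor[of V W] by (simp add: zero_fun_def)
  next
    case (Cons p xs)
    have "(\<lambda>\<beta>. c * tensor_of_list V W (p # xs) \<beta>) =
        elem_tensor V W (c \<odot>\<^bsub>V\<^esub> fst p) (snd p) + (\<lambda>\<beta>. c * tensor_of_list V W xs \<beta>)"
      using Cons.prems by (subst elem_tensor_scale) (auto simp: algebra_simps fun_eq_iff)
    also have "\<dots> \<in> tens V W"
      using Cons cspace_closed(2)[OF assms(1)]
      by (intro add_in_subtensor elem_tensor_in_subtensor) auto
    finally show ?case .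
  qed
qed

lemma tensor_apply_bilinear:
  assumes t: "t \<in> tens V W"
  shows "bilinear_form V W \<beta> \<Longrightarrow> bilinear_form V W \<gamma> \<Longrightarrow> t (\<lambda>x y. \<beta> x y + \<gamma> x y) = t \<beta> + t \<gamma>"
    and "bilinear_form V W \<beta> \<Longrightarrow> t (\<lambda>x y. c * \<beta> x y) = c * t \<beta>"
proof -
  obtain xs where xs: "set xs \<subseteq> carrier V \<times> carrier W" "t = tensor_of_list V W xs"
    using t by (auto elim: subtensorE)
  { assume b: "bilinear_form V W \<beta>" "bilinear_form V W \<gamma>"
    have c: "bilinear_form V W (\<lambda>x y. \<beta> x y + \<gamma> x y)"
      using b by (auto simp: bilinear_form_iff algebra_simps)
    show "t (\<lambda>x y. \<beta> x y + \<gamma> x y) = t \<beta> + t \<gamma>"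
      unfolding xs(2) tensor_of_list_apply[OF b(1)] tensor_of_list_apply[OF b(2)]
        tensor_of_list_apply[OF c] by (induction xs) auto }
  { assume b: "bilinear_form V W \<beta>"
    have c: "bilinear_form V W (\<lambda>x y. c * \<beta> x y)"
      using b by (auto simp: bilinear_form_iff algebra_simps)
    show "t (\<lambda>x y. c * \<beta> x y) = c * t \<beta>"
      unfolding xs(2) tensor_of_list_apply[OF b(1)]
        tensor_of_list_apply[OF c] by (induction xs) (auto simp: algebra_simps) }
qed

lemma bilinear_form_cong:
  assumes "cvector_space V" "cvector_space W"
    and "\<And>x y. x \<in> carrier V \<Longrightarrow> y \<in> carrier W \<Longrightarrow> \<beta> x y = \<gamma> x y"
  shows "bilinear_form V W \<beta> \<longleftrightarrow> bilinear_form V W \<gamma>"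
  using assms(3) cspace_closed[OF assms(1)] cspace_closed[OF assms(2)] 
  by (simp add: bilinear_form_iff)

lemma tensor_apply_cong:
  assumes "cvector_space V" "cvector_space W" and t: "t \<in> tens V W"
    and eq: "\<And>x y. x \<in> carrier V \<Longrightarrow> y \<in> carrier W \<Longrightarrow> \<beta> x y = \<gamma> x y"
  shows "t \<beta> = t \<gamma>"
proof (cases "bilinear_form V W \<beta>")
  case True
  then have c: "bilinear_form V W \<gamma>" using bilinear_form_cong[OF assms(1,2), of \<beta> \<gamma>] eq by blast
  obtain xs where xs: "set xs \<subseteq> carrier V \<times> carrier W" "t = tensor_of_list V W xs"
    using t by (auto elim: subtensorE)
  show ?thesis
    unfolding xs(2) tensor_of_list_apply[OF True] tensor_of_list_apply[OF c]
    using xs(1) eq by (intro arg_cong[where f = sum_list] map_cong) auto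
next
  case False
  then have "\<not> bilinear_form V W \<gamma>" using bilinear_form_cong[OF assms(1,2), of \<beta> \<gamma>] eq by blast
  then show ?thesis using False tensor_nonbilinear[OF t] by simp
qed

text \<open>
  Tensors are functionals on bilinear forms, so a lift with values in tensors can be computed
  by fixing the form \<open>\<gamma>\<close> at which the result is evaluated.
\<close>

lemma tensor_lift_apply:
  fixes b :: "'a \<Rightarrow> 'b \<Rightarrow> 'c \<Rightarrow> complex"
  assumes t: "t \<in> tens V W" and b: "\<And>\<gamma>. bilinear_form V W (\<lambda>x y. b x y \<gamma>)"
  shows "tensor_lift V W b t \<gamma> = t (\<lambda>x y. b x y \<gamma>)"
proof -
  obtain xs where xs: "set xs \<subseteq> carrier V \<times> carrier W" "t = tensor_of_list V W xs"
    using t by (auto elim: subtensorE)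
  have "tensor_lift V W b t = (\<Sum>(x, y)\<leftarrow>xs. b x y)"
    unfolding xs(2)
    by (rule tensor_lift_sum[OF vector_space_functions(1)])
      (use b xs(1) in \<open>auto simp: bilinear_form_iff fun_eq_iff\<close>)
  moreover have "(\<Sum>(x, y)\<leftarrow>xs. b x y) \<gamma> = (\<Sum>(x, y)\<leftarrow>xs. b x y \<gamma>)"
    by (induction xs) auto
  ultimately show ?thesis by (simp add: xs(2) tensor_of_list_apply[OF b])
qed

text \<open>
  Conjugating the values turns a map that is antilinear in both arguments into a bilinear
  form, at which \<open>t\<close> can be evaluated.
\<close>

lemma tensor_lift_antilinear:
  fixes b :: "'a \<Rightarrow> 'b \<Rightarrow> 'c \<Rightarrow> complex"
  assumes t: "t \<in> tens V W" and b: "\<And>\<gamma>. bilinear_form V W (\<lambda>x y. cnj (b x y \<gamma>))"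
  shows "tensor_lift V W b t \<gamma> = cnj (t (\<lambda>x y. cnj (b x y \<gamma>)))"
proof -
  obtain xs where xs: "set xs \<subseteq> carrier V \<times> carrier W" "t = tensor_of_list V W xs"
    using t by (auto elim: subtensorE)
  have b': "b (x \<oplus>\<^bsub>V\<^esub> x') y \<gamma> = b x y \<gamma> + b x' y \<gamma>" "b x (y \<oplus>\<^bsub>W\<^esub> y') \<gamma> = b x y \<gamma> + b x y' \<gamma>"
    "b (c \<odot>\<^bsub>V\<^esub> x) y \<gamma> = cnj c * b x y \<gamma>" "b x (c \<odot>\<^bsub>W\<^esub> y) \<gamma> = cnj c * b x y \<gamma>"
    if "x \<in> carrier V" "x' \<in> carrier V" "y \<in> carrier W" "y' \<in> carrier W" for x x' y y' c \<gamma>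
  proof -
    have eq: "cnj (b x y \<gamma>) = z \<longleftrightarrow> b x y \<gamma> = cnj z" for x y z by auto
    show "b (x \<oplus>\<^bsub>V\<^esub> x') y \<gamma> = b x y \<gamma> + b x' y \<gamma>" "b x (y \<oplus>\<^bsub>W\<^esub> y') \<gamma> = b x y \<gamma> + b x y' \<gamma>"
      "b (c \<odot>\<^bsub>V\<^esub> x) y \<gamma> = cnj c * b x y \<gamma>" "b x (c \<odot>\<^bsub>W\<^esub> y) \<gamma> = cnj c * b x y \<gamma>"
      using b[of \<gamma>] that unfolding bilinear_form_iff eq by simp_all
  qed
  have "tensor_lift V W b t = (\<Sum>(x, y)\<leftarrow>xs. b x y)"
    unfolding xs(2)
    by (rule tensor_lift_sum[OF vector_space_functions(2)])
      (use b' xs(1) in \<open>auto simp: fun_eq_iff\<close>)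
  moreover have "(\<Sum>(x, y)\<leftarrow>xs. b x y) \<gamma> = cnj (\<Sum>(x, y)\<leftarrow>xs. cnj (b x y \<gamma>))"
    by (induction xs) auto
  ultimately show ?thesis by (simp add: xs(2) tensor_of_list_apply[OF b])
qed

lemma tensor_lift_in:
  assumes t: "t \<in> tens V W" and b: "\<And>\<gamma>. bilinear_form V W (\<lambda>x y. b x y \<gamma>)"
    and "\<And>x y. x \<in> carrier V \<Longrightarrow> y \<in> carrier W \<Longrightarrow> b x y \<in> subtensor V' W' A B"
  shows "tensor_lift V W b t \<in> subtensor V' W' A B"
proof -
  obtain xs where xs: "set xs \<subseteq> carrier V \<times> carrier W" "t = tensor_of_list V W xs"
    using t by (auto elim: subtensorE)
  have "tensor_lift V W b t = (\<Sum>(x, y)\<leftarrow>xs. b x y)"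
    unfolding xs(2)
    by (rule tensor_lift_sum[OF vector_space_functions(1)])
      (use b xs(1) in \<open>auto simp: bilinear_form_iff fun_eq_iff\<close>)
  also have "\<dots> \<in> subtensor V' W' A B"
    using xs(1) by (induction xs) (auto intro: zero_in_subtensor add_in_subtensor assms(3))
  finally show ?thesis .
qed

lemma elem_tensor_apply:
  "elem_tensor V W x y \<beta> = (if bilinear_form V W \<beta> then \<beta> x y else 0)"
  by (simp add: elem_tensor_def)

lemma bilinear_elem_tensor:
  assumes "linear_between V V' f" "linear_between W W' g"
  shows "bilinear_form V W (\<lambda>x y. elem_tensor V' W' (f x) (g y) \<beta>)"
  using assms
  by (auto simp: bilinear_form_iff elem_tensor_apply linear_between_def Pi_iff)

lemma linear_between_id: "linear_between V V id"
  by (auto simp: linear_between_def)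

lemma tensor_map_apply:
  assumes "t \<in> tens V W" "linear_between V V' f" "linear_between W W' g"
  shows "tensor_map V W V' W' f g t \<beta> = (if bilinear_form V' W' \<beta> then t (\<lambda>x y. \<beta> (f x) (g y)) else 0)"
proof -
  obtain xs where xs: "set xs \<subseteq> carrier V \<times> carrier W" "t = tensor_of_list V W xs"
    using assms(1) by (auto elim: subtensorE)
  have b0: "bilinear_form V W (\<lambda>x y. 0)" by (auto simp: bilinear_form_iff)
  have "t (\<lambda>x y. 0) = 0"
    unfolding xs(2) tensor_of_list_apply[OF b0] by (induction xs) auto
  then show ?thesis
    unfolding tensor_map_def tensor_lift_apply[OF assms(1) bilinear_elem_tensor[OF assms(2,3)]]
    by (simp add: elem_tensor_apply)
qed

lemma tensor_map_in:
  assumes "t \<in> tens V W" "linear_between V V' f" "linear_between W W' g"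
  shows "tensor_map V W V' W' f g t \<in> tens V' W'"
  unfolding tensor_map_def
  by (rule tensor_lift_in[OF assms(1) bilinear_elem_tensor[OF assms(2,3)]])
    (use assms in \<open>auto intro!: elem_tensor_in_subtensor simp: linear_between_def\<close>)

lemma tensor_space_simps [simp]:
  "carrier (tensor_space V W) = tens V W"
  "add (tensor_space V W) = (+)"
  "zero (tensor_space V W) = 0"
  "smult (tensor_space V W) = (\<lambda>c t \<beta>. c * t \<beta>)"
  "one (tensor_space V W) = elem_tensor V W \<one>\<^bsub>V\<^esub> \<one>\<^bsub>W\<^esub>"
  by (auto simp: tensor_space_def)

lemma cspace_tensor_space:
  assumes "cvector_space V" shows "cvector_space (tensor_space V W)"
proof (rule cspaceI)
  show "abelian_group (tensor_space V W)"
  proof (rule abelian_groupI)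
    fix t assume "t \<in> carrier (tensor_space V W)"
    then show "\<exists>s\<in>carrier (tensor_space V W). s \<oplus>\<^bsub>tensor_space V W\<^esub> t = \<zero>\<^bsub>tensor_space V W\<^esub>"
      using scale_in_tens[OF assms, of t W "-1"]
      by (intro bexI[of _ "\<lambda>\<beta>. -1 * t \<beta>"]) (auto simp: fun_eq_iff)
  qed (auto intro: add_in_subtensor zero_in_subtensor)
qed (auto intro: scale_in_tens[OF assms] simp: fun_eq_iff algebra_simps)

lemma linear_form_on_tensors:
  assumes F: "linear_form (tensor_space V W) F" and t: "t \<in> tens V W"
  shows "F t = t (\<lambda>x y. F (elem_tensor V W x y))"
    and "bilinear_form V W (\<lambda>x y. F (elem_tensor V W x y))"
proof -
  show b: "bilinear_form V W (\<lambda>x y. F (elem_tensor V W x y))"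
    using F by (auto simp: bilinear_form_iff linear_form_iff elem_tensor_biadditive elem_tensor_scale elem_tensor_in_subtensor)
  obtain xs where xs: "set xs \<subseteq> carrier V \<times> carrier W" "t = tensor_of_list V W xs"
    using t by (auto elim: subtensorE)
  have 0: "F 0 = 0"
    using F zero_in_subtensor[of V W] unfolding linear_form_iff by (metis add_cancel_right_right tensor_space_simps(1,2))
  have "tensor_of_list V W xs \<in> tens V W \<and> F (tensor_of_list V W xs) = (\<Sum>(x, y)\<leftarrow>xs. F (elem_tensor V W x y))"
    using xs(1)
  proof (induction xs)
    case (Cons p xs)
    have 1: "elem_tensor V W (fst p) (snd p) \<in> tens V W"
      using Cons.prems by (auto intro: elem_tensor_in_subtensor)
    have 2: "tensor_of_list V W xs \<in> tens V W \<and> F (tensor_of_list V W xs) = (\<Sum>(x, y)\<leftarrow>xs. F (elem_tensor V W x y))"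
      using Cons by auto
    have "F (elem_tensor V W (fst p) (snd p) + tensor_of_list V W xs) =
        F (elem_tensor V W (fst p) (snd p)) + F (tensor_of_list V W xs)"
      using F 1 2 by (simp add: linear_form_iff)
    moreover have "(\<Sum>(x, y)\<leftarrow>p # xs. F (elem_tensor V W x y)) =
        F (elem_tensor V W (fst p) (snd p)) + (\<Sum>(x, y)\<leftarrow>xs. F (elem_tensor V W x y))"
      by (cases p) simp
    ultimately show ?case
      unfolding tensor_of_list_simps(2) using 2 add_in_subtensor[OF 1, of "tensor_of_list V W xs"] by presburger
  qed (simp add: 0 zero_in_subtensor)
  then show "F t = t (\<lambda>x y. F (elem_tensor V W x y))"
    by (simp add: xs(2) tensor_of_list_apply[OF b])
qed

text \<open>
  The sums \<open>\<Sum> \<gamma>(x\<^sub>1\<^sub>1, x\<^sub>1\<^sub>2, x\<^sub>2)\<close> and \<open>\<Sum> \<gamma>(x\<^sub>1, x\<^sub>2\<^sub>1, x\<^sub>2\<^sub>2)\<close> are evaluations of tensors at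
  these two forms.
\<close>

lemma bilinear_of_trilinear:
  assumes "cvector_space U" "cvector_space W" "trilinear_form U V W \<gamma>"
  shows "bilinear_form U (tensor_space V W) (\<lambda>u s. s (\<gamma> u))"
    and "bilinear_form (tensor_space U V) W (\<lambda>s w. s (\<lambda>u v. \<gamma> u v w))"
proof -
  have b1: "bilinear_form V W (\<gamma> u)" if "u \<in> carrier U" for u
    using assms that by (auto simp: trilinear_form_def)
  have b2: "bilinear_form U V (\<lambda>u v. \<gamma> u v w)" if "w \<in> carrier W" for w
    using assms that by (auto simp: trilinear_form_def linear_form_iff bilinear_form_iff)
  note cl = cspace_closed[OF assms(1)] cspace_closed[OF assms(2)]
  have 1: "s (\<gamma> (u \<oplus>\<^bsub>U\<^esub> u')) = s (\<gamma> u) + s (\<gamma> u')" "s (\<gamma> (c \<odot>\<^bsub>U\<^esub> u)) = c * s (\<gamma> u)"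
    if s: "s \<in> tens V W" and u: "u \<in> carrier U" "u' \<in> carrier U" for s u u' c
  proof -
    have "\<gamma> (u \<oplus>\<^bsub>U\<^esub> u') v w = \<gamma> u v w + \<gamma> u' v w" "\<gamma> (c \<odot>\<^bsub>U\<^esub> u) v w = c * \<gamma> u v w"
      if "v \<in> carrier V" "w \<in> carrier W" for v w
      using assms(3) u that by (auto simp: trilinear_form_def linear_form_iff)
    note eq = this
    obtain xs where xs: "set xs \<subseteq> carrier V \<times> carrier W" "s = tensor_of_list V W xs"
      using s by (auto elim: subtensorE)
    show "s (\<gamma> (u \<oplus>\<^bsub>U\<^esub> u')) = s (\<gamma> u) + s (\<gamma> u')" "s (\<gamma> (c \<odot>\<^bsub>U\<^esub> u)) = c * s (\<gamma> u)"
      using xs(1) cl u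
      by (simp_all add: xs(2) tensor_of_list_apply[OF b1]) (induction xs; auto simp: eq algebra_simps)+
  qed
  have 2: "s (\<lambda>u v. \<gamma> u v (w \<oplus>\<^bsub>W\<^esub> w')) = s (\<lambda>u v. \<gamma> u v w) + s (\<lambda>u v. \<gamma> u v w')"
      "s (\<lambda>u v. \<gamma> u v (c \<odot>\<^bsub>W\<^esub> w)) = c * s (\<lambda>u v. \<gamma> u v w)"
    if s: "s \<in> tens U V" and w: "w \<in> carrier W" "w' \<in> carrier W" for s w w' c
  proof -
    have "\<gamma> u v (w \<oplus>\<^bsub>W\<^esub> w') = \<gamma> u v w + \<gamma> u v w'" "\<gamma> u v (c \<odot>\<^bsub>W\<^esub> w) = c * \<gamma> u v w"
      if "u \<in> carrier U" "v \<in> carrier V" for u v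
      using assms(3) w that by (auto simp: trilinear_form_def bilinear_form_iff)
    note eq = this
    obtain xs where xs: "set xs \<subseteq> carrier U \<times> carrier V" "s = tensor_of_list U V xs"
      using s by (auto elim: subtensorE)
    show "s (\<lambda>u v. \<gamma> u v (w \<oplus>\<^bsub>W\<^esub> w')) = s (\<lambda>u v. \<gamma> u v w) + s (\<lambda>u v. \<gamma> u v w')"
      "s (\<lambda>u v. \<gamma> u v (c \<odot>\<^bsub>W\<^esub> w)) = c * s (\<lambda>u v. \<gamma> u v w)"
      using xs(1) cl w
      by (simp_all add: xs(2) tensor_of_list_apply[OF b2]) (induction xs; auto simp: eq algebra_simps)+
  qed
  show "bilinear_form U (tensor_space V W) (\<lambda>u s. s (\<gamma> u))"
    using 1 by (auto simp: bilinear_form_iff)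
  show "bilinear_form (tensor_space U V) W (\<lambda>s w. s (\<lambda>u v. \<gamma> u v w))"
    using 2 by (auto simp: bilinear_form_iff)
qed

lemma trilinear_of_bilinear:
  assumes "bilinear_form U (tensor_space V W) \<beta>"
  shows "trilinear_form U V W (\<lambda>u v w. \<beta> u (elem_tensor V W v w))"
  using assms
  by (auto simp: trilinear_form_def linear_form_iff bilinear_form_iff elem_tensor_biadditive
      elem_tensor_scale elem_tensor_in_subtensor)

lemma tensor_assoc_apply:
  assumes U: "cvector_space U" and V: "cvector_space V" and W: "cvector_space W"
    and t: "t \<in> tens (tensor_space U V) W"
  shows "tensor_assoc U V W t \<gamma> =
      (if bilinear_form U (tensor_space V W) \<gamma>
       then t (\<lambda>s w. s (\<lambda>u v. \<gamma> u (elem_tensor V W v w))) else 0)"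
    and "tensor_assoc U V W t \<in> tens U (tensor_space V W)"
proof -
  let ?b = "\<lambda>w u v. elem_tensor U (tensor_space V W) u (elem_tensor V W v w)"
  have tri: "trilinear_form U V W (\<lambda>u v w. ?b w u v \<gamma>)" for \<gamma>
    using trilinear_of_bilinear[OF bilinear_elem_tensor[OF linear_between_id linear_between_id]]
    by simp
  have b2: "bilinear_form U V (\<lambda>u v. ?b w u v \<gamma>)" if "w \<in> carrier W" for w \<gamma>
    using tri[of \<gamma>] that by (auto simp: trilinear_form_def linear_form_iff bilinear_form_iff)
  have l: "tensor_lift U V (?b w) s \<gamma> = s (\<lambda>u v. ?b w u v \<gamma>)"
    if "s \<in> tens U V" "w \<in> carrier W" for s w \<gamma>
    using tensor_lift_apply[OF that(1) b2[OF that(2)]] .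
  have b: "bilinear_form (tensor_space U V) W (\<lambda>s w. tensor_lift U V (?b w) s \<gamma>)" for \<gamma>
    using bilinear_of_trilinear(2)[OF U W tri[of \<gamma>]]
      bilinear_form_cong[OF cspace_tensor_space[OF U] W, of V "\<lambda>s w. tensor_lift U V (?b w) s \<gamma>" "\<lambda>s w. s (\<lambda>u v. ?b w u v \<gamma>)"]
    by (simp add: l)
  have "tensor_assoc U V W t \<gamma> = t (\<lambda>s w. tensor_lift U V (?b w) s \<gamma>)"
    unfolding tensor_assoc_def by (rule tensor_lift_apply[OF t b])
  also have "\<dots> = t (\<lambda>s w. s (\<lambda>u v. ?b w u v \<gamma>))"
    by (rule tensor_apply_cong[OF cspace_tensor_space[OF U] W t]) (simp add: l)
  also have "\<dots> = (if bilinear_form U (tensor_space V W) \<gamma>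
       then t (\<lambda>s w. s (\<lambda>u v. \<gamma> u (elem_tensor V W v w))) else 0)"
  proof (cases "bilinear_form U (tensor_space V W) \<gamma>")
    case False
    have b0: "bilinear_form (tensor_space U V) W (\<lambda>s w. 0)" "bilinear_form U V (\<lambda>s w. 0)"
      by (auto simp: bilinear_form_iff)
    have z: "t (\<lambda>x y. 0) = 0" using tensor_apply_bilinear(2)[OF t b0(1), of 0] by simp
    have "s (\<lambda>x y. 0) = 0" if "s \<in> tens U V" for s
      using tensor_apply_bilinear(2)[OF that b0(2), of 0] by simp
    then have "t (\<lambda>s w. s (\<lambda>x y. 0)) = t (\<lambda>x y. 0)"
      by (intro tensor_apply_cong[OF cspace_tensor_space[OF U] W t]) simp
    then show ?thesis using False z by (simp add: elem_tensor_apply)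
  qed (simp add: elem_tensor_apply)
  finally show "tensor_assoc U V W t \<gamma> =
      (if bilinear_form U (tensor_space V W) \<gamma>
       then t (\<lambda>s w. s (\<lambda>u v. \<gamma> u (elem_tensor V W v w))) else 0)" .
  show "tensor_assoc U V W t \<in> tens U (tensor_space V W)"
    unfolding tensor_assoc_def
    by (rule tensor_lift_in[OF t b])
      (auto intro!: tensor_lift_in[where V = U and W = V] b2 elem_tensor_in_subtensor)
qed

text \<open>
  A bilinear form on \<open>M \<times> (H \<otimes> H)\<close> is the same thing as a trilinear form on \<open>M \<times> H \<times> H\<close>, and
  evaluating both sides of the coassociative law at it gives the two iterated sums.
\<close>

lemma coassociative_iff:
  assumes M: "cvector_space M" and H: "cvector_space H"
    and \<rho>: "linear_between M (tensor_space M H) \<rho>" and \<delta>: "linear_between H (tensor_space H H) \<delta>"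
    and t: "t \<in> tens M H"
  shows "tensor_assoc M H H (tensor_map M H (tensor_space M H) H \<rho> id t) =
           tensor_map M H M (tensor_space H H) id \<delta> t \<longleftrightarrow>
         (\<forall>\<gamma>. trilinear_form M H H \<gamma> \<longrightarrow>
            t (\<lambda>m h. \<rho> m (\<lambda>a b. \<gamma> a b h)) = t (\<lambda>m h. \<delta> h (\<gamma> m)))" (is "?l = ?r \<longleftrightarrow> ?R")
proof -
  have \<rho>m: "\<rho> m \<in> tens M H" if "m \<in> carrier M" for m using \<rho> that by (auto simp: linear_between_def)
  have \<delta>m: "\<delta> m \<in> tens H H" if "m \<in> carrier H" for m using \<delta> that by (auto simp: linear_between_def)
  have m: "tensor_map M H (tensor_space M H) H \<rho> id t \<in> tens (tensor_space M H) H"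
    by (rule tensor_map_in[OF t \<rho> linear_between_id])
  have l: "?l \<beta> = t (\<lambda>m h. \<rho> m (\<lambda>a b. \<beta> a (elem_tensor H H b h)))"
    if "bilinear_form M (tensor_space H H) \<beta>" for \<beta>
  proof -
    have "trilinear_form M H H (\<lambda>u v w. \<beta> u (elem_tensor H H v w))"
      by (rule trilinear_of_bilinear[OF that])
    from bilinear_of_trilinear(2)[OF M H this] show ?thesis
      unfolding tensor_assoc_apply(1)[OF M H H m] using that
      by (simp add: tensor_map_apply[OF t \<rho> linear_between_id])
  qed
  have r: "?r \<beta> = t (\<lambda>m h. \<delta> h (\<lambda>a b. \<beta> m (elem_tensor H H a b)))"
    if b: "bilinear_form M (tensor_space H H) \<beta>" for \<beta>
  proof -
    have "\<beta> m (\<delta> h) = \<delta> h (\<lambda>a b. \<beta> m (elem_tensor H H a b))" if "m \<in> carrier M" "h \<in> carrier H" for m h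
      using b that \<delta>m by (intro linear_form_on_tensors(1)) (auto simp: bilinear_form_def)
    then have "t (\<lambda>m h. \<beta> m (\<delta> h)) = t (\<lambda>m h. \<delta> h (\<lambda>a b. \<beta> m (elem_tensor H H a b)))"
      by (rule tensor_apply_cong[OF M H t])
    then show ?thesis
      using b by (simp add: tensor_map_apply[OF t linear_between_id \<delta>])
  qed
  have lr: "?l \<in> tens M (tensor_space H H)" "?r \<in> tens M (tensor_space H H)"
    by (rule tensor_assoc_apply(2)[OF M H H m]) (rule tensor_map_in[OF t linear_between_id \<delta>])
  show ?thesis
  proof
    assume eq: "?l = ?r"
    show ?R
    proof (intro allI impI)
      fix \<gamma> assume tri: "trilinear_form M H H \<gamma>"
      note b = bilinear_of_trilinear(1)[OF M H tri]
      have b1: "bilinear_form H H (\<gamma> a)" if "a \<in> carrier M" for a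
        using tri that by (auto simp: trilinear_form_def)
      have 1: "\<rho> m (\<lambda>a b. \<gamma> a b h) = \<rho> m (\<lambda>a b. elem_tensor H H b h (\<gamma> a))" if "m \<in> carrier M" for m h
        by (rule tensor_apply_cong[OF M H \<rho>m[OF that]]) (simp add: elem_tensor_apply b1)
      have 2: "\<delta> h (\<lambda>a b. elem_tensor H H a b (\<gamma> m)) = \<delta> h (\<gamma> m)" if "m \<in> carrier M" "h \<in> carrier H" for m h
        using that by (simp add: elem_tensor_apply b1)
      have "t (\<lambda>m h. \<rho> m (\<lambda>a b. \<gamma> a b h)) = t (\<lambda>m h. \<rho> m (\<lambda>a b. elem_tensor H H b h (\<gamma> a)))"
        by (rule tensor_apply_cong[OF M H t]) (rule 1)
      also have "\<dots> = t (\<lambda>m h. \<delta> h (\<lambda>a b. elem_tensor H H a b (\<gamma> m)))"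
        using l[OF b] r[OF b] eq by simp
      also have "\<dots> = t (\<lambda>m h. \<delta> h (\<gamma> m))"
        by (rule tensor_apply_cong[OF M H t]) (rule 2)
      finally show "t (\<lambda>m h. \<rho> m (\<lambda>a b. \<gamma> a b h)) = t (\<lambda>m h. \<delta> h (\<gamma> m))" .
    qed
  next
    assume R: ?R
    show "?l = ?r"
    proof (rule tensor_eqI[OF lr])
      fix \<beta> assume b: "bilinear_form M (tensor_space H H) \<beta>"
      have "trilinear_form M H H (\<lambda>u v w. \<beta> u (elem_tensor H H v w))"
        by (rule trilinear_of_bilinear[OF b])
      then show "?l \<beta> = ?r \<beta>" using R l[OF b] r[OF b] by simp
    qed
  qed
qed

lemma linear_form_scaled:
  assumes "linear_form complex_space (\<lambda>c. f c)" shows "f c = c * f 1"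
  using assms unfolding linear_form_iff complex_space_simps
  by (metis UNIV_I mult.right_neutral)

text \<open>
  A bilinear form on \<open>\<complex> \<times> W\<close> is determined by the linear form that it induces on \<open>{1} \<times> W\<close>.
\<close>

lemma counit_left_iff:
  assumes V: "cvector_space V" and W: "cvector_space W" and "linear_form V \<epsilon>" and t: "t \<in> tens V W" and x: "x \<in> carrier W"
  shows "tensor_map V W complex_space W \<epsilon> id t = elem_tensor complex_space W 1 x \<longleftrightarrow>
    (\<forall>\<psi>. linear_form W \<psi> \<longrightarrow> t (\<lambda>a b. \<epsilon> a * \<psi> b) = \<psi> x)" (is "?l = ?r \<longleftrightarrow> ?R")
proof
  assume eq: "?l = ?r"
  show ?R
  proof (intro allI impI)
    fix \<psi> assume "linear_form W \<psi>"
    then have b: "bilinear_form complex_space W (\<lambda>c b. c * \<psi> b)"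
      by (auto simp: bilinear_form_iff linear_form_iff algebra_simps)
    show "t (\<lambda>a b. \<epsilon> a * \<psi> b) = \<psi> x"
      using fun_cong[OF eq, of "\<lambda>c b. c * \<psi> b"] b
      by (simp add: tensor_map_apply[OF t assms(3) linear_between_id] elem_tensor_apply)
  qed
next
  assume R: ?R
  show "?l = ?r"
  proof (rule tensor_eqI[OF tensor_map_in[OF t assms(3) linear_between_id]])
    show "?r \<in> tens complex_space W" using x by (auto intro!: elem_tensor_in_subtensor)
    fix \<beta> assume b: "bilinear_form complex_space W \<beta>"
    have hc: "\<beta> c y = c * \<beta> 1 y" if "y \<in> carrier W" for c y
      using linear_form_scaled[of "\<lambda>c. \<beta> c y" c] b that by (simp add: bilinear_form_def)
    have "t (\<lambda>a b. \<beta> (\<epsilon> a) (id b)) = t (\<lambda>a b. \<epsilon> a * \<beta> 1 b)"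
      by (rule tensor_apply_cong[OF V W t]) (unfold id_apply, rule hc)
    moreover have "linear_form W (\<beta> 1)" using b by (auto simp: bilinear_form_def)
    ultimately show "?l \<beta> = ?r \<beta>" using R b
      by (simp add: tensor_map_apply[OF t assms(3) linear_between_id] elem_tensor_apply)
  qed
qed

lemma counit_right_iff:
  assumes V: "cvector_space V" and W: "cvector_space W" and "linear_form W \<epsilon>" and t: "t \<in> tens V W" and x: "x \<in> carrier V"
  shows "tensor_map V W V complex_space id \<epsilon> t = elem_tensor V complex_space x 1 \<longleftrightarrow>
    (\<forall>\<psi>. linear_form V \<psi> \<longrightarrow> t (\<lambda>a b. \<psi> a * \<epsilon> b) = \<psi> x)" (is "?l = ?r \<longleftrightarrow> ?R")
proof
  assume eq: "?l = ?r"
  show ?R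
  proof (intro allI impI)
    fix \<psi> assume "linear_form V \<psi>"
    then have b: "bilinear_form V complex_space (\<lambda>b c. \<psi> b * c)"
      by (auto simp: bilinear_form_iff linear_form_iff algebra_simps)
    show "t (\<lambda>a b. \<psi> a * \<epsilon> b) = \<psi> x"
      using fun_cong[OF eq, of "\<lambda>b c. \<psi> b * c"] b
      by (simp add: tensor_map_apply[OF t linear_between_id assms(3)] elem_tensor_apply)
  qed
next
  assume R: ?R
  show "?l = ?r"
  proof (rule tensor_eqI[OF tensor_map_in[OF t linear_between_id assms(3)]])
    show "?r \<in> tens V complex_space" using x by (auto intro!: elem_tensor_in_subtensor)
    fix \<beta> assume b: "bilinear_form V complex_space \<beta>"
    have hc: "\<beta> y c = \<beta> y 1 * c" if "y \<in> carrier V" for c y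
      using linear_form_scaled[of "\<beta> y" c] b that by (simp add: bilinear_form_def mult.commute)
    have "t (\<lambda>a b. \<beta> (id a) (\<epsilon> b)) = t (\<lambda>a b. \<beta> a 1 * \<epsilon> b)"
      by (rule tensor_apply_cong[OF V W t]) (unfold id_apply, rule hc)
    moreover have "linear_form V (\<lambda>v. \<beta> v 1)" using b by (auto simp: bilinear_form_def)
    ultimately show "?l \<beta> = ?r \<beta>" using R b
      by (simp add: tensor_map_apply[OF t linear_between_id assms(3)] elem_tensor_apply)
  qed
qed

lemma tensor_apply_sum:
  assumes t: "t \<in> tens V W" and "\<And>i. i \<in> I \<Longrightarrow> bilinear_form V W (\<beta> i)"
  shows "t (\<lambda>x y. \<Sum>i\<in>I. \<beta> i x y) = (\<Sum>i\<in>I. t (\<beta> i))"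
    and "bilinear_form V W (\<lambda>x y. \<Sum>i\<in>I. \<beta> i x y)"
proof -
  have b0: "bilinear_form V W (\<lambda>x y. 0)" by (auto simp: bilinear_form_iff)
  have "t (\<lambda>x y. 0) = 0" using tensor_apply_bilinear(2)[OF t b0, of 0] by simp
  then have "t (\<lambda>x y. \<Sum>i\<in>I. \<beta> i x y) = (\<Sum>i\<in>I. t (\<beta> i)) \<and> bilinear_form V W (\<lambda>x y. \<Sum>i\<in>I. \<beta> i x y)"
    using assms(2)
  proof (induction I rule: infinite_finite_induct)
    case (insert i I)
    then have b: "bilinear_form V W (\<beta> i)" "bilinear_form V W (\<lambda>x y. \<Sum>i\<in>I. \<beta> i x y)"
      by auto
    from b have "bilinear_form V W (\<lambda>x y. \<beta> i x y + (\<Sum>i\<in>I. \<beta> i x y))"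
      by (auto simp: bilinear_form_iff algebra_simps)
    then show ?case using insert tensor_apply_bilinear(1)[OF t b] by simp
  qed (use b0 in auto)
  then show "t (\<lambda>x y. \<Sum>i\<in>I. \<beta> i x y) = (\<Sum>i\<in>I. t (\<beta> i))"
    "bilinear_form V W (\<lambda>x y. \<Sum>i\<in>I. \<beta> i x y)" by auto
qed

lemma bilinear_form_comp:
  assumes "bilinear_form V W \<beta>"
  shows "linear_between V' V f \<Longrightarrow> bilinear_form V' W (\<lambda>x. \<beta> (f x))"
    and "linear_between W' W g \<Longrightarrow> bilinear_form V W' (\<lambda>x y. \<beta> x (g y))"
  using assms by (auto simp: bilinear_form_iff linear_between_def Pi_iff)

lemma bilinear_form_comp2: "bilinear_form C D \<beta> \<Longrightarrow> linear_between V C f \<Longrightarrow> linear_between W D g \<Longrightarrow>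
    bilinear_form V W (\<lambda>a b. \<beta> (f a) (g b))"
  by (auto simp: bilinear_form_iff linear_between_def Pi_iff)

section \<open>Linear forms and finite-dimensional subspaces\<close>

locale complex_vector_space = vector_space scale
  for scale :: "complex \<Rightarrow> 'a::ab_group_add \<Rightarrow> 'a" (infixr "\<cdot>" 75)
begin

definition lin :: "('a \<Rightarrow> complex) \<Rightarrow> bool" where
  "lin f \<longleftrightarrow> (\<forall>x y. f (x + y) = f x + f y) \<and> (\<forall>c x. f (c \<cdot> x) = c * f x)"

lemma linI: "(\<And>x y. f (x + y) = f x + f y) \<Longrightarrow> (\<And>c x. f (c \<cdot> x) = c * f x) \<Longrightarrow> lin f"
  by (auto simp: lin_def)

lemma lin_simps:
  assumes "lin f"
  shows "f (x + y) = f x + f y" "f (c \<cdot> x) = c * f x" "f 0 = 0" "f (- x) = - f x"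
    "f (x - y) = f x - f y" "f (\<Sum>i\<in>I. g i) = (\<Sum>i\<in>I. f (g i))"
proof -
  show 1: "f (x + y) = f x + f y" "f (c \<cdot> x) = c * f x" for x y c using assms by (auto simp: lin_def)
  show 0: "f 0 = 0" using 1(2)[of 0 0] by simp
  show 2: "f (- x) = - f x" for x using 1(1)[of x "- x"] 0 by (simp add: eq_neg_iff_add_eq_0 add.commute)
  show "f (x - y) = f x - f y" using 1(1)[of x "- y"] 2 by simp
  show "f (\<Sum>i\<in>I. g i) = (\<Sum>i\<in>I. f (g i))"
    by (induction I rule: infinite_finite_induct) (auto simp: 0 1)
qed

lemma lin_iff_linear: "lin f \<longleftrightarrow> Vector_Spaces.linear scale (*) f"
  using vector_space_axioms vector_space_complex
  by (auto simp: lin_def Vector_Spaces.linear_iff)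

lemma linear_form_separates:
  assumes "subspace K" "x \<notin> K"
  obtains \<phi> where "lin \<phi>" "\<And>k. k \<in> K \<Longrightarrow> \<phi> k = 0" "\<phi> x = 1"
proof -
  interpret P: vector_space_pair scale "(*) :: complex \<Rightarrow> complex \<Rightarrow> complex"
    using vector_space_axioms vector_space_complex by (rule vector_space_pair.intro)
  obtain B where B: "B \<subseteq> K" "independent B" "K \<subseteq> span B"
    by (rule maximal_independent_subset)
  have "span B = K" using B assms(1) by (simp add: span_subspace)
  then have x: "x \<notin> span B" using assms(2) by simp
  then have "independent (insert x B)" using B(2) by (rule independent_insertI)
  then obtain \<phi> where \<phi>: "Vector_Spaces.linear scale (*) \<phi>" "\<forall>b\<in>insert x B. \<phi> b = (if b = x then 1 else 0)"
    using P.linear_independent_extend[of "insert x B" "\<lambda>b. if b = x then 1 else 0"] by auto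
  have l: "lin \<phi>" using \<phi>(1) by (simp add: lin_iff_linear)
  have "\<phi> k = 0" if "k \<in> K" for k
  proof -
    have "k \<in> span B" using that B by auto
    then show ?thesis
    proof (induction rule: span_induct_alt)
      case (step c b y)
      then have "b \<noteq> x" using x span_base by auto
      then show ?case using step \<phi>(2) by (simp add: lin_simps[OF l])
    qed (simp add: lin_simps[OF l])
  qed
  then show thesis using that l \<phi>(2) by simp
qed

lemma linear_forms_separate_points:
  assumes "\<And>\<phi>. lin \<phi> \<Longrightarrow> \<phi> x = \<phi> y" shows "x = y"
proof (rule ccontr)
  assume "x \<noteq> y"
  then obtain \<phi> where "lin \<phi>" "\<phi> (x - y) = 1"
    using linear_form_separates[of "{0}" "x - y"] by auto
  then show False using assms[of \<phi>] by (simp add: lin_simps)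
qed

lemma in_subspace_if_linear_forms:
  assumes "subspace K" "\<And>\<phi>. lin \<phi> \<Longrightarrow> (\<And>k. k \<in> K \<Longrightarrow> \<phi> k = 0) \<Longrightarrow> \<phi> x = 0" shows "x \<in> K"
  using assms linear_form_separates[of K x] by (metis zero_neq_one)

definition findim :: "'a set \<Rightarrow> bool" where
  "findim V \<longleftrightarrow> subspace V \<and> (\<exists>B. finite B \<and> V \<subseteq> span B)"

lemma findim_subset: "findim V \<Longrightarrow> subspace W \<Longrightarrow> W \<subseteq> V \<Longrightarrow> findim W"
  by (auto simp: findim_def)

lemma findim_span: "finite B \<Longrightarrow> findim (span B)"
  by (auto simp: findim_def)

lemma findim_span_Un:
  assumes "findim V" "findim W" shows "findim (span (V \<union> W))"
proof -
  obtain B C where "finite B" "V \<subseteq> span B" "finite C" "W \<subseteq> span C"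
    using assms by (auto simp: findim_def)
  then have "V \<union> W \<subseteq> span (B \<union> C)" using span_mono[of B "B \<union> C"] span_mono[of C "B \<union> C"] by auto
  then have "span (V \<union> W) \<subseteq> span (B \<union> C)" by (simp add: span_minimal)
  then show ?thesis using \<open>finite B\<close> \<open>finite C\<close> by (auto simp: findim_def intro!: exI[of _ "B \<union> C"])
qed

text \<open>
  The dual basis consists of forms on the whole space, not only on \<open>V\<close>: these are what
  convolution operators act with.
\<close>

lemma dual_basis:
  assumes "findim V"
  obtains n :: nat and e \<phi> where "\<And>i. i < n \<Longrightarrow> e i \<in> V" "\<And>i. lin (\<phi> i)"
    "\<And>i j. i < n \<Longrightarrow> j < n \<Longrightarrow> \<phi> i (e j) = (if i = j then 1 else 0)"
    "\<And>v. v \<in> V \<Longrightarrow> v = (\<Sum>i<n. \<phi> i v \<cdot> e i)"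
proof -
  interpret P: vector_space_pair scale "(*) :: complex \<Rightarrow> complex \<Rightarrow> complex"
    using vector_space_axioms vector_space_complex by (rule vector_space_pair.intro)
  obtain C where C: "finite C" "V \<subseteq> span C" "subspace V" using assms by (auto simp: findim_def)
  obtain B where B: "B \<subseteq> V" "independent B" "V \<subseteq> span B"
    by (rule maximal_independent_subset)
  have "finite B" using independent_span_bound[OF C(1) B(2)] B(1) C(2) by auto
  then obtain e where e: "bij_betw e {..<card B} B"
    using ex_bij_betw_nat_finite lessThan_atLeast0 by metis
  let ?n = "card B"
  have "\<exists>\<phi>. lin \<phi> \<and> (\<forall>b\<in>B. \<phi> b = (if b = e i then 1 else 0))" for i
    using P.linear_independent_extend[OF B(2), of "\<lambda>b. if b = e i then 1 else 0"] by (auto simp: lin_iff_linear)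
  then obtain \<phi> where \<phi>: "\<And>i. lin (\<phi> i)" "\<And>i b. b \<in> B \<Longrightarrow> \<phi> i b = (if b = e i then 1 else 0)"
    by metis
  have eB: "e i \<in> B" if "i < ?n" for i using e that by (auto simp: bij_betw_def)
  have dual: "\<phi> i (e j) = (if i = j then 1 else 0)" if "i < ?n" "j < ?n" for i j
    using that \<phi>(2)[OF eB] e by (auto simp: bij_betw_def inj_on_def)
  have "v = (\<Sum>i<?n. \<phi> i v \<cdot> e i)" if "v \<in> V" for v
  proof -
    have "v \<in> span B" using that B by auto
    then show ?thesis
    proof (induction rule: span_induct_alt)
      case (step c b y)
      then obtain j where j: "j < ?n" "b = e j" using e by (auto simp: bij_betw_def)
      have "(\<Sum>i<?n. \<phi> i (c \<cdot> b + y) \<cdot> e i) = (\<Sum>i<?n. (if i = j then c else 0) \<cdot> e i) + (\<Sum>i<?n. \<phi> i y \<cdot> e i)"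
        unfolding j(2) using j(1)
        by (auto simp: lin_simps[OF \<phi>(1)] dual scale_left_distrib sum.distrib intro!: sum.cong)
      also have "(\<Sum>i<?n. (if i = j then c else 0) \<cdot> e i) = (\<Sum>i<?n. if i = j then c \<cdot> e j else 0)"
        by (intro sum.cong) auto
      also have "\<dots> = c \<cdot> b" using j by simp
      finally show ?case using step by simp
    qed (simp add: lin_simps[OF \<phi>(1)])
  qed
  then show thesis using that[of ?n e \<phi>] eB B(1) \<phi>(1) dual by blast
qed


section \<open>Hermitian forms\<close>

definition hermitian :: "('a \<Rightarrow> 'a \<Rightarrow> complex) \<Rightarrow> bool" where
  "hermitian s \<longleftrightarrow> (\<forall>y. lin (\<lambda>x. s x y)) \<and> (\<forall>x y. s y x = cnj (s x y))"

definition positive_on :: "('a \<Rightarrow> 'a \<Rightarrow> complex) \<Rightarrow> 'a set \<Rightarrow> bool" where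
  "positive_on s V \<longleftrightarrow> (\<forall>x\<in>V. x \<noteq> 0 \<longrightarrow> 0 < Re (s x x))"

definition orthonormal :: "('a \<Rightarrow> 'a \<Rightarrow> complex) \<Rightarrow> nat \<Rightarrow> (nat \<Rightarrow> 'a) \<Rightarrow> bool" where
  "orthonormal s n e \<longleftrightarrow> (\<forall>i<n. \<forall>j<n. s (e i) (e j) = (if i = j then 1 else 0))"

lemma hermitian_lin: "hermitian s \<Longrightarrow> lin (\<lambda>x. s x y)"
  unfolding hermitian_def by blast

lemma hermitian_sym: "hermitian s \<Longrightarrow> s y x = cnj (s x y)"
  unfolding hermitian_def by blast

lemma hermitian_simps:
  assumes "hermitian s"
  shows "s (x + x') y = s x y + s x' y" "s (c \<cdot> x) y = c * s x y" "s 0 y = 0" "s (x - x') y = s x y - s x' y"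
    "s (\<Sum>i\<in>I. f i) y = (\<Sum>i\<in>I. s (f i) y)"
    "s y (x + x') = s y x + s y x'" "s y (c \<cdot> x) = cnj c * s y x" "s y 0 = 0" "s y (x - x') = s y x - s y x'"
    "s y (\<Sum>i\<in>I. f i) = (\<Sum>i\<in>I. s y (f i))" "Im (s x x) = 0" "s x x = of_real (Re (s x x))"
proof -
  note l = lin_simps[OF hermitian_lin[OF assms]]
  note h = hermitian_sym[OF assms]
  show "s (x + x') y = s x y + s x' y" "s (c \<cdot> x) y = c * s x y" "s 0 y = 0" "s (x - x') y = s x y - s x' y"
    "s (\<Sum>i\<in>I. f i) y = (\<Sum>i\<in>I. s (f i) y)" by (simp_all add: l)
  show "s y (x + x') = s y x + s y x'" "s y (c \<cdot> x) = cnj c * s y x" "s y 0 = 0" "s y (x - x') = s y x - s y x'"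
    "s y (\<Sum>i\<in>I. f i) = (\<Sum>i\<in>I. s y (f i))"
    by (simp_all add: h[of y "x + x'"] h[of y "c \<cdot> x"] h[of y 0] h[of y "x - x'"] h[of y "sum f I"]
        h[of y x] h[of y x'] h[of y "f _"] l)
  have "Im (s x x) = Im (cnj (s x x))" using h[of x x] by simp
  then show "Im (s x x) = 0" by simp
  then show "s x x = of_real (Re (s x x))" by (simp add: complex_eq_iff)
qed

lemma orthonormal_expand:
  assumes "hermitian s" "orthonormal s n e" "j < n"
  shows "s (\<Sum>i<n. c i \<cdot> e i) (e j) = c j"
proof -
  have "(\<Sum>i<n. c i * s (e i) (e j)) = (\<Sum>i<n. if i = j then c j else 0)"
    using assms by (intro sum.cong) (auto simp: orthonormal_def)
  then show ?thesis using assms(3) by (simp add: hermitian_simps[OF assms(1)])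
qed

lemma orthonormal_norm:
  assumes "hermitian s" "orthonormal s n e"
  shows "s (\<Sum>i<n. c i \<cdot> e i) (\<Sum>i<n. c i \<cdot> e i) = of_real (\<Sum>i<n. (cmod (c i))\<^sup>2)"
proof -
  have "s (\<Sum>i<n. c i \<cdot> e i) (\<Sum>i<n. c i \<cdot> e i) = (\<Sum>j<n. cnj (c j) * s (\<Sum>i<n. c i \<cdot> e i) (e j))"
    by (simp add: hermitian_simps(10,7)[OF assms(1)])
  also have "\<dots> = (\<Sum>j<n. of_real ((cmod (c j))\<^sup>2))"
    by (intro sum.cong) (simp_all add: orthonormal_expand[OF assms] complex_norm_square mult.commute del: of_real_power)
  finally show ?thesis by simp
qed

lemma orthonormal_length:
  assumes "hermitian s" "orthonormal s n e" "finite B" "\<And>i. i < n \<Longrightarrow> e i \<in> span B"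
  shows "n \<le> card B"
proof -
  have inj: "inj_on e {..<n}"
    using assms(2) unfolding orthonormal_def inj_on_def by (metis lessThan_iff zero_neq_one)
  have "independent (e ` {..<n})"
  proof (rule independent_if_scalars_zero)
    fix f x assume z: "(\<Sum>x\<in>e ` {..<n}. f x \<cdot> x) = 0" and "x \<in> e ` {..<n}"
    then obtain j where j: "j < n" "x = e j" by auto
    have "(\<Sum>i<n. f (e i) \<cdot> e i) = 0" using z by (simp add: sum.reindex[OF inj])
    then show "f x = 0"
      using orthonormal_expand[OF assms(1,2) j(1), of "\<lambda>i. f (e i)"] j(2) hermitian_simps(3)[OF assms(1)] by simp
  qed simp
  then have "card (e ` {..<n}) \<le> card B"
    using independent_span_bound[OF assms(3)] assms(4) by blast
  then show ?thesis by (simp add: card_image[OF inj])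
qed

text \<open>
  Take an orthonormal extension of maximal length; its length is bounded by the dimension of
  \<open>V\<close>. A vector outside its span, made orthogonal to it and normalised, would give a longer one.
\<close>

lemma orthonormal_basis_extension:
  assumes "findim V" and s: "hermitian s" "positive_on s V"
    and e: "orthonormal s r e" "\<And>i. i < r \<Longrightarrow> e i \<in> V"
  obtains n e' where "r \<le> n" "\<And>i. i < r \<Longrightarrow> e' i = e i" "orthonormal s n e'"
    "\<And>i. i < n \<Longrightarrow> e' i \<in> V" "\<And>v. v \<in> V \<Longrightarrow> v = (\<Sum>i<n. s v (e' i) \<cdot> e' i)"
proof -
  obtain B where B: "finite B" "V \<subseteq> span B" "subspace V" using assms(1) by (auto simp: findim_def)
  define P where "P n \<longleftrightarrow> r \<le> n \<and> (\<exists>e'. (\<forall>i<r. e' i = e i) \<and> orthonormal s n e' \<and> (\<forall>i<n. e' i \<in> V))" for n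
  have "P r" using e by (auto simp: P_def)
  moreover have bd: "n \<le> card B" if Pn: "P n" for n
  proof -
    obtain f where "orthonormal s n f" "\<forall>i<n. f i \<in> V" using Pn unfolding P_def by blast
    then show ?thesis using orthonormal_length[OF s(1) _ B(1), of n f] B(2) by blast
  qed
  ultimately obtain n where n: "P n" "\<And>m. P m \<Longrightarrow> m \<le> n"
    using Nat.ex_has_greatest_nat[of P r "card B"] by metis
  then obtain e' where e': "r \<le> n" "\<And>i. i < r \<Longrightarrow> e' i = e i" "orthonormal s n e'" "\<And>i. i < n \<Longrightarrow> e' i \<in> V"
    by (auto simp: P_def)
  have "v = (\<Sum>i<n. s v (e' i) \<cdot> e' i)" if v: "v \<in> V" for v
  proof (rule ccontr)
    assume neq: "v \<noteq> (\<Sum>i<n. s v (e' i) \<cdot> e' i)"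
    define w where "w = v - (\<Sum>i<n. s v (e' i) \<cdot> e' i)"
    have wV: "w \<in> V" unfolding w_def using e'(4) v B(3) by (intro subspace_diff subspace_sum subspace_scale) auto
    have w0: "w \<noteq> 0" using neq by (simp add: w_def)
    define N where "N = Re (s w w)"
    have N: "N > 0" using s(2) wV w0 by (auto simp: positive_on_def N_def)
    have orth: "s w (e' j) = 0" if "j < n" for j
      using orthonormal_expand[OF s(1) e'(3) that, of "\<lambda>i. s v (e' i)"]
      by (simp add: w_def hermitian_simps(4)[OF s(1)])
    then have orth': "s (e' j) w = 0" if "j < n" for j
      using that hermitian_sym[OF s(1), of "e' j" w] by simp
    define u where "u = of_real (1 / sqrt N) \<cdot> w"
    have "s u u = 1"
    proof -
      have "s u u = of_real (1 / sqrt N) * of_real (1 / sqrt N) * of_real N"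
        using hermitian_simps(12)[OF s(1), of w] by (simp add: u_def hermitian_simps(2,7)[OF s(1)] N_def)
      also have "\<dots> = of_real (1 / sqrt N * (1 / sqrt N) * N)" by (simp only: of_real_mult)
      also have "1 / sqrt N * (1 / sqrt N) * N = 1" using N by (simp add: field_simps)
      finally show ?thesis by simp
    qed
    moreover have "s u (e' j) = 0" "s (e' j) u = 0" if "j < n" for j
      using orth orth' that by (simp_all add: u_def hermitian_simps(2,7)[OF s(1)])
    moreover have "u \<in> V" using wV B(3) by (simp add: u_def subspace_scale)
    ultimately have "P (Suc n)"
      using e' unfolding P_def orthonormal_def
      by (intro conjI exI[of _ "e'(n := u)"]) (auto simp: less_Suc_eq)
    then show False using n(2) by force
  qed
  then show thesis using that e' by blast
qed

lemma orthonormal_basis: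
  assumes "findim V" "hermitian s" "positive_on s V"
  obtains n e where "orthonormal s n e" "\<And>i. i < n \<Longrightarrow> e i \<in> V" "\<And>v. v \<in> V \<Longrightarrow> v = (\<Sum>i<n. s v (e i) \<cdot> e i)"
  using orthonormal_basis_extension[OF assms, of 0] by (auto simp: orthonormal_def)

lemma orthogonal_projection:
  assumes "findim V" "hermitian s" "positive_on s V"
  obtains v where "v \<in> V" "\<And>w. w \<in> V \<Longrightarrow> s (x - v) w = 0"
proof -
  obtain n e where e: "orthonormal s n e" "\<And>i. i < n \<Longrightarrow> e i \<in> V" "\<And>v. v \<in> V \<Longrightarrow> v = (\<Sum>i<n. s v (e i) \<cdot> e i)"
    using orthonormal_basis[OF assms] by blast
  define v where "v = (\<Sum>i<n. s x (e i) \<cdot> e i)"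
  have "s (x - v) (e j) = 0" if "j < n" for j
    using orthonormal_expand[OF assms(2) e(1) that] by (simp add: v_def hermitian_simps(4)[OF assms(2)])
  then have "s (x - v) w = 0" if "w \<in> V" for w
    by (subst e(3)[OF that]) (simp add: hermitian_simps(10,7)[OF assms(2)])
  moreover have "v \<in> V"
    using e(2) assms(1) unfolding v_def findim_def by (intro subspace_sum subspace_scale) auto
  ultimately show thesis using that by blast
qed

text \<open>
  In orthonormal coordinates \<open>c\<close> for \<open>s\<close>, \<open>|q(x,x)| \<le> \<Sum> |q(e\<^sub>i,e\<^sub>j)| |c\<^sub>i| |c\<^sub>j|\<close> and
  \<open>|c\<^sub>i| |c\<^sub>j| \<le> s(x,x)\<close>.
\<close>

lemma hermitian_bound:
  assumes "findim V" "hermitian s" "positive_on s V" "hermitian q"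
  obtains C where "C > 0" "\<And>x. x \<in> V \<Longrightarrow> \<bar>Re (q x x)\<bar> \<le> C * Re (s x x)"
proof -
  obtain n e where e: "orthonormal s n e" "\<And>i. i < n \<Longrightarrow> e i \<in> V" "\<And>v. v \<in> V \<Longrightarrow> v = (\<Sum>i<n. s v (e i) \<cdot> e i)"
    using orthonormal_basis[OF assms(1-3)] by blast
  define C where "C = 1 + (\<Sum>i<n. \<Sum>j<n. cmod (q (e i) (e j)))"
  have C: "C > 0" unfolding C_def by (simp add: add_pos_nonneg sum_nonneg)
  have "\<bar>Re (q x x)\<bar> \<le> C * Re (s x x)" if "x \<in> V" for x
  proof -
    define c where "c i = s x (e i)" for i
    have x: "x = (\<Sum>i<n. c i \<cdot> e i)" using e(3)[OF that] by (simp add: c_def)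
    have S: "Re (s x x) = (\<Sum>i<n. (cmod (c i))\<^sup>2)"
      by (subst (1 2) x) (simp add: orthonormal_norm[OF assms(2) e(1)])
    have "q x x = (\<Sum>j<n. \<Sum>i<n. cnj (c j) * (c i * q (e i) (e j)))"
      by (subst (1 2) x) (simp add: hermitian_simps(5,2,10,7)[OF assms(4)] sum_distrib_left)
    then have "cmod (q x x) \<le> (\<Sum>j<n. \<Sum>i<n. cmod (c j) * (cmod (c i) * cmod (q (e i) (e j))))"
      by (auto intro!: order.trans[OF norm_sum] sum_mono simp: norm_mult)
    also have "\<dots> \<le> (\<Sum>j<n. \<Sum>i<n. cmod (q (e i) (e j)) * Re (s x x))"
    proof (intro sum_mono)
      fix i j assume ij: "j \<in> {..<n}" "i \<in> {..<n}"
      have m: "(cmod (c k))\<^sup>2 \<le> Re (s x x)" if "k \<in> {..<n}" for k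
        unfolding S using that by (intro member_le_sum) auto
      have "cmod (c j) * cmod (c i) \<le> ((cmod (c j))\<^sup>2 + (cmod (c i))\<^sup>2) / 2"
        using sum_squares_bound[of "cmod (c j)" "cmod (c i)"] by simp
      also have "\<dots> \<le> Re (s x x)" using m[OF ij(1)] m[OF ij(2)] by simp
      finally show "cmod (c j) * (cmod (c i) * cmod (q (e i) (e j))) \<le> cmod (q (e i) (e j)) * Re (s x x)"
        using mult_right_mono[of "cmod (c j) * cmod (c i)" "Re (s x x)" "cmod (q (e i) (e j))"] by (simp add: mult_ac)
    qed
    also have "\<dots> = (C - 1) * Re (s x x)"
      unfolding C_def by (subst sum.swap) (simp add: sum_distrib_right)
    also have "\<dots> \<le> C * Re (s x x)" using S by (simp add: algebra_simps sum_nonneg)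
    finally show ?thesis using abs_Re_le_cmod[of "q x x"] by linarith
  qed
  then show thesis using that C by blast
qed

text \<open>
  Let \<open>\<mu>\<close> be the infimum of \<open>q(x,x)/s(x,x)\<close>. If the semidefinite form \<open>p = q - \<mu> s\<close> were definite,
  it would dominate a positive multiple of \<open>s\<close> by the previous bound, and \<open>\<mu>\<close> could be increased;
  this takes the place of a compactness argument. So \<open>p(x\<^sub>0,x\<^sub>0) = 0\<close> for some \<open>x\<^sub>0 \<noteq> 0\<close>, and
  semidefiniteness forces \<open>p(x\<^sub>0,y) = 0\<close> for all \<open>y\<close>.
\<close>

lemma least_eigenvalue:
  fixes s q :: "'a \<Rightarrow> 'a \<Rightarrow> complex"
  assumes V: "findim V" and s: "hermitian s" "positive_on s V" and q: "hermitian q" and x1: "x1 \<in> V" "x1 \<noteq> 0"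
  obtains \<mu> :: real and x0 where "x0 \<in> V" "x0 \<noteq> 0" "\<And>y. y \<in> V \<Longrightarrow> q x0 y = \<mu> * s x0 y"
    "\<And>x. x \<in> V \<Longrightarrow> \<mu> * Re (s x x) \<le> Re (q x x)"
proof -
  obtain C where C: "C > 0" "\<And>x. x \<in> V \<Longrightarrow> \<bar>Re (q x x)\<bar> \<le> C * Re (s x x)"
    using hermitian_bound[OF V s q] by blast
  define R where "R = (\<lambda>x. Re (q x x) / Re (s x x)) ` (V - {0})"
  define \<mu> where "\<mu> = Inf R"
  have pos: "Re (s x x) > 0" if "x \<in> V" "x \<noteq> 0" for x using s(2) that by (auto simp: positive_on_def)
  have "- C \<le> r" if rR: "r \<in> R" for r
  proof -
    obtain x where x: "x \<in> V" "x \<noteq> 0" "r = Re (q x x) / Re (s x x)" using rR unfolding R_def by blast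
    have "- C * Re (s x x) \<le> Re (q x x)" using C(2)[OF x(1)] by linarith
    then show ?thesis using pos[OF x(1,2)] by (simp add: x(3) pos_le_divide_eq)
  qed
  then have bdd: "bdd_below R" unfolding bdd_below_def by blast
  have ne: "R \<noteq> {}" using x1 by (auto simp: R_def)
  have low: "\<mu> * Re (s x x) \<le> Re (q x x)" if "x \<in> V" for x
  proof (cases "x = 0")
    case True then show ?thesis by (simp add: hermitian_simps(3)[OF s(1)] hermitian_simps(3)[OF q])
  next
    case False
    then have "\<mu> \<le> Re (q x x) / Re (s x x)"
      unfolding \<mu>_def using that by (intro cInf_lower[OF _ bdd]) (auto simp: R_def)
    then show ?thesis using pos[OF that False] by (simp add: pos_le_divide_eq)
  qed
  define p where "p x y = q x y - of_real \<mu> * s x y" for x y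
  have p: "hermitian p"
    unfolding hermitian_def
  proof (intro conjI allI)
    show "lin (\<lambda>x. p x y)" for y
      by (rule linI) (simp_all add: p_def hermitian_simps(1,2)[OF s(1)] hermitian_simps(1,2)[OF q] algebra_simps)
    show "p y x = cnj (p x y)" for x y
      using hermitian_sym[OF q, of y x] hermitian_sym[OF s(1), of y x] by (simp add: p_def)
  qed
  have p_nonneg: "0 \<le> Re (p x x)" if "x \<in> V" for x using low[OF that] by (simp add: p_def)
  have "\<exists>x0\<in>V. x0 \<noteq> 0 \<and> Re (p x0 x0) = 0"
  proof (rule ccontr)
    assume "\<not> ?thesis"
    then have "positive_on p V" using p_nonneg by (force simp: positive_on_def)
    then obtain D where D: "D > 0" "\<And>x. x \<in> V \<Longrightarrow> \<bar>Re (s x x)\<bar> \<le> D * Re (p x x)"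
      using hermitian_bound[OF V p _ s(1)] by blast
    have "\<mu> + 1 / D \<le> r" if rR: "r \<in> R" for r
    proof -
      obtain x where x: "x \<in> V" "x \<noteq> 0" "r = Re (q x x) / Re (s x x)" using rR unfolding R_def by blast
      have "Re (s x x) / D \<le> Re (p x x)"
        using D(2)[OF x(1)] D(1) by (simp add: pos_divide_le_eq mult.commute)
      then have "(\<mu> + 1 / D) * Re (s x x) \<le> Re (q x x)" by (simp add: p_def algebra_simps)
      then show ?thesis using pos[OF x(1,2)] by (simp add: x(3) pos_le_divide_eq)
    qed
    then have "\<mu> + 1 / D \<le> \<mu>" using cInf_greatest[OF ne, of "\<mu> + 1 / D"] by (simp add: \<mu>_def)
    then show False using D(1) by simp
  qed
  then obtain x0 where x0: "x0 \<in> V" "x0 \<noteq> 0" "Re (p x0 x0) = 0" by blast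
  have "p x0 y = 0" if y: "y \<in> V" for y
  proof (rule ccontr)
    assume nz: "p x0 y \<noteq> 0"
    define z where "z = p x0 y"
    \<comment> \<open>At \<open>x0 - t z y\<close> the form has the value \<open>- 2 t |z|\<^sup>2 + t\<^sup>2 |z|\<^sup>2 p y y\<close>, negative for small \<open>t\<close>.\<close>
    define Y where "Y = Re (p y y)"
    define t where "t = 1 / (Y + 1)"
    have Y: "Y \<ge> 0" using p_nonneg[OF y] by (simp add: Y_def)
    define x where "x = x0 - (of_real t * z) \<cdot> y"
    have "x \<in> V" using x0(1) y V unfolding x_def findim_def by (intro subspace_diff subspace_scale) auto
    have yx: "p y x0 = cnj z" using hermitian_sym[OF p, of y x0] by (simp add: z_def)
    have pxx: "p x x = p x0 x0 - cnj (of_real t * z) * z - of_real t * z * cnj z + of_real t * z * cnj (of_real t * z) * p y y"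
      unfolding x_def hermitian_simps(4,9,2,7)[OF p] yx z_def[symmetric] by (simp add: algebra_simps)
    have p00: "p x0 x0 = 0" "p y y = of_real Y"
      using hermitian_simps(12)[OF p, of x0] x0(3) hermitian_simps(12)[OF p, of y] by (simp_all add: Y_def)
    have "p x x = of_real ((t\<^sup>2 * Y - 2 * t) * (cmod z)\<^sup>2)"
      unfolding pxx p00 of_real_mult complex_norm_square by (simp add: algebra_simps power2_eq_square)
    then have "0 \<le> (t\<^sup>2 * Y - 2 * t) * (cmod z)\<^sup>2" using p_nonneg[OF \<open>x \<in> V\<close>] by simp
    then have "0 \<le> t\<^sup>2 * Y - 2 * t" using nz by (simp add: z_def zero_le_mult_iff)
    moreover have "t > 0" "t * Y < 2" using Y by (simp_all add: t_def field_simps)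
    then have "t\<^sup>2 * Y - 2 * t < 0"
      using mult_strict_left_mono[of "t * Y" 2 t] by (simp add: power2_eq_square mult_ac)
    ultimately show False by linarith
  qed
  then show thesis using that[of x0 \<mu>] x0 low by (simp add: p_def)
qed

end

section \<open>Hopf *-algebras tested against linear forms\<close>

locale hopf_star =
  fixes H :: "'h::ring_1 hopf_star_algebra"
  assumes hopf_star: "is_hopf_star_algebra H"
begin

abbreviation sc :: "complex \<Rightarrow> 'h \<Rightarrow> 'h" (infixr "\<cdot>" 75) where
  "c \<cdot> x \<equiv> smult H c x"

abbreviation \<epsilon> :: "'h \<Rightarrow> complex" where "\<epsilon> \<equiv> counit H"
abbreviation S :: "'h \<Rightarrow> 'h" where "S \<equiv> antipode H"
abbreviation st :: "'h \<Rightarrow> 'h" where "st \<equiv> star H"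
abbreviation bil :: "('h \<Rightarrow> 'h \<Rightarrow> complex) \<Rightarrow> bool" where "bil \<equiv> bilinear_form H H"

lemma hopf: "is_hopf_algebra H" and algebra: "is_algebra H" and coalgebra: "is_coalgebra H"
  using hopf_star by (auto simp: is_hopf_star_algebra_def is_hopf_algebra_def)

lemma H_simps [simp]:
  "carrier H = UNIV" "mult H = (*)" "one H = 1" "zero H = 0" "add H = (+)"
  using algebra by (auto simp: is_algebra_def)

lemma cspace_H: "cvector_space H"
  using algebra by (auto simp: is_algebra_def)

lemma sc_mult: "c \<cdot> (x * y) = (c \<cdot> x) * y" "c \<cdot> (x * y) = x * (c \<cdot> y)"
  using algebra unfolding is_algebra_def by blast+

lemma sc_mult_simps [simp]: "(c \<cdot> x) * y = c \<cdot> (x * y)" "x * (c \<cdot> y) = c \<cdot> (x * y)"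
  by (simp_all add: sc_mult(1)[symmetric] sc_mult(2)[symmetric])

lemma vector_space_H: "vector_space (smult H)"
proof -
  interpret M: Module.module complex_ring H by (rule cspace_H)
  show ?thesis
    using M.smult_l_distr M.smult_r_distr M.smult_assoc1 M.smult_one
    by unfold_locales (auto simp: complex_ring_def)
qed

sublocale complex_vector_space "smult H"
  using vector_space_H by (rule complex_vector_space.intro)

lemma linear_form_H [simp]: "linear_form H \<phi> \<longleftrightarrow> lin \<phi>"
  by (simp add: linear_form_iff lin_def)

lemma bil_iff: "bil \<beta> \<longleftrightarrow> (\<forall>y. lin (\<lambda>x. \<beta> x y)) \<and> (\<forall>x. lin (\<beta> x))"
  by (auto simp: bilinear_form_def)

lemma comult_linear: "linear_between H (tensor_space H H) (comult H)"
  using coalgebra by (auto simp: is_coalgebra_def)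

lemma comult_tens [simp]: "comult H x \<in> subtensor H H UNIV UNIV"
  using comult_linear by (auto simp: linear_between_def)

lemma comult_tens' [simp]: "comult H x \<in> tens H H"
  by simp

lemma comult_lin: "lin (\<lambda>x. comult H x \<beta>)"
  using comult_linear by (auto simp: lin_def linear_between_def)

lemma star_anti:
  "st (x + y) = st x + st y" "st (c \<cdot> x) = cnj c \<cdot> st x" "st (st x) = x" "st (x * y) = st y * st x"
  "\<epsilon> (st x) = cnj (\<epsilon> x)"
  using hopf_star by (auto simp: is_hopf_star_algebra_def antilinear_between_def)

lemma star_0 [simp]: "st 0 = 0" using star_anti(2)[of 0 0] by simp

lemma star_1 [simp]: "st 1 = 1"
  by (metis mult.left_neutral mult.right_neutral star_anti(3,4))

lemma star_sum: "st (sum f I) = (\<Sum>i\<in>I. st (f i))"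
  by (induction I rule: infinite_finite_induct) (auto simp: star_anti)

lemma antipode_linear: "S (x + y) = S x + S y" "S (c \<cdot> x) = c \<cdot> S x"
  using hopf by (auto simp: is_hopf_algebra_def linear_between_def)

lemma antipode_0 [simp]: "S 0 = 0" using antipode_linear(2)[of 0 0] by simp

lemma antipode_sum: "S (sum f I) = (\<Sum>i\<in>I. S (f i))"
  by (induction I rule: infinite_finite_induct) (auto simp: antipode_linear)

lemma counit_lin [simp]: "lin \<epsilon>"
  using coalgebra by (auto simp: is_coalgebra_def)

lemma counit_mult: "\<epsilon> 1 = 1" "\<epsilon> (x * y) = \<epsilon> x * \<epsilon> y"
  using hopf by (auto simp: is_hopf_algebra_def)

lemma lin_comp [intro]:
  assumes "lin \<phi>"
  shows "lin (\<lambda>x. \<phi> (x * y))" "lin (\<lambda>x. \<phi> (y * x))" "lin (\<lambda>x. \<phi> (S x))" "lin (\<lambda>x. cnj (\<phi> (st x)))"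
    "lin (\<lambda>x. c * \<phi> x)" "lin (\<lambda>x. \<phi> x * c)"
  by (auto simp: lin_simps[OF assms] lin_def distrib_right distrib_left antipode_linear star_anti)

lemma lin_sum: "(\<And>i. i \<in> I \<Longrightarrow> lin (\<phi> i)) \<Longrightarrow> lin (\<lambda>x. \<Sum>i\<in>I. \<phi> i x)"
  by (rule linI) (auto simp: lin_simps sum.distrib sum_distrib_left)

lemma lin_zero [simp]: "lin (\<lambda>x. 0)" by (simp add: lin_def)

lemma bil_product [intro]: "lin \<phi> \<Longrightarrow> lin \<psi> \<Longrightarrow> bil (\<lambda>a b. \<phi> a * \<psi> b)"
  by (auto simp: bil_iff)

lemma coassociativity:
  assumes "trilinear_form H H H \<gamma>"
  shows "comult H x (\<lambda>a b. comult H a (\<lambda>c d. \<gamma> c d b)) = comult H x (\<lambda>a b. comult H b (\<gamma> a))"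
  using coassociative_iff[OF cspace_H cspace_H comult_linear comult_linear comult_tens', of x] coalgebra assms
  by (simp add: is_coalgebra_def)

lemma trilin_product: "lin \<phi> \<Longrightarrow> lin \<psi> \<Longrightarrow> lin \<chi> \<Longrightarrow> trilinear_form H H H (\<lambda>a b c. \<phi> a * \<psi> b * \<chi> c)"
  by (auto simp: trilinear_form_def bil_iff)

lemma comult_counit:
  assumes "lin \<psi>"
  shows "comult H x (\<lambda>a b. \<epsilon> a * \<psi> b) = \<psi> x" "comult H x (\<lambda>a b. \<psi> a * \<epsilon> b) = \<psi> x"
  using counit_left_iff[OF cspace_H cspace_H _ comult_tens', of \<epsilon> x x] counit_right_iff[OF cspace_H cspace_H _ comult_tens', of \<epsilon> x x]
    coalgebra assms by (auto simp: is_coalgebra_def)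

lemma comult_1: "bil \<beta> \<Longrightarrow> comult H 1 \<beta> = \<beta> 1 1"
  using hopf by (auto simp: is_hopf_algebra_def elem_tensor_apply)

lemma bil_zero [simp]: "bil (\<lambda>a b. 0)"
  by (simp add: bil_iff)

lemma comult_apply_lin:
  "bil \<beta> \<Longrightarrow> bil \<gamma> \<Longrightarrow> comult H x (\<lambda>a b. \<beta> a b + \<gamma> a b) = comult H x \<beta> + comult H x \<gamma>"
  "bil \<beta> \<Longrightarrow> comult H x (\<lambda>a b. c * \<beta> a b) = c * comult H x \<beta>"
  "bil \<beta> \<Longrightarrow> comult H x (\<lambda>a b. \<beta> a b * c) = comult H x \<beta> * c"
  using tensor_apply_bilinear(1)[OF comult_tens', of \<beta> \<gamma> x] tensor_apply_bilinear(2)[OF comult_tens', of \<beta> x c]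
  by (simp_all add: mult.commute)

lemma comult_apply_zero [simp]: "comult H x (\<lambda>a b. 0) = 0"
  using comult_apply_lin(2)[where \<beta> = "\<lambda>_ _. 0" and c = 0] by simp

lemma comult_apply_sum:
  assumes "\<And>i. i \<in> I \<Longrightarrow> bil (\<beta> i)"
  shows "comult H x (\<lambda>a b. \<Sum>i\<in>I. \<beta> i a b) = (\<Sum>i\<in>I. comult H x (\<beta> i))"
  using assms
proof (induction I rule: infinite_finite_induct)
  case (insert i I)
  have "bil (\<lambda>a b. \<Sum>i\<in>I. \<beta> i a b)" using insert by (auto simp: bil_iff intro!: lin_sum)
  then show ?case using insert by (simp add: comult_apply_lin)
qed simp_all

lemma bil_comult_mult:
  assumes b: "bil \<gamma>"
  shows "bil (\<lambda>a b. comult H y (\<lambda>c d. \<gamma> (a * c) (b * d)))"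
proof -
  have b1: "bil (\<lambda>c d. \<gamma> (a * c) (b * d))" for a b using b by (auto simp: bil_iff)
  have "\<gamma> (x + x') y = \<gamma> x y + \<gamma> x' y" "\<gamma> y (x + x') = \<gamma> y x + \<gamma> y x'"
    "\<gamma> (c \<cdot> x) y = c * \<gamma> x y" "\<gamma> y (c \<cdot> x) = c * \<gamma> y x" for x x' y c
    using b lin_simps(1)[of "\<gamma> y"] lin_simps(1)[of "\<lambda>x. \<gamma> x y"] lin_simps(2)[of "\<gamma> y"] lin_simps(2)[of "\<lambda>x. \<gamma> x y"]
    by (auto simp: bil_iff)
  then show ?thesis
    by (auto simp: bil_iff distrib_right comult_apply_lin(1)[OF b1 b1] comult_apply_lin(2)[OF b1] intro!: linI)
qed

lemma comult_mult:
  assumes b: "bil \<beta>"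
  shows "comult H (x * y) \<beta> = comult H x (\<lambda>a b. comult H y (\<lambda>c d. \<beta> (a * c) (b * d)))"
proof -
  have e: "bil (\<lambda>c d. elem_tensor H H (a * c) (b * d) \<gamma>)" for a b \<gamma>
  proof (cases "bil \<gamma>")
    case True
    then have "bil (\<lambda>c d. \<gamma> (a * c) (b * d))" by (auto simp: bil_iff)
    then show ?thesis using True by (simp add: elem_tensor_apply)
  qed (simp add: elem_tensor_apply)
  have l: "tensor_lift H H (\<lambda>c d. elem_tensor H H (a * c) (b * d)) (comult H y) \<gamma> =
      comult H y (\<lambda>c d. elem_tensor H H (a * c) (b * d) \<gamma>)" for a b \<gamma>
    by (rule tensor_lift_apply[OF comult_tens' e])
  have tri: "bil (\<lambda>a b. comult H y (\<lambda>c d. elem_tensor H H (a * c) (b * d) \<gamma>))" for \<gamma>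
    using bil_comult_mult[of \<gamma> y] by (cases "bil \<gamma>") (simp_all add: elem_tensor_apply)
  have "comult H (x * y) = tensor_lift H H (\<lambda>a b.
                tensor_lift H H (\<lambda>c d. elem_tensor H H (a * c) (b * d)) (comult H y)) (comult H x)"
    using hopf by (simp add: is_hopf_algebra_def tensor_space_def)
  then have "comult H (x * y) \<beta> = comult H x (\<lambda>a b. comult H y (\<lambda>c d. elem_tensor H H (a * c) (b * d) \<beta>))"
    using tensor_lift_apply[where \<gamma> = \<beta> and b = "\<lambda>a b.
                tensor_lift H H (\<lambda>c d. elem_tensor H H (a * c) (b * d)) (comult H y)", OF comult_tens'[of x]] tri
    by (simp add: l)
  then show ?thesis using b by (simp add: elem_tensor_apply)
qed

lemma comult_star:
  assumes b: "bil \<beta>"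
  shows "comult H (st x) \<beta> = cnj (comult H x (\<lambda>a b. cnj (\<beta> (st a) (st b))))"
proof -
  have "bil (\<lambda>a b. cnj (elem_tensor H H (st a) (st b) \<gamma>))" for \<gamma>
  proof (cases "bil \<gamma>")
    case True
    then have "bil (\<lambda>a b. cnj (\<gamma> (st a) (st b)))" by (auto simp: bil_iff)
    then show ?thesis using True by (simp add: elem_tensor_apply)
  qed (simp add: elem_tensor_apply)
  from tensor_lift_antilinear[where b = "\<lambda>a b. elem_tensor H H (st a) (st b)", OF comult_tens'[of x] this] show ?thesis
    using b hopf_star by (simp add: is_hopf_star_algebra_def elem_tensor_apply)
qed

text \<open>
  Bilinearity of a map into \<open>H\<close> is tested against linear forms, so that it reduces to the scalar
  case.
\<close>

definition hbil :: "('h \<Rightarrow> 'h \<Rightarrow> 'h) \<Rightarrow> bool" where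
  "hbil b \<longleftrightarrow> (\<forall>\<psi>. lin \<psi> \<longrightarrow> bil (\<lambda>x y. \<psi> (b x y)))"

lemma linear_form_tensor_lift:
  assumes t: "t \<in> tens V W" and b: "\<And>\<psi>. lin \<psi> \<Longrightarrow> bilinear_form V W (\<lambda>x y. \<psi> (b x y))" and \<psi>: "lin \<psi>"
  shows "\<psi> (tensor_lift V W b t) = t (\<lambda>x y. \<psi> (b x y))"
proof -
  obtain xs where xs: "set xs \<subseteq> carrier V \<times> carrier W" "t = tensor_of_list V W xs"
    using t by (auto elim: subtensorE)
  have eqs: "b (x \<oplus>\<^bsub>V\<^esub> x') y = b x y + b x' y" "b x (y \<oplus>\<^bsub>W\<^esub> y') = b x y + b x y'"
    "b (c \<odot>\<^bsub>V\<^esub> x) y = c \<cdot> b x y" "b x (c \<odot>\<^bsub>W\<^esub> y) = c \<cdot> b x y"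
    if "x \<in> carrier V" "x' \<in> carrier V" "y \<in> carrier W" "y' \<in> carrier W" for x x' y y' c
  proof -
    have "\<psi> (b (x \<oplus>\<^bsub>V\<^esub> x') y) = \<psi> (b x y) + \<psi> (b x' y)" "\<psi> (b x (y \<oplus>\<^bsub>W\<^esub> y')) = \<psi> (b x y) + \<psi> (b x y')"
      "\<psi> (b (c \<odot>\<^bsub>V\<^esub> x) y) = c * \<psi> (b x y)" "\<psi> (b x (c \<odot>\<^bsub>W\<^esub> y)) = c * \<psi> (b x y)" if "lin \<psi>" for \<psi>
      using b[OF that] \<open>x \<in> carrier V\<close> \<open>x' \<in> carrier V\<close> \<open>y \<in> carrier W\<close> \<open>y' \<in> carrier W\<close>
      unfolding bilinear_form_iff by blast+
    then show "b (x \<oplus>\<^bsub>V\<^esub> x') y = b x y + b x' y" "b x (y \<oplus>\<^bsub>W\<^esub> y') = b x y + b x y'"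
      "b (c \<odot>\<^bsub>V\<^esub> x) y = c \<cdot> b x y" "b x (c \<odot>\<^bsub>W\<^esub> y) = c \<cdot> b x y"
      by (auto intro!: linear_forms_separate_points simp: lin_simps)
  qed
  have "tensor_lift V W b t = (\<Sum>(x, y)\<leftarrow>xs. b x y)"
    unfolding xs(2) by (rule tensor_lift_sum[OF vector_space_H]) (use eqs xs(1) in auto)
  moreover have "\<psi> (\<Sum>(x, y)\<leftarrow>xs. b x y) = (\<Sum>(x, y)\<leftarrow>xs. \<psi> (b x y))"
    by (induction xs) (auto simp: lin_simps[OF \<psi>])
  ultimately show ?thesis
    using b[OF \<psi>] by (simp add: xs(2) tensor_of_list_apply)
qed

lemma tensor_lift_H:
  assumes "hbil b" "t \<in> tens H H" "lin \<psi>"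
  shows "\<psi> (tensor_lift H H b t) = t (\<lambda>x y. \<psi> (b x y))"
  using assms by (intro linear_form_tensor_lift) (auto simp: hbil_def)

lemma comult_apply_elem_sum:
  assumes "bil \<beta>" "comult H x = (\<Sum>i\<in>I. elem_tensor H H (f i) (g i))"
  shows "comult H x \<beta> = (\<Sum>i\<in>I. \<beta> (f i) (g i))"
  using assms by (simp add: elem_tensor_apply sum_fun_apply)

lemma comult_lift_sum:
  assumes "hbil b" "comult H x = (\<Sum>i\<in>I. elem_tensor H H (f i) (g i))"
  shows "tensor_lift H H b (comult H x) = (\<Sum>i\<in>I. b (f i) (g i))"
proof (rule linear_forms_separate_points)
  fix \<psi> assume \<psi>: "lin \<psi>"
  then have b: "bil (\<lambda>x y. \<psi> (b x y))" using assms(1) by (auto simp: hbil_def)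
  show "\<psi> (tensor_lift H H b (comult H x)) = \<psi> (\<Sum>i\<in>I. b (f i) (g i))"
    unfolding tensor_lift_H[OF assms(1) comult_tens' \<psi>] comult_apply_elem_sum[OF b assms(2)]
    by (simp add: lin_simps[OF \<psi>])
qed

lemma comult_eqI:
  assumes "\<And>\<beta>. bil \<beta> \<Longrightarrow> comult H x \<beta> = (\<Sum>i\<in>I. \<beta> (f i) (g i))"
  shows "comult H x = (\<Sum>i\<in>I. elem_tensor H H (f i) (g i))"
proof (rule tensor_eqI[OF comult_tens])
  show "(\<Sum>i\<in>I. elem_tensor H H (f i) (g i)) \<in> subtensor H H UNIV UNIV"
    by (auto intro: sum_in_subtensor elem_tensor_in_subtensor)
  show "comult H x \<beta> = (\<Sum>i\<in>I. elem_tensor H H (f i) (g i)) \<beta>" if "bil \<beta>" for \<beta>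
    using assms that by (simp add: elem_tensor_apply sum_fun_apply)
qed

lemma antipode_sums:
  assumes "comult H x = (\<Sum>i\<in>I. elem_tensor H H (f i) (g i))"
  shows "(\<Sum>i\<in>I. S (f i) * g i) = \<epsilon> x \<cdot> 1" "(\<Sum>i\<in>I. f i * S (g i)) = \<epsilon> x \<cdot> 1"
proof -
  have "hbil (\<lambda>a b. S a * b)" "hbil (\<lambda>a b. a * S b)"
    by (auto simp: hbil_def bil_iff)
  from this[THEN comult_lift_sum, OF assms]
  show "(\<Sum>i\<in>I. S (f i) * g i) = \<epsilon> x \<cdot> 1" "(\<Sum>i\<in>I. f i * S (g i)) = \<epsilon> x \<cdot> 1"
    using hopf by (simp_all add: is_hopf_algebra_def)
qed


section \<open>Convolution operators\<close>

text \<open>In Sweedler notation \<open>L \<phi> x = \<phi>(x\<^sub>1) x\<^sub>2\<close> and \<open>R \<psi> x = x\<^sub>1 \<psi>(x\<^sub>2)\<close>.\<close>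

definition L :: "('h \<Rightarrow> complex) \<Rightarrow> 'h \<Rightarrow> 'h" where
  "L \<phi> x = tensor_lift H H (\<lambda>a b. \<phi> a \<cdot> b) (comult H x)"

definition R :: "('h \<Rightarrow> complex) \<Rightarrow> 'h \<Rightarrow> 'h" where
  "R \<psi> x = tensor_lift H H (\<lambda>a b. \<psi> b \<cdot> a) (comult H x)"

lemma L_apply: "lin \<phi> \<Longrightarrow> lin \<psi> \<Longrightarrow> \<psi> (L \<phi> x) = comult H x (\<lambda>a b. \<phi> a * \<psi> b)"
  unfolding L_def by (subst tensor_lift_H) (auto simp: hbil_def lin_simps bil_iff)

lemma R_apply: "lin \<phi> \<Longrightarrow> lin \<psi> \<Longrightarrow> \<psi> (R \<phi> x) = comult H x (\<lambda>a b. \<psi> a * \<phi> b)"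
  unfolding R_def by (subst tensor_lift_H) (auto simp: hbil_def lin_simps bil_iff mult.commute)

text \<open>
  Both sides are \<open>\<phi>(x\<^sub>1) \<psi>(x\<^sub>2)\<close>.
\<close>

lemma LR_swap: "lin \<phi> \<Longrightarrow> lin \<psi> \<Longrightarrow> \<psi> (L \<phi> x) = \<phi> (R \<psi> x)"
  by (simp add: L_apply R_apply)

lemma L_lin: "lin \<phi> \<Longrightarrow> lin \<psi> \<Longrightarrow> lin (\<lambda>x. \<psi> (L \<phi> x))"
  and R_lin: "lin \<phi> \<Longrightarrow> lin \<psi> \<Longrightarrow> lin (\<lambda>x. \<psi> (R \<phi> x))"
  by (simp_all add: L_apply R_apply comult_lin)

lemma L_linear: "lin \<phi> \<Longrightarrow> L \<phi> (x + y) = L \<phi> x + L \<phi> y" "lin \<phi> \<Longrightarrow> L \<phi> (c \<cdot> x) = c \<cdot> L \<phi> x"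
  by (rule linear_forms_separate_points; simp add: lin_simps lin_simps[OF L_lin])+

lemma R_linear: "lin \<phi> \<Longrightarrow> R \<phi> (x + y) = R \<phi> x + R \<phi> y" "lin \<phi> \<Longrightarrow> R \<phi> (c \<cdot> x) = c \<cdot> R \<phi> x"
  by (rule linear_forms_separate_points; simp add: lin_simps lin_simps[OF R_lin])+

lemma L_sum: "lin \<phi> \<Longrightarrow> L \<phi> (sum f I) = (\<Sum>i\<in>I. L \<phi> (f i))"
  by (rule linear_forms_separate_points) (simp add: lin_simps lin_simps[OF L_lin])

lemma LR_diff: "lin \<phi> \<Longrightarrow> R \<phi> (x - y) = R \<phi> x - R \<phi> y" "lin \<phi> \<Longrightarrow> L \<phi> (x - y) = L \<phi> x - L \<phi> y"
  by (rule linear_forms_separate_points; simp add: lin_simps lin_simps[OF L_lin] lin_simps[OF R_lin])+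

lemma LR_zero: "lin \<phi> \<Longrightarrow> R \<phi> 0 = 0" "lin \<phi> \<Longrightarrow> L \<phi> 0 = 0"
  using R_linear(2)[of \<phi> 0 0] L_linear(2)[of \<phi> 0 0] by simp_all

lemma LR_counit [simp]: "L \<epsilon> x = x" "R \<epsilon> x = x"
  by (rule linear_forms_separate_points; simp add: L_apply R_apply comult_counit)+

lemma counit_LR: "lin \<phi> \<Longrightarrow> \<epsilon> (L \<phi> x) = \<phi> x" "lin \<phi> \<Longrightarrow> \<epsilon> (R \<phi> x) = \<phi> x"
  by (simp_all add: L_apply R_apply comult_counit)

lemma LR_one: "lin \<phi> \<Longrightarrow> L \<phi> 1 = \<phi> 1 \<cdot> 1" "lin \<phi> \<Longrightarrow> R \<phi> 1 = \<phi> 1 \<cdot> 1"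
  by (rule linear_forms_separate_points; simp add: L_apply R_apply comult_1 bil_product lin_simps)+

lemma comult_R: "lin \<phi> \<Longrightarrow> comult H (R \<phi> x) \<beta> = comult H x (\<lambda>a b. comult H a \<beta> * \<phi> b)"
  using R_apply[OF _ comult_lin] .

lemma comult_L: "lin \<phi> \<Longrightarrow> comult H (L \<phi> x) \<beta> = comult H x (\<lambda>a b. \<phi> a * comult H b \<beta>)"
  using L_apply[OF _ comult_lin] .

lemma LR_commute:
  assumes "lin \<phi>" "lin \<psi>" shows "L \<phi> (R \<psi> x) = R \<psi> (L \<phi> x)"
proof (rule linear_forms_separate_points)
  fix \<chi> assume \<chi>: "lin \<chi>"
  have "\<chi> (L \<phi> (R \<psi> x)) = comult H x (\<lambda>a b. comult H a (\<lambda>c d. \<phi> c * \<chi> d * \<psi> b))"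
    by (simp add: L_apply assms \<chi> comult_R comult_apply_lin bil_product)
  also have "\<dots> = comult H x (\<lambda>a b. comult H b (\<lambda>c d. \<phi> a * \<chi> c * \<psi> d))"
    by (rule coassociativity[OF trilin_product[OF assms(1) \<chi> assms(2)]])
  also have "\<dots> = \<chi> (R \<psi> (L \<phi> x))"
    by (simp add: R_apply assms \<chi> comult_L comult_apply_lin bil_product mult.assoc)
  finally show "\<chi> (L \<phi> (R \<psi> x)) = \<chi> (R \<psi> (L \<phi> x))" .
qed

lemma L_L:
  assumes "lin \<phi>" "lin \<psi>" shows "L \<phi> (L \<psi> x) = L (\<lambda>y. \<phi> (L \<psi> y)) x"
proof (rule linear_forms_separate_points)
  fix \<chi> assume \<chi>: "lin \<chi>"
  have "\<chi> (L (\<lambda>y. \<phi> (L \<psi> y)) x) = comult H x (\<lambda>a b. comult H a (\<lambda>c d. \<psi> c * \<phi> d * \<chi> b))"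
    by (simp add: L_apply comult_lin assms \<chi> comult_apply_lin bil_product)
  also have "\<dots> = comult H x (\<lambda>a b. comult H b (\<lambda>c d. \<psi> a * \<phi> c * \<chi> d))"
    by (rule coassociativity[OF trilin_product[OF assms(2,1) \<chi>]])
  also have "\<dots> = \<chi> (L \<phi> (L \<psi> x))"
    by (simp add: L_apply assms \<chi> comult_L comult_apply_lin bil_product mult.assoc)
  finally show "\<chi> (L \<phi> (L \<psi> x)) = \<chi> (L (\<lambda>y. \<phi> (L \<psi> y)) x)" by simp
qed

lemma R_R:
  assumes "lin \<phi>" "lin \<psi>" shows "R \<phi> (R \<psi> x) = R (\<lambda>y. \<phi> (R \<psi> y)) x"
proof (rule linear_forms_separate_points)
  fix \<chi> assume \<chi>: "lin \<chi>"
  have "\<chi> (R \<phi> (R \<psi> x)) = comult H x (\<lambda>a b. comult H a (\<lambda>c d. \<chi> c * \<phi> d * \<psi> b))"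
    by (simp add: R_apply assms \<chi> comult_R comult_apply_lin bil_product)
  also have "\<dots> = comult H x (\<lambda>a b. comult H b (\<lambda>c d. \<chi> a * \<phi> c * \<psi> d))"
    by (rule coassociativity[OF trilin_product[OF \<chi> assms(1,2)]])
  also have "\<dots> = \<chi> (R (\<lambda>y. \<phi> (R \<psi> y)) x)"
    by (simp add: R_apply comult_lin assms \<chi> comult_apply_lin bil_product mult.assoc)
  finally show "\<chi> (R \<phi> (R \<psi> x)) = \<chi> (R (\<lambda>y. \<phi> (R \<psi> y)) x)" .
qed


section \<open>Coideals and subcoalgebras\<close>

text \<open>
  Expand the second legs of \<open>\<Delta>(x)\<close> in a finite basis \<open>e\<close> with dual basis \<open>\<psi>\<close>. The first legs
  collected at \<open>e\<^sub>i\<close> then add up to \<open>x\<^sub>1 \<psi>\<^sub>i(x\<^sub>2)\<close>. In particular, when all \<open>R \<psi> x\<close> lie in a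
  subspace, the first legs can be chosen there.
\<close>

lemma comult_expansion:
  obtains n :: nat and e \<psi> where "\<And>i. lin (\<psi> i)" "comult H x = (\<Sum>i<n. elem_tensor H H (R (\<psi> i) x) (e i))"
proof -
  obtain xs where xs: "comult H x = tensor_of_list H H xs"
    using comult_tens[of x] unfolding subtensor_def by blast
  have fd: "findim (span (snd ` set xs))" by (rule findim_span) simp
  obtain n :: nat and e \<psi> where e: "\<And>i. lin (\<psi> i)"
    "\<And>v. v \<in> span (snd ` set xs) \<Longrightarrow> v = (\<Sum>i<n. \<psi> i v \<cdot> e i)"
    by (rule dual_basis[OF fd], rule that)
  have "comult H x \<beta> = (\<Sum>i<n. \<beta> (R (\<psi> i) x) (e i))" if b: "bil \<beta>" for \<beta>
  proof -
    have l: "lin (\<beta> a)" "lin (\<lambda>a. \<beta> a c)" for a c using b by (auto simp: bil_iff)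
    have "(\<Sum>(a, c)\<leftarrow>ys. \<beta> a c) = (\<Sum>i<n. \<Sum>(a, c)\<leftarrow>ys. \<beta> a (e i) * \<psi> i c)" if "set ys \<subseteq> set xs" for ys
      using that
    proof (induction ys)
      case (Cons p ys)
      then have "snd p \<in> span (snd ` set xs)" by (auto intro: span_base)
      then have "\<beta> (fst p) (snd p) = (\<Sum>i<n. \<beta> (fst p) (e i) * \<psi> i (snd p))"
        by (subst e(2)) (auto simp: lin_simps[OF l(1)] mult.commute)
      then show ?case using Cons by (cases p) (simp add: sum.distrib)
    qed simp
    from this[OF order.refl] show ?thesis
      using b e(1) by (simp add: R_apply[OF e(1) l(2)] bil_product l xs tensor_of_list_apply)
  qed
  then show thesis by (intro that[of \<psi> e n, OF e(1)] comult_eqI)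
qed

definition right_coideal :: "'h set \<Rightarrow> bool" where
  "right_coideal V \<longleftrightarrow> subspace V \<and> (\<forall>\<psi> x. lin \<psi> \<longrightarrow> x \<in> V \<longrightarrow> R \<psi> x \<in> V)"

lemma right_coidealD: "right_coideal V \<Longrightarrow> lin \<psi> \<Longrightarrow> x \<in> V \<Longrightarrow> R \<psi> x \<in> V" "right_coideal V \<Longrightarrow> subspace V"
  by (auto simp: right_coideal_def)

lemma comult_in_subtensor_iff:
  assumes A: "subspace A"
  shows "comult H x \<in> subtensor H H A UNIV \<longleftrightarrow> (\<forall>\<psi>. lin \<psi> \<longrightarrow> R \<psi> x \<in> A)"
proof
  assume "comult H x \<in> subtensor H H A UNIV"
  then obtain xs where xs: "set xs \<subseteq> A \<times> UNIV" "comult H x = tensor_of_list H H xs" by (elim subtensorE)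
  show "\<forall>\<psi>. lin \<psi> \<longrightarrow> R \<psi> x \<in> A"
  proof (intro allI impI)
    fix \<psi> assume \<psi>: "lin \<psi>"
    have "R \<psi> x = (\<Sum>(a, b)\<leftarrow>xs. \<psi> b \<cdot> a)"
      unfolding R_def xs(2)
      by (rule tensor_lift_sum[OF vector_space_H])
         (auto simp: scale_left_distrib scale_right_distrib lin_simps[OF \<psi>] mult.commute)
    also have "\<dots> \<in> A" using xs(1)
      by (induction xs) (auto intro!: subspace_add[OF A] subspace_scale[OF A] subspace_0[OF A])
    finally show "R \<psi> x \<in> A" .
  qed
next
  assume R: "\<forall>\<psi>. lin \<psi> \<longrightarrow> R \<psi> x \<in> A"
  obtain n :: nat and e \<psi> where "\<And>i. lin (\<psi> i)" "comult H x = (\<Sum>i<n. elem_tensor H H (R (\<psi> i) x) (e i))"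
    by (rule comult_expansion[where x = x], rule that)
  then show "comult H x \<in> subtensor H H A UNIV"
    using R by (auto intro!: sum_in_subtensor elem_tensor_in_subtensor)
qed

text \<open>
  The first legs of \<open>\<Delta>(x)\<close> lie in \<open>V\<close>; expanding them in the basis \<open>e\<close> collects \<open>\<phi>\<^sub>i(x\<^sub>1) x\<^sub>2\<close> at \<open>e\<^sub>i\<close>.
\<close>

lemma right_coideal_expansion:
  assumes V: "right_coideal V" "x \<in> V" and \<phi>: "\<And>i. lin (\<phi> i)"
    and e: "\<And>v. v \<in> V \<Longrightarrow> v = (\<Sum>i<n. \<phi> i v \<cdot> e i)"
  shows "comult H x = (\<Sum>i<n. elem_tensor H H (e i) (L (\<phi> i) x))"
proof (rule comult_eqI)
  fix \<beta> assume b: "bil \<beta>"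
  have l: "lin (\<beta> a)" "lin (\<lambda>a. \<beta> a c)" for a c using b by (auto simp: bil_iff)
  obtain m :: nat and f \<psi> where f: "\<And>i. lin (\<psi> i)" "comult H x = (\<Sum>i<m. elem_tensor H H (R (\<psi> i) x) (f i))"
    by (rule comult_expansion[where x = x], rule that)
  have "comult H x \<beta> = (\<Sum>j<m. \<beta> (R (\<psi> j) x) (f j))"
    by (rule comult_apply_elem_sum[OF b f(2)])
  also have "\<dots> = (\<Sum>j<m. \<Sum>i<n. \<phi> i (R (\<psi> j) x) * \<beta> (e i) (f j))"
    by (rule sum.cong[OF refl], subst e[OF right_coidealD(1)[OF V(1) f(1) V(2)]])
       (simp add: lin_simps[OF l(2)])
  also have "\<dots> = (\<Sum>i<n. \<Sum>j<m. \<phi> i (R (\<psi> j) x) * \<beta> (e i) (f j))" by (rule sum.swap)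
  also have "\<dots> = (\<Sum>i<n. comult H x (\<lambda>a b. \<phi> i a * \<beta> (e i) b))"
    by (rule sum.cong[OF refl], rule comult_apply_elem_sum[OF _ f(2), symmetric])
      (auto intro!: bil_product \<phi> l)
  also have "\<dots> = (\<Sum>i<n. \<beta> (e i) (L (\<phi> i) x))"
    by (simp add: L_apply[OF \<phi> l(1)])
  finally show "comult H x \<beta> = (\<Sum>i<n. \<beta> (e i) (L (\<phi> i) x))" .
qed

definition subcoalgebra :: "'h set \<Rightarrow> bool" where
  "subcoalgebra V \<longleftrightarrow> right_coideal V \<and> (\<forall>\<phi> x. lin \<phi> \<longrightarrow> x \<in> V \<longrightarrow> L \<phi> x \<in> V)"

lemma right_coideal_span:
  assumes "\<And>\<psi> x. lin \<psi> \<Longrightarrow> x \<in> B \<Longrightarrow> R \<psi> x \<in> span B"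
  shows "right_coideal (span B)"
  unfolding right_coideal_def
proof (intro conjI allI impI)
  fix \<psi> x assume \<psi>: "lin \<psi>" and x: "x \<in> span B"
  from x show "R \<psi> x \<in> span B"
    by (induction rule: span_induct_alt)
      (auto simp: LR_zero R_linear \<psi> intro!: span_zero span_add span_scale assms)
qed simp

lemma L_finite_span: "\<exists>C. finite C \<and> (\<forall>\<phi>. lin \<phi> \<longrightarrow> L \<phi> x \<in> span C)"
proof -
  obtain n :: nat and e \<psi> where e: "\<And>i. lin (\<psi> i)" "comult H x = (\<Sum>i<n. elem_tensor H H (R (\<psi> i) x) (e i))"
    by (rule comult_expansion[where x = x], rule that)
  have "L \<phi> x \<in> span (e ` {..<n})" if "lin \<phi>" for \<phi>
  proof -
    have "hbil (\<lambda>a b. \<phi> a \<cdot> b)"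
      using that by (auto simp: hbil_def lin_simps bil_iff)
    from comult_lift_sum[OF this e(2)] show ?thesis
      unfolding L_def by (auto intro!: span_sum span_scale intro: span_base)
  qed
  then show ?thesis by (intro exI[of _ "e ` {..<n}"]) simp
qed

text \<open>
  The elements \<open>L \<phi> (R \<psi> x)\<close> are the middle legs of \<open>\<Delta>\<^sup>2(x)\<close> and span a subcoalgebra. It is
  finite-dimensional since \<open>R \<psi> x\<close> runs through a finite span and, for each spanning element, so
  does the result of applying \<open>L \<phi>\<close>.
\<close>

lemma finite_subcoalgebra:
  obtains V where "findim V" "subcoalgebra V" "x \<in> V"
proof -
  define B where "B = {L \<phi> (R \<psi> x) | \<phi> \<psi>. lin \<phi> \<and> lin \<psi>}"
  obtain n :: nat and e \<psi> where e: "\<And>i. lin (\<psi> i)" "comult H x = (\<Sum>i<n. elem_tensor H H (R (\<psi> i) x) (e i))"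
    by (rule comult_expansion[where x = x], rule that)
  obtain D where D: "\<And>y. finite (D y)" "\<And>y \<phi>. lin \<phi> \<Longrightarrow> L \<phi> y \<in> span (D y)"
    using L_finite_span by metis
  define C where "C = (\<Union>i<n. D (R (\<psi> i) x))"
  have finC: "finite C" by (simp add: C_def D(1))
  have "L \<phi> (R \<theta> x) \<in> span C" if l: "lin \<phi>" "lin \<theta>" for \<phi> \<theta>
  proof -
    have "hbil (\<lambda>a b. \<theta> b \<cdot> a)"
      using l by (auto simp: hbil_def lin_simps bil_iff)
    then have "R \<theta> x = (\<Sum>i<n. \<theta> (e i) \<cdot> R (\<psi> i) x)"
      unfolding R_def[of \<theta>] by (rule comult_lift_sum[OF _ e(2)])
    then have "L \<phi> (R \<theta> x) = (\<Sum>i<n. \<theta> (e i) \<cdot> L \<phi> (R (\<psi> i) x))"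
      by (simp add: L_sum L_linear l)
    moreover have "L \<phi> (R (\<psi> i) x) \<in> span C" if "i < n" for i
      using D(2)[OF l(1)] span_mono[of "D (R (\<psi> i) x)" C] that by (auto simp: C_def)
    ultimately show ?thesis by (auto intro!: span_sum span_scale)
  qed
  then have "B \<subseteq> span C" by (auto simp: B_def)
  then have "span B \<subseteq> span C" by (simp add: span_minimal)
  then have "findim (span B)" using findim_subset[OF findim_span[OF finC], of "span B"] by simp
  moreover have "subcoalgebra (span B)"
    unfolding subcoalgebra_def
  proof (intro conjI allI impI)
    show "right_coideal (span B)"
    proof (rule right_coideal_span)
      fix \<psi> y assume \<psi>: "lin \<psi>" and "y \<in> B"
      then obtain \<phi> \<theta> where y: "y = L \<phi> (R \<theta> x)" "lin \<phi>" "lin \<theta>" by (auto simp: B_def)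
      then have "R \<psi> y = L \<phi> (R (\<lambda>z. \<psi> (R \<theta> z)) x)"
        using \<psi> by (simp add: LR_commute[symmetric] R_R)
      also have "\<dots> \<in> B" unfolding B_def using y \<psi> R_lin by blast
      finally show "R \<psi> y \<in> span B" by (rule span_base)
    qed
    fix \<psi> y assume \<psi>: "lin \<psi>" and y: "y \<in> span B"
    from y show "L \<psi> y \<in> span B"
    proof (induction rule: span_induct_alt)
      case (step c b y)
      from \<open>b \<in> B\<close> obtain \<phi> \<theta> where b: "b = L \<phi> (R \<theta> x)" "lin \<phi>" "lin \<theta>" by (auto simp: B_def)
      then have "L \<psi> b = L (\<lambda>z. \<psi> (L \<phi> z)) (R \<theta> x)"
        using \<psi> by (simp add: L_L)
      also have "\<dots> \<in> B" unfolding B_def using b \<psi> L_lin by blast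
      finally show ?case using step \<psi> by (auto simp: L_linear intro!: span_add span_scale intro: span_base)
    qed (auto simp: LR_zero \<psi> intro: span_zero)
  qed
  moreover have "x \<in> span B"
    by (rule span_base) (auto simp: B_def intro!: exI[of _ \<epsilon>])
  ultimately show thesis using that by blast
qed

lemma right_coideal_Un: 
  assumes "right_coideal V" "right_coideal W" shows "right_coideal (span (V \<union> W))"
  by (rule right_coideal_span) (use assms in \<open>auto intro: span_base right_coidealD\<close>)

end

context hopf_star
begin

section \<open>Matrix coalgebras and compatible inner products\<close>

text \<open>
  The matrix of a comodule with coaction \<open>e\<^sub>j \<mapsto> \<Sum>\<^sub>i e\<^sub>i \<otimes> u\<^sub>i\<^sub>j\<close>.
\<close>

definition corep :: "nat \<Rightarrow> (nat \<Rightarrow> nat \<Rightarrow> 'h) \<Rightarrow> bool" where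
  "corep n u \<longleftrightarrow> (\<forall>i<n. \<forall>j<n. comult H (u i j) = (\<Sum>k<n. elem_tensor H H (u i k) (u k j)) \<and>
     \<epsilon> (u i j) = (if i = j then 1 else 0))"

text \<open>
  This is coassociativity at \<open>e\<^sub>j\<close>, read in the coordinate \<open>e\<^sub>i\<close> of the first leg.
\<close>

lemma corep_of_right_coideal:
  assumes V: "right_coideal V" and \<phi>: "\<And>i. lin (\<phi> i)" and eV: "\<And>i. i < n \<Longrightarrow> e i \<in> V"
    and dual: "\<And>i j. i < n \<Longrightarrow> j < n \<Longrightarrow> \<phi> i (e j) = (if i = j then 1 else 0)"
    and e: "\<And>v. v \<in> V \<Longrightarrow> v = (\<Sum>i<n. \<phi> i v \<cdot> e i)"
  shows "corep n (\<lambda>i j. L (\<phi> i) (e j))"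
  unfolding corep_def
proof (intro allI impI conjI comult_eqI)
  fix i j assume ij: "i < n" "j < n"
  show "\<epsilon> (L (\<phi> i) (e j)) = (if i = j then 1 else 0)"
    using dual ij by (simp add: counit_LR \<phi>)
  fix \<beta> assume b: "bil \<beta>"
  then have l: "lin (\<beta> a)" "lin (\<lambda>a. \<beta> a c)" for a c by (auto simp: bil_iff)
  have tri: "trilinear_form H H H (\<lambda>a b c. \<phi> i a * \<beta> b c)"
    using b \<phi> by (auto simp: trilinear_form_def bil_iff)
  have bl: "bil (\<lambda>a b. comult H a (\<lambda>c d. \<phi> i c * \<beta> d b))"
  proof -
    have "bil (\<lambda>c d. \<phi> i c * \<beta> d b)" for b using l \<phi> by (auto simp: bil_iff)
    note b1 = this
    have "lin (\<lambda>b. comult H a (\<lambda>c d. \<phi> i c * \<beta> d b))" for a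
      by (rule linI)
        (simp_all add: lin_simps(1,2)[OF l(1)] distrib_left comult_apply_lin(1)[OF b1 b1] 
          comult_apply_lin(2)[OF b1, symmetric] mult.left_commute)
    then show ?thesis by (auto simp: bil_iff comult_lin)
  qed
  have "comult H (L (\<phi> i) (e j)) \<beta> = comult H (e j) (\<lambda>a b. comult H b (\<lambda>c d. \<phi> i a * \<beta> c d))"
    by (simp add: comult_L \<phi> comult_apply_lin(2)[OF b])
  also have "\<dots> = comult H (e j) (\<lambda>a b. comult H a (\<lambda>c d. \<phi> i c * \<beta> d b))"
    by (rule coassociativity[OF tri, symmetric])
  also have "\<dots> = (\<Sum>k<n. comult H (e k) (\<lambda>c d. \<phi> i c * \<beta> d (L (\<phi> k) (e j))))"
    by (rule comult_apply_elem_sum[OF bl right_coideal_expansion[OF V eV[OF ij(2)] \<phi> e]])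
  also have "\<dots> = (\<Sum>k<n. \<beta> (L (\<phi> i) (e k)) (L (\<phi> k) (e j)))"
    by (simp add: L_apply[OF \<phi> l(2)])
  finally show "comult H (L (\<phi> i) (e j)) \<beta> = (\<Sum>k<n. \<beta> (L (\<phi> i) (e k)) (L (\<phi> k) (e j)))" .
qed


definition cvec :: "nat \<Rightarrow> (complex, nat \<Rightarrow> complex) module" where
  "cvec n = \<lparr>carrier = {f. \<forall>i\<ge>n. f i = 0}, mult = undefined, one = undefined,
     zero = 0, add = (+), smult = (\<lambda>c f i. c * f i)\<rparr>"

definition unit_vec :: "nat \<Rightarrow> nat \<Rightarrow> complex" where
  "unit_vec i = (\<lambda>k. if k = i then 1 else 0)"

text \<open>
  The comodule with matrix \<open>u\<close> on the sequences supported in \<open>{..<n}\<close>: the CQG condition speaks of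
  comodules whose vectors are complex sequences.
\<close>

definition matrix_comodule :: "nat \<Rightarrow> (nat \<Rightarrow> nat \<Rightarrow> 'h) \<Rightarrow> ('h, nat \<Rightarrow> complex) comodule" where
  "matrix_comodule n u = \<lparr>carrier = carrier (cvec n), mult = mult (cvec n), one = one (cvec n),
     zero = zero (cvec n), add = add (cvec n), smult = smult (cvec n),
     coact = (\<lambda>m \<beta>. \<Sum>j<n. m j * (\<Sum>i<n. elem_tensor (cvec n) H (unit_vec i) (u i j) \<beta>))\<rparr>"

lemma cvec_simps [simp]:
  "carrier (cvec n) = {f. \<forall>i\<ge>n. f i = 0}" "zero (cvec n) = 0" "add (cvec n) = (+)"
  "smult (cvec n) = (\<lambda>c f i. c * f i)"
  by (auto simp: cvec_def)

lemma matrix_comodule_simps [simp]: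
  "carrier (matrix_comodule n u) = {f. \<forall>i\<ge>n. f i = 0}" "zero (matrix_comodule n u) = 0"
  "add (matrix_comodule n u) = (+)" "smult (matrix_comodule n u) = (\<lambda>c f i. c * f i)"
  by (auto simp: matrix_comodule_def)

lemma cspace_matrix_comodule: "cvector_space (matrix_comodule n u)"
proof (rule cspaceI)
  show "abelian_group (matrix_comodule n u)"
  proof (rule abelian_groupI)
    fix f assume "f \<in> carrier (matrix_comodule n u)"
    then show "\<exists>g\<in>carrier (matrix_comodule n u). g \<oplus>\<^bsub>matrix_comodule n u\<^esub> f = \<zero>\<^bsub>matrix_comodule n u\<^esub>"
      by (intro bexI[of _ "\<lambda>i. - f i"]) (auto simp: fun_eq_iff)
  qed (auto simp: algebra_simps)
qed (auto simp: fun_eq_iff algebra_simps)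

lemma unit_vec_carrier: "i < n \<Longrightarrow> unit_vec i \<in> carrier (matrix_comodule n u)"
  by (auto simp: unit_vec_def)

lemma elem_tensor_matrix_comodule: "elem_tensor (cvec n) H = elem_tensor (matrix_comodule n u) H"
  by (auto simp: elem_tensor_def fun_eq_iff bilinear_form_iff)

lemma coact_def:
  "coact (matrix_comodule n u) m \<beta> =
     (\<Sum>j<n. m j * (\<Sum>i<n. elem_tensor (matrix_comodule n u) H (unit_vec i) (u i j) \<beta>))"
  unfolding elem_tensor_matrix_comodule[symmetric] by (simp add: matrix_comodule_def)

lemma coact_matrix_comodule:
  assumes "bilinear_form (matrix_comodule n u) H \<beta>"
  shows "coact (matrix_comodule n u) m \<beta> = (\<Sum>j<n. m j * (\<Sum>i<n. \<beta> (unit_vec i) (u i j)))"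
  using assms by (simp add: coact_def elem_tensor_apply)

lemma coact_tens: "coact (matrix_comodule n u) m \<in> tens (matrix_comodule n u) H"
proof -
  let ?M = "matrix_comodule n u"
  have "coact ?M m = (\<Sum>j<n. (\<lambda>\<beta>. m j * (\<Sum>i<n. elem_tensor ?M H (unit_vec i) (u i j)) \<beta>))"
    by (simp add: fun_eq_iff coact_def sum_fun_apply)
  also have "\<dots> \<in> tens ?M H"
    using unit_vec_carrier[of _ n u]
    by (intro sum_in_subtensor scale_in_tens cspace_matrix_comodule elem_tensor_in_subtensor) auto
  finally show ?thesis .
qed

lemma cvec_expand:
  assumes "m \<in> carrier (matrix_comodule n u)"
  shows "m = (\<Sum>j<n. (\<lambda>k. m j * unit_vec j k))"
proof
  fix k
  have "(\<Sum>j<n. m j * unit_vec j k) = (\<Sum>j<n. if j = k then m k else 0)"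
    by (intro sum.cong) (auto simp: unit_vec_def)
  then show "m k = (\<Sum>j<n. (\<lambda>k. m j * unit_vec j k)) k"
    using assms by (simp add: sum_fun_apply)
qed

lemma cvec_linear_form:
  assumes f: "linear_form (matrix_comodule n u) f" and m: "m \<in> carrier (matrix_comodule n u)"
  shows "f m = (\<Sum>j<n. m j * f (unit_vec j))"
proof -
  have fl: "f (a + b) = f a + f b" "f (\<lambda>i. c * a i) = c * f a"
    if "a \<in> carrier (matrix_comodule n u)" "b \<in> carrier (matrix_comodule n u)" for a b c
    using f that by (auto simp: linear_form_iff)
  have f0: "f 0 = 0" using fl(2)[of 0 0 0] by (simp add: zero_fun_def)
  have "J \<subseteq> {..<n} \<Longrightarrow> f (\<Sum>j\<in>J. (\<lambda>k. m j * unit_vec j k)) = (\<Sum>j\<in>J. m j * f (unit_vec j)) \<and>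
      (\<Sum>j\<in>J. (\<lambda>k. m j * unit_vec j k)) \<in> carrier (matrix_comodule n u)" for J
  proof (induction J rule: infinite_finite_induct)
    case (insert j J)
    have "unit_vec j \<in> carrier (matrix_comodule n u)" "(\<lambda>k. m j * unit_vec j k) \<in> carrier (matrix_comodule n u)"
      using insert.prems by (auto simp: unit_vec_def)
    then show ?case using insert fl(1)[of "\<lambda>k. m j * unit_vec j k" "\<Sum>j\<in>J. (\<lambda>k. m j * unit_vec j k)"] fl(2)
      by (auto simp: plus_fun_def)
  qed (auto simp: f0)
  from this[of "{..<n}"] cvec_expand[OF m] show ?thesis by simp
qed

lemma coact_linear: "linear_between (matrix_comodule n u) (tensor_space (matrix_comodule n u) H) (coact (matrix_comodule n u))"
  using coact_tens[of n u]
  by (auto simp: linear_between_def fun_eq_iff coact_def sum.distrib algebra_simps sum_distrib_left)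

lemma right_comodule_matrix_comodule:
  assumes u: "corep n u"
  shows "right_comodule H (matrix_comodule n u)"
proof -
  let ?M = "matrix_comodule n u"
  note uD = u[unfolded corep_def, rule_format]
  have coassoc: "coact ?M m (\<lambda>a h. coact ?M a (\<lambda>a b. \<gamma> a b h)) = coact ?M m (\<lambda>a h. comult H h (\<gamma> a))"
    if tri: "trilinear_form ?M H H \<gamma>" for \<gamma> m
  proof -
    note b = bilinear_of_trilinear[OF cspace_matrix_comodule cspace_H tri]
    have b1: "bilinear_form ?M H (\<lambda>a b. \<gamma> a b h)" for h
      using tri by (auto simp: trilinear_form_def linear_form_iff bilinear_form_iff)
    have b2: "bil (\<gamma> (unit_vec i))" if "i < n" for i
      using tri unit_vec_carrier[OF that, of u] by (auto simp: trilinear_form_def)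
    have uv: "unit_vec i k = (if k = i then 1 else 0)" for i k by (simp add: unit_vec_def)
    have "coact ?M m (\<lambda>a h. coact ?M a (\<lambda>a b. \<gamma> a b h)) =
        (\<Sum>j<n. m j * (\<Sum>i<n. coact ?M (unit_vec i) (\<lambda>a b. \<gamma> a b (u i j))))"
      by (rule coact_matrix_comodule[OF bilinear_form_comp(1)[OF b(2) coact_linear]])
    also have "\<dots> = (\<Sum>j<n. m j * (\<Sum>i<n. \<Sum>k<n. \<gamma> (unit_vec k) (u k i) (u i j)))"
      by (intro sum.cong refl arg_cong2[where f = "(*)"])
        (simp add: coact_matrix_comodule[OF b1] uv if_distrib[of "\<lambda>c. c * _"] cong: if_cong)
    also have "\<dots> = (\<Sum>j<n. m j * (\<Sum>k<n. \<Sum>i<n. \<gamma> (unit_vec k) (u k i) (u i j)))"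
      by (intro sum.cong refl arg_cong2[where f = "(*)"] sum.swap)
    also have "\<dots> = (\<Sum>j<n. m j * (\<Sum>k<n. comult H (u k j) (\<gamma> (unit_vec k))))"
      using uD by (intro sum.cong refl arg_cong2[where f = "(*)"] comult_apply_elem_sum[symmetric] b2) auto
    also have "\<dots> = coact ?M m (\<lambda>a h. comult H h (\<gamma> a))"
      by (rule coact_matrix_comodule[OF bilinear_form_comp(2)[OF b(1) comult_linear], symmetric])
    finally show ?thesis .
  qed
  have counit: "coact ?M m (\<lambda>a b. \<psi> a * \<epsilon> b) = \<psi> m"
    if \<psi>: "linear_form ?M \<psi>" and m: "m \<in> carrier ?M" for \<psi> m
  proof -
    have "bilinear_form ?M H (\<lambda>a b. \<psi> a * \<epsilon> b)"
      using \<psi> lin_simps[OF counit_lin] by (auto simp: bilinear_form_iff linear_form_iff algebra_simps)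
    then have "coact ?M m (\<lambda>a b. \<psi> a * \<epsilon> b) = (\<Sum>j<n. m j * (\<Sum>i<n. \<psi> (unit_vec i) * \<epsilon> (u i j)))"
      by (rule coact_matrix_comodule)
    also have "\<dots> = (\<Sum>j<n. m j * (\<Sum>i<n. if i = j then \<psi> (unit_vec j) else 0))"
      using uD by (intro sum.cong refl arg_cong2[where f = "(*)"]) auto
    also have "\<dots> = \<psi> m" using cvec_linear_form[OF \<psi> m] by simp
    finally show ?thesis .
  qed
  show ?thesis
    unfolding right_comodule_def
    using cspace_matrix_comodule coact_linear coassoc counit
      coassociative_iff[OF cspace_matrix_comodule cspace_H coact_linear comult_linear coact_tens]
      counit_right_iff[OF cspace_matrix_comodule cspace_H _ coact_tens]
    by simp
qed

lemma finite_dim_matrix_comodule: "finite_dim (matrix_comodule n u)"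
proof -
  let ?M = "matrix_comodule n u"
  interpret M: Module.module complex_ring ?M by (rule cspace_matrix_comodule)
  have fs: "(\<Oplus>\<^bsub>?M\<^esub>b\<in>B. f b) = (\<Sum>b\<in>B. f b)" if "finite B" "f \<in> B \<rightarrow> carrier ?M" for B f
    using that by (induction B rule: finite_induct) (auto simp: M.finsum_insert Pi_iff)
  have inj: "inj_on unit_vec {..<n}"
    by (auto simp: inj_on_def unit_vec_def fun_eq_iff split: if_splits)
  have "\<exists>c. x = (\<Oplus>\<^bsub>?M\<^esub>b\<in>unit_vec ` {..<n}. c b \<odot>\<^bsub>?M\<^esub> b)" if "x \<in> carrier ?M" for x
  proof -
    define c where "c b = x (the_inv_into {..<n} unit_vec b)" for b
    have "(\<Oplus>\<^bsub>?M\<^esub>b\<in>unit_vec ` {..<n}. c b \<odot>\<^bsub>?M\<^esub> b) = (\<Sum>b\<in>unit_vec ` {..<n}. c b \<odot>\<^bsub>?M\<^esub> b)"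
      by (rule fs) (auto simp: unit_vec_def)
    also have "\<dots> = (\<Sum>j<n. (\<lambda>k. x j * unit_vec j k))"
      by (simp add: sum.reindex[OF inj] c_def the_inv_into_f_f[OF inj])
    also have "\<dots> = x" by (rule cvec_expand[OF that, symmetric])
    finally show ?thesis by (intro exI) (rule sym)
  qed
  then show ?thesis
    unfolding finite_dim_def using unit_vec_carrier[of _ n u]
    by (intro exI[of _ "unit_vec ` {..<n}"]) auto
qed

text \<open>
  The coaction of the dual comodule is a definite description, so one has to know that it
  denotes. With the coordinate forms \<open>co\<^sub>k\<close>, a solution is \<open>\<Sum>\<^sub>k co\<^sub>k \<otimes> \<Sum>\<^sub>l f(e\<^sub>l) S(u\<^sub>l\<^sub>k)\<close>. It is
  unique because every \<open>f\<^sub>0\<close> is the sum of \<open>f\<^sub>0(e\<^sub>k) co\<^sub>k\<close>, so that a tensor \<open>t\<close> is determined by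
  the elements \<open>\<Sum> f\<^sub>0(e\<^sub>k) f\<^sub>1\<close>.
\<close>

lemma dual_coaction_exists:
  assumes f: "f \<in> carrier (dual_space (matrix_comodule n u))"
  defines "M \<equiv> matrix_comodule n u"
  defines "P \<equiv> \<lambda>t. t \<in> carrier (tensor_space (dual_space M) H) \<and>
        (\<forall>m\<in>carrier M. \<forall>\<chi>. lin \<chi> \<longrightarrow>
           t (\<lambda>f\<^sub>0 f\<^sub>1. f\<^sub>0 m * \<chi> f\<^sub>1) = coact M m (\<lambda>m\<^sub>0 m\<^sub>1. f m\<^sub>0 * \<chi> (S m\<^sub>1)))"
  shows "\<exists>!t. P t"
proof -
  let ?D = "dual_space M"
  have fl: "linear_form M f" using f by (simp add: dual_space_def M_def)
  define co where "co k = (\<lambda>m. if m \<in> carrier M then m k else (0::complex))" for k :: nat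
  have co: "co k \<in> carrier ?D" if "k < n" for k
    using that by (auto simp: dual_space_def co_def linear_form_iff M_def)
  have bev: "bilinear_form ?D H (\<lambda>f\<^sub>0 f\<^sub>1. f\<^sub>0 m * \<chi> f\<^sub>1)" if "lin \<chi>" for m \<chi>
    using lin_simps[OF that] by (auto simp: bilinear_form_iff dual_space_def algebra_simps)
  have cD: "cvector_space ?D"
  proof (rule cspaceI)
    show "abelian_group ?D"
    proof (rule abelian_groupI)
      fix g assume "g \<in> carrier ?D"
      then show "\<exists>k\<in>carrier ?D. k \<oplus>\<^bsub>?D\<^esub> g = \<zero>\<^bsub>?D\<^esub>"
        by (intro bexI[of _ "\<lambda>x. - g x"]) (auto simp: dual_space_def linear_form_iff fun_eq_iff)
    qed (auto simp: dual_space_def linear_form_iff fun_eq_iff algebra_simps)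
  qed (auto simp: dual_space_def linear_form_iff fun_eq_iff algebra_simps)
  have expand: "t \<beta> = (\<Sum>k<n. t (\<lambda>f\<^sub>0 f\<^sub>1. f\<^sub>0 (unit_vec k) * \<beta> (co k) f\<^sub>1))"
    if t: "t \<in> tens ?D H" and b: "bilinear_form ?D H \<beta>" for t \<beta>
  proof -
    have l: "lin (\<beta> (co k))" if "k < n" for k using b co[OF that] by (auto simp: bilinear_form_def)
    have "\<beta> g h = (\<Sum>k<n. g (unit_vec k) * \<beta> (co k) h)" if g: "g \<in> carrier ?D" for g h
    proof -
      have gl: "linear_form M g" and g0: "\<And>x. x \<notin> carrier M \<Longrightarrow> g x = 0" using g by (auto simp: dual_space_def)
      have g_eq: "g = (\<Sum>k<n. (\<lambda>x. g (unit_vec k) * co k x))"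
      proof
        fix x show "g x = (\<Sum>k<n. (\<lambda>x. g (unit_vec k) * co k x)) x"
          using cvec_linear_form[OF gl[unfolded M_def], of x] g0[of x]
          by (cases "x \<in> carrier M")
            (simp_all add: sum_fun_apply co_def M_def mult.commute del: matrix_comodule_simps)
      qed
      have J: "J \<subseteq> {..<n} \<Longrightarrow> (\<Sum>k\<in>J. (\<lambda>x. g (unit_vec k) * co k x)) \<in> carrier ?D \<and>
          \<beta> (\<Sum>k\<in>J. (\<lambda>x. g (unit_vec k) * co k x)) h = (\<Sum>k\<in>J. g (unit_vec k) * \<beta> (co k) h)" for J
      proof (induction J rule: infinite_finite_induct)
        case (insert k J)
        have ck: "co k \<in> carrier ?D" using insert.prems co by auto
        then have "(\<lambda>x. g (unit_vec k) * co k x) \<in> carrier ?D"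
          by (auto simp: dual_space_def linear_form_iff algebra_simps)
        moreover have "\<beta> (\<lambda>x. g (unit_vec k) * co k x) h = g (unit_vec k) * \<beta> (co k) h"
          using b ck by (auto simp: bilinear_form_iff dual_space_def)
        moreover have "\<beta> (a + c) h = \<beta> a h + \<beta> c h" "a + c \<in> carrier ?D" if "a \<in> carrier ?D" "c \<in> carrier ?D" for a c
          using b that cspace_closed(1)[OF cD that] by (auto simp: bilinear_form_iff dual_space_def)
        ultimately show ?case using insert by (simp add: plus_fun_def)
      next
        case empty
        have z: "(0::(nat \<Rightarrow> complex) \<Rightarrow> complex) \<in> carrier ?D" by (auto simp: dual_space_def linear_form_iff)
        then have "\<beta> (0 \<odot>\<^bsub>?D\<^esub> 0) h = 0 * \<beta> 0 h"
          using b by (simp add: bilinear_form_iff)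
        moreover have "0 \<odot>\<^bsub>?D\<^esub> 0 = 0" by (simp add: dual_space_def fun_eq_iff)
        ultimately show ?case using z by (simp add: zero_fun_def)
      qed (use finite_subset in blast)
      from J[of "{..<n}"] show ?thesis unfolding g_eq[symmetric] by simp
    qed
    then have "t \<beta> = t (\<lambda>g h. \<Sum>k<n. g (unit_vec k) * \<beta> (co k) h)"
      by (intro tensor_apply_cong[OF cD cspace_H t])
    also have "\<dots> = (\<Sum>k<n. t (\<lambda>f\<^sub>0 f\<^sub>1. f\<^sub>0 (unit_vec k) * \<beta> (co k) f\<^sub>1))"
      by (rule tensor_apply_sum(1)[OF t]) (auto intro: bev l)
    finally show ?thesis .
  qed
  define t0 where "t0 = (\<Sum>k<n. elem_tensor ?D H (co k) (\<Sum>l<n. f (unit_vec l) \<cdot> S (u l k)))"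
  have "P t0"
    unfolding P_def
  proof (intro conjI ballI allI impI)
    show "t0 \<in> carrier (tensor_space ?D H)"
      unfolding t0_def using co by (auto intro!: sum_in_subtensor elem_tensor_in_subtensor)
    fix m \<chi> assume m: "m \<in> carrier M" and \<chi>: "lin \<chi>"
    have "t0 (\<lambda>f\<^sub>0 f\<^sub>1. f\<^sub>0 m * \<chi> f\<^sub>1) = (\<Sum>k<n. m k * (\<Sum>l<n. f (unit_vec l) * \<chi> (S (u l k))))"
      using bev[OF \<chi>] m by (simp add: t0_def sum_fun_apply elem_tensor_apply co_def lin_simps[OF \<chi>])
    also have "\<dots> = coact M m (\<lambda>m\<^sub>0 m\<^sub>1. f m\<^sub>0 * \<chi> (S m\<^sub>1))"
      unfolding M_def
      using fl lin_simps[OF \<chi>] by (intro coact_matrix_comodule[symmetric])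
        (auto simp: bilinear_form_iff linear_form_iff M_def antipode_linear algebra_simps)
    finally show "t0 (\<lambda>f\<^sub>0 f\<^sub>1. f\<^sub>0 m * \<chi> f\<^sub>1) = coact M m (\<lambda>m\<^sub>0 m\<^sub>1. f m\<^sub>0 * \<chi> (S m\<^sub>1))" .
  qed
  moreover have "t = t0" if "P t" for t
  proof (rule tensor_eqI)
    show tt: "t \<in> tens ?D H" "t0 \<in> tens ?D H" using that \<open>P t0\<close> by (auto simp: P_def)
    fix \<beta> assume b: "bilinear_form ?D H \<beta>"
    have l: "lin (\<beta> (co k))" if "k < n" for k using b co[OF that] by (auto simp: bilinear_form_def)
    have uc: "unit_vec k \<in> carrier M" if "k < n" for k using unit_vec_carrier[OF that] by (simp add: M_def)
    show "t \<beta> = t0 \<beta>"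
      unfolding expand[OF tt(1) b] expand[OF tt(2) b]
      using that \<open>P t0\<close> uc l by (intro sum.cong) (auto simp: P_def)
  qed
  ultimately show ?thesis by blast
qed

text \<open>
  \<open>Q\<close> is the Gram matrix of a compatible inner product on the comodule with matrix \<open>u\<close>, and the
  last equation is the colinearity of the map from the conjugate to the dual comodule at \<open>e\<^sub>j\<close>,
  evaluated at \<open>e\<^sub>i\<close>.
\<close>

lemma compatible_matrix:
  assumes cqg: "cqg_algebra H" and u: "corep n u"
  obtains Q where "\<And>i j. i < n \<Longrightarrow> j < n \<Longrightarrow> Q j i = cnj (Q i j)"
    "\<And>c. (\<exists>i<n. c i \<noteq> 0) \<Longrightarrow> 0 < Re (\<Sum>i<n. \<Sum>j<n. c i * cnj (c j) * Q i j)"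
    "\<And>i j. i < n \<Longrightarrow> j < n \<Longrightarrow> (\<Sum>k<n. Q i k \<cdot> st (u k j)) = (\<Sum>k<n. Q k j \<cdot> S (u k i))"
proof -
  let ?M = "matrix_comodule n u"
  let ?C = "conj_comodule H ?M"
  let ?D = "dual_space ?M"
  obtain ip where ip: "compatible_inner_product H ?M ip"
    using cqg right_comodule_matrix_comodule[OF u] finite_dim_matrix_comodule[of n u]
    unfolding cqg_algebra_def by blast
  let ?F = "\<lambda>y x. if x \<in> carrier ?M then ip x y else 0"
  have ipl: "linear_form ?M (\<lambda>x. ip x y)" and ips: "ip y x = cnj (ip x y)"
    and ipp: "x \<noteq> 0 \<Longrightarrow> Re (ip x x) > 0" if "x \<in> carrier ?M" "y \<in> carrier ?M" for x y
    using ip that unfolding compatible_inner_product_def inner_product_def matrix_comodule_simps(2) by blast+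
  have F: "comodule_map H ?C (dual_comodule H ?M) ?F"
    using ip by (simp add: compatible_inner_product_def)
  have uc: "unit_vec k \<in> carrier ?M" if "k < n" for k using unit_vec_carrier[OF that] .
  have Cs: "carrier ?C = carrier ?M" "add ?C = add ?M" "smult ?C = (\<lambda>c. smult ?M (cnj c))"
    "carrier (conj_space ?M) = carrier ?M" "add (conj_space ?M) = add ?M" "smult (conj_space ?M) = (\<lambda>c. smult ?M (cnj c))"
    by (simp_all add: conj_comodule_def conj_space_def)
  have Ds: "carrier (dual_comodule H ?M) = carrier ?D" "add (dual_comodule H ?M) = add ?D" "smult (dual_comodule H ?M) = smult ?D"
    by (simp_all add: dual_comodule_def)
  have bC: "bilinear_form (conj_space ?M) H = bilinear_form ?C H"
    and bD: "bilinear_form (dual_comodule H ?M) H = bilinear_form ?D H"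
    by (auto simp: fun_eq_iff bilinear_form_iff Cs Ds)
  have eC: "elem_tensor (conj_space ?M) H = elem_tensor ?C H"
    and eD: "elem_tensor (dual_comodule H ?M) H = elem_tensor ?D H"
    by (auto simp: fun_eq_iff elem_tensor_def bC bD)
  have tC: "tens (conj_space ?M) H = tens ?C H" and tD: "tens (dual_comodule H ?M) H = tens ?D H"
    by (auto simp: subtensor_def tensor_of_list_def eC eD Cs Ds)
  have Flin: "linear_between ?C (dual_comodule H ?M) ?F" using F by (simp add: comodule_map_def)
  have cC: "cnj (elem_tensor (conj_space ?M) H m (st h) \<beta>) = cnj (if bilinear_form ?C H \<beta> then \<beta> m (st h) else 0)" for m h \<beta>
    by (simp add: elem_tensor_apply bC)
  have bl: "bilinear_form ?M H (\<lambda>m h. cnj (elem_tensor (conj_space ?M) H m (st h) \<beta>))" for \<beta>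
  proof (cases "bilinear_form ?C H \<beta>")
    case True
    have s: "smult ?M c x = smult ?C (cnj c) x" for c x by (simp add: Cs)
    show ?thesis unfolding cC using True
      by (simp add: bilinear_form_iff star_anti Cs del: matrix_comodule_simps) (auto simp: s simp del: matrix_comodule_simps) 
  next
    case False
    have "bilinear_form ?M H (\<lambda>m h. 0)" by (simp add: bilinear_form_iff)
    with False show ?thesis unfolding cC by simp
  qed
  have cj: "coact ?C m \<beta> = cnj (\<Sum>j<n. m j * (\<Sum>i<n. cnj (\<beta> (unit_vec i) (st (u i j)))))"
    if b: "bilinear_form ?C H \<beta>" for m \<beta>
  proof -
    have "coact ?C m \<beta> = cnj (coact ?M m (\<lambda>m h. cnj (elem_tensor (conj_space ?M) H m (st h) \<beta>)))"
      using tensor_lift_antilinear[where b = "\<lambda>m h. elem_tensor (conj_space ?M) H m (st h)", OF coact_tens bl]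
      by (simp add: conj_comodule_def)
    then show ?thesis using b by (simp add: coact_matrix_comodule[OF bl]) (simp add: elem_tensor_apply bC)
  qed
  have ctens: "coact ?C m \<in> tens ?C H" for m
  proof -
    have "coact ?C m = (\<lambda>\<beta>. \<Sum>j<n. cnj (m j) * (\<Sum>i<n. elem_tensor ?C H (unit_vec i) (st (u i j)) \<beta>))"
    proof
      fix \<beta> 
      have "coact ?C m \<beta> = cnj (coact ?M m (\<lambda>m h. cnj (elem_tensor (conj_space ?M) H m (st h) \<beta>)))"
        using tensor_lift_antilinear[where b = "\<lambda>m h. elem_tensor (conj_space ?M) H m (st h)", OF coact_tens bl]
        by (simp add: conj_comodule_def)
      then show "coact ?C m \<beta> = (\<Sum>j<n. cnj (m j) * (\<Sum>i<n. elem_tensor ?C H (unit_vec i) (st (u i j)) \<beta>))"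
        by (simp only: coact_matrix_comodule[OF bl]) (simp add: eC)
    qed
    also have "\<dots> = (\<Sum>j<n. (\<lambda>\<beta>. cnj (m j) * (\<Sum>i<n. elem_tensor ?C H (unit_vec i) (st (u i j))) \<beta>))"
      by (simp add: fun_eq_iff sum_fun_apply)
    also have "\<dots> \<in> tens ?C H"
    proof (intro sum_in_subtensor scale_in_tens elem_tensor_in_subtensor)
      show "cvector_space ?C"
      proof (rule cspaceI)
        show "abelian_group ?C"
        proof (rule abelian_groupI)
          fix f assume "f \<in> carrier ?C"
          then show "\<exists>g\<in>carrier ?C. g \<oplus>\<^bsub>?C\<^esub> f = \<zero>\<^bsub>?C\<^esub>"
            by (intro bexI[of _ "\<lambda>i. - f i"]) (auto simp: fun_eq_iff Cs conj_comodule_def conj_space_def)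
        qed (auto simp: algebra_simps conj_comodule_def conj_space_def)
      qed (auto simp: fun_eq_iff algebra_simps Cs)
    qed (use uc in \<open>auto simp: Cs\<close>)
    finally show ?thesis .
  qed
  have key: "(\<Sum>k<n. ip (unit_vec i) (unit_vec k) \<cdot> st (u k j)) = (\<Sum>k<n. ip (unit_vec k) (unit_vec j) \<cdot> S (u k i))"
    if ij: "i < n" "j < n" for i j
  proof (rule linear_forms_separate_points)
    fix \<chi> assume \<chi>: "lin \<chi>"
    define f where "f = ?F (unit_vec j)"
    have fD: "f \<in> carrier ?D"
      using Flin uc[OF ij(2)] unfolding linear_between_def f_def Cs Ds by blast
    have fl: "linear_form ?M f" using fD by (simp add: dual_space_def)
    define Pt where "Pt t \<longleftrightarrow> t \<in> carrier (tensor_space ?D H) \<and>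
        (\<forall>m\<in>carrier ?M. \<forall>\<chi>. lin \<chi> \<longrightarrow>
           t (\<lambda>f\<^sub>0 f\<^sub>1. f\<^sub>0 m * \<chi> f\<^sub>1) = coact ?M m (\<lambda>m\<^sub>0 m\<^sub>1. f m\<^sub>0 * \<chi> (S m\<^sub>1)))" for t
    have ex: "\<exists>!t. Pt t"
      using dual_coaction_exists[OF fD] unfolding Pt_def .
    have bev: "bilinear_form ?D H (\<lambda>f\<^sub>0 f\<^sub>1. f\<^sub>0 m * \<chi> f\<^sub>1)" if "lin \<chi>" for m \<chi>
      using lin_simps[OF that] by (auto simp: bilinear_form_iff dual_space_def algebra_simps)
    have bS: "bilinear_form ?M H (\<lambda>m\<^sub>0 m\<^sub>1. f m\<^sub>0 * \<chi> (S m\<^sub>1))" if "lin \<chi>" for \<chi>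
      using fl lin_simps[OF that] by (auto simp: bilinear_form_iff linear_form_iff antipode_linear algebra_simps)
    have eqv: "tensor_lift ?D H (\<lambda>f\<^sub>0 f\<^sub>1. f\<^sub>0 m \<cdot> f\<^sub>1) t = tensor_lift ?M H (\<lambda>m\<^sub>0 m\<^sub>1. f m\<^sub>0 \<cdot> S m\<^sub>1) (coact ?M m) \<longleftrightarrow>
        (\<forall>\<chi>. lin \<chi> \<longrightarrow> t (\<lambda>f\<^sub>0 f\<^sub>1. f\<^sub>0 m * \<chi> f\<^sub>1) = coact ?M m (\<lambda>m\<^sub>0 m\<^sub>1. f m\<^sub>0 * \<chi> (S m\<^sub>1)))" (is "?l = ?r \<longleftrightarrow> _")
      if t: "t \<in> tens ?D H" for t m
    proof -
      have "\<chi> ?l = t (\<lambda>f\<^sub>0 f\<^sub>1. f\<^sub>0 m * \<chi> f\<^sub>1)" if "lin \<chi>" for \<chi>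
        using linear_form_tensor_lift[OF t _ that, of "\<lambda>f\<^sub>0 f\<^sub>1. f\<^sub>0 m \<cdot> f\<^sub>1"] bev that by (simp add: lin_simps)
      moreover have "\<chi> ?r = coact ?M m (\<lambda>m\<^sub>0 m\<^sub>1. f m\<^sub>0 * \<chi> (S m\<^sub>1))" if "lin \<chi>" for \<chi>
        using linear_form_tensor_lift[OF coact_tens _ that, where b = "\<lambda>m\<^sub>0 m\<^sub>1. f m\<^sub>0 \<cdot> S m\<^sub>1"] bS that by (simp add: lin_simps)
      ultimately show ?thesis using linear_forms_separate_points[of ?l ?r] by auto
    qed
    define t where "t = coact (dual_comodule H ?M) f"
    have "t = (THE t. Pt t)"
      unfolding t_def dual_comodule_def Pt_def using eqv
      by (simp del: matrix_comodule_simps cong: conj_cong)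
    then have Pt: "Pt t" using theI'[OF ex] by simp
    have t2: "t = tensor_map ?C H (dual_comodule H ?M) H ?F id (coact ?C (unit_vec j))"
      using F uc[OF ij(2)] unfolding comodule_map_def t_def f_def Cs by blast
    have bFC: "bilinear_form ?C H (\<lambda>x y. ?F x (unit_vec i) * \<chi> y)"
      using bilinear_form_comp(1)[OF bev[OF \<chi>, of "unit_vec i", folded bD] Flin] by simp
    have "t (\<lambda>f\<^sub>0 f\<^sub>1. f\<^sub>0 (unit_vec i) * \<chi> f\<^sub>1) = coact ?C (unit_vec j) (\<lambda>x y. ?F x (unit_vec i) * \<chi> y)"
      unfolding t2 tensor_map_apply[OF ctens Flin linear_between_id] bD using bev[OF \<chi>] by simp
    also have "\<dots> = (\<Sum>k<n. ip (unit_vec i) (unit_vec k) * \<chi> (st (u k j)))"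
      unfolding cj[OF bFC] using uc[OF ij(1)] ij
      by (simp add: unit_vec_def[of j] if_distrib[of "\<lambda>c. c * _"] cong: if_cong)
    finally have 1: "t (\<lambda>f\<^sub>0 f\<^sub>1. f\<^sub>0 (unit_vec i) * \<chi> f\<^sub>1) = (\<Sum>k<n. ip (unit_vec i) (unit_vec k) * \<chi> (st (u k j)))" .
    have "t (\<lambda>f\<^sub>0 f\<^sub>1. f\<^sub>0 (unit_vec i) * \<chi> f\<^sub>1) = coact ?M (unit_vec i) (\<lambda>m\<^sub>0 m\<^sub>1. f m\<^sub>0 * \<chi> (S m\<^sub>1))"
      using Pt \<chi> uc[OF ij(1)] unfolding Pt_def by blast
    also have "\<dots> = (\<Sum>k<n. f (unit_vec k) * \<chi> (S (u k i)))"
      unfolding coact_matrix_comodule[OF bS[OF \<chi>]] using ij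
      by (simp add: unit_vec_def[of i] if_distrib[of "\<lambda>c. c * _"] cong: if_cong)
    also have "\<dots> = (\<Sum>k<n. ip (unit_vec k) (unit_vec j) * \<chi> (S (u k i)))"
      using uc by (intro sum.cong) (auto simp: f_def)
    finally show "\<chi> (\<Sum>k<n. ip (unit_vec i) (unit_vec k) \<cdot> st (u k j)) = \<chi> (\<Sum>k<n. ip (unit_vec k) (unit_vec j) \<cdot> S (u k i))"
      using 1 by (simp add: lin_simps[OF \<chi>])
  qed
  show thesis
  proof (rule that[of "\<lambda>i j. ip (unit_vec i) (unit_vec j)"])
    show "ip (unit_vec j) (unit_vec i) = cnj (ip (unit_vec i) (unit_vec j))" if "i < n" "j < n" for i j
      by (rule ips[OF uc[OF that(1)] uc[OF that(2)]])
    fix c :: "nat \<Rightarrow> complex" assume c: "\<exists>i<n. c i \<noteq> 0"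
    define m where "m i = (if i < n then c i else 0)" for i
    have m: "m \<in> carrier ?M" "m \<noteq> 0" using c by (auto simp: m_def fun_eq_iff)
    have "ip m m = (\<Sum>i<n. m i * ip (unit_vec i) m)"
      by (rule cvec_linear_form[OF ipl[OF m(1) m(1)] m(1)])
    also have "\<dots> = (\<Sum>i<n. m i * (\<Sum>j<n. cnj (m j) * ip (unit_vec i) (unit_vec j)))"
    proof (intro sum.cong refl arg_cong2[where f = "(*)"])
      fix i assume i: "i \<in> {..<n}"
      have "ip (unit_vec i) m = cnj (ip m (unit_vec i))" using ips[OF m(1) uc] i by simp
      also have "ip m (unit_vec i) = (\<Sum>j<n. m j * ip (unit_vec j) (unit_vec i))"
        using i by (intro cvec_linear_form[OF ipl[OF uc uc] m(1)]) auto
      also have "cnj \<dots> = (\<Sum>j<n. cnj (m j) * cnj (ip (unit_vec j) (unit_vec i)))" by simp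
      also have "\<dots> = (\<Sum>j<n. cnj (m j) * ip (unit_vec i) (unit_vec j))"
        by (intro sum.cong refl) (use i ips[OF uc uc] in \<open>metis lessThan_iff\<close>)
      finally show "ip (unit_vec i) m = \<dots>" .
    qed
    also have "\<dots> = (\<Sum>i<n. \<Sum>j<n. c i * cnj (c j) * ip (unit_vec i) (unit_vec j))"
      by (simp add: sum_distrib_left m_def mult.assoc)
    finally show "0 < Re (\<Sum>i<n. \<Sum>j<n. c i * cnj (c j) * ip (unit_vec i) (unit_vec j))"
      using ipp[OF m(1) m(1) m(2)] by simp
  qed (rule key)
qed

end

section \<open>Unitary matrices and the antipode\<close>

context hopf_star
begin

definition tau :: "'h \<Rightarrow> 'h" where "tau x = st (S x)"

lemma tau_linear: "tau (x + y) = tau x + tau y" "tau (c \<cdot> x) = cnj c \<cdot> tau x" "tau 0 = 0"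
  by (simp_all add: tau_def antipode_linear star_anti)

lemma tau_sum: "tau (sum f I) = (\<Sum>i\<in>I. tau (f i))"
  by (simp add: tau_def antipode_sum star_sum)

lemma L_form_sum:
  assumes "\<And>i. i \<in> I \<Longrightarrow> lin (\<phi> i)"
  shows "L (\<lambda>x. \<Sum>i\<in>I. c i * \<phi> i x) y = (\<Sum>i\<in>I. c i \<cdot> L (\<phi> i) y)"
proof (rule linear_forms_separate_points)
  fix \<psi> assume \<psi>: "lin \<psi>"
  have l: "lin (\<lambda>x. \<Sum>i\<in>I. c i * \<phi> i x)" using assms by (intro lin_sum) auto
  have "\<psi> (L (\<lambda>x. \<Sum>i\<in>I. c i * \<phi> i x) y) = (\<Sum>i\<in>I. c i * \<phi> i (R \<psi> y))"
    by (simp add: LR_swap[OF l \<psi>])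
  also have "\<dots> = (\<Sum>i\<in>I. c i * \<psi> (L (\<phi> i) y))"
    by (intro sum.cong refl) (simp add: LR_swap assms \<psi>)
  finally show "\<psi> (L (\<lambda>x. \<Sum>i\<in>I. c i * \<phi> i x) y) = \<psi> (\<Sum>i\<in>I. c i \<cdot> L (\<phi> i) y)"
    by (simp add: lin_simps[OF \<psi>])
qed

lemma corep_antipode:
  assumes "corep n u" "i < n" "j < n"
  shows "(\<Sum>k<n. S (u i k) * u k j) = (if i = j then 1 else 0)" "(\<Sum>k<n. u i k * S (u k j)) = (if i = j then 1 else 0)"
proof -
  have "comult H (u i j) = (\<Sum>k<n. elem_tensor H H (u i k) (u k j))" "\<epsilon> (u i j) = (if i = j then 1 else 0)"
    using assms by (auto simp: corep_def)
  from antipode_sums[OF this(1)] this(2)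
  show "(\<Sum>k<n. S (u i k) * u k j) = (if i = j then 1 else 0)" "(\<Sum>k<n. u i k * S (u k j)) = (if i = j then 1 else 0)"
    by auto
qed

lemma corep_comult: "corep n u \<Longrightarrow> bil \<beta> \<Longrightarrow> i < n \<Longrightarrow> j < n \<Longrightarrow> comult H (u i j) \<beta> = (\<Sum>k<n. \<beta> (u i k) (u k j))"
  by (rule comult_apply_elem_sum) (auto simp: corep_def)

lemma sum_delta2:
  fixes f :: "nat \<Rightarrow> nat \<Rightarrow> 'h"
  assumes "i < n" "k < m"
  shows "(\<Sum>a<n. \<Sum>b<m. if i = a \<and> k = b then f a b else 0) = f i k"
proof -
  have "(\<Sum>a<n. \<Sum>b<m. if i = a \<and> k = b then f a b else 0) = (\<Sum>a<n. if i = a then (\<Sum>b<m. if k = b then f a b else 0) else 0)"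
    by (intro sum.cong refl) simp
  then show ?thesis using assms by simp
qed

text \<open>
  Both sides are entries of an inverse of the matrix with entries \<open>u\<^sub>i\<^sub>j v\<^sub>k\<^sub>l\<close>: the left one of
  a left inverse, by the antipode law for a product, and the right one of a right inverse.
\<close>

lemma antipode_mult_corep:
  assumes u: "corep n u" and v: "corep m v" and ij: "i < n" "j < n" "k < m" "l < m"
  shows "S (u i j * v k l) = S (v k l) * S (u i j)"
proof -
  have inv: "(\<Sum>p<n. \<Sum>q<m. S (u i p * v k q) * (u p a * v q b)) = (if i = a \<and> k = b then 1 else 0)"
    if ab: "a < n" "b < m" for a b
  proof -
    have "comult H (u i a * v k b) = (\<Sum>(p,q)\<in>{..<n}\<times>{..<m}. elem_tensor H H (u i p * v k q) (u p a * v q b))"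
      unfolding split_beta
    proof (rule comult_eqI)
      fix \<beta> assume b: "bil \<beta>"
      have b1: "bil (\<lambda>c d. \<beta> (x * c) (y * d))" for x y using b by (auto simp: bil_iff)
      have "\<beta> (x + x') y = \<beta> x y + \<beta> x' y" "\<beta> y (x + x') = \<beta> y x + \<beta> y x'"
        "\<beta> (c \<cdot> x) y = c * \<beta> x y" "\<beta> y (c \<cdot> x) = c * \<beta> y x" for x x' y c
        using b lin_simps(1)[of "\<beta> y"] lin_simps(1)[of "\<lambda>x. \<beta> x y"] lin_simps(2)[of "\<beta> y"] lin_simps(2)[of "\<lambda>x. \<beta> x y"]
        by (auto simp: bil_iff)
      then have b2: "bil (\<lambda>x y. \<Sum>q<m. \<beta> (x * v k q) (y * v q b))"
        by (auto simp: bil_iff intro!: lin_sum linI simp: distrib_right)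
      have "comult H (u i a * v k b) \<beta> = comult H (u i a) (\<lambda>x y. \<Sum>q<m. \<beta> (x * v k q) (y * v q b))"
        unfolding comult_mult[OF b] using corep_comult[OF v b1 ij(3) ab(2)] by simp
      also have "\<dots> = (\<Sum>p<n. \<Sum>q<m. \<beta> (u i p * v k q) (u p a * v q b))"
        by (rule corep_comult[OF u b2 ij(1) ab(1)])
      finally show "comult H (u i a * v k b) \<beta> =
         (\<Sum>p\<in>{..<n}\<times>{..<m}. \<beta> (u i (fst p) * v k (snd p)) (u (fst p) a * v (snd p) b))"
        by (simp add: sum.cartesian_product split_beta)
    qed
    from antipode_sums(1)[OF this[unfolded split_beta]] have
      "(\<Sum>p<n. \<Sum>q<m. S (u i p * v k q) * (u p a * v q b)) = \<epsilon> (u i a * v k b) \<cdot> 1"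
      by (simp add: sum.cartesian_product split_beta)
    moreover have "\<epsilon> (u i a * v k b) = (if i = a \<and> k = b then 1 else 0)"
      using u v ij ab by (simp add: corep_def counit_mult)
    ultimately show ?thesis by simp
  qed
  have "S (v k l) * S (u i j) = (\<Sum>a<n. \<Sum>b<m. (if i = a \<and> k = b then 1 else 0) * (S (v b l) * S (u a j)))"
  proof -
    have "(if P then 1 else 0) * x = (if P then x else 0)" for P and x :: 'h by simp
    then show ?thesis using sum_delta2[OF ij(1,3), of "\<lambda>a b. S (v b l) * S (u a j)"] by simp
  qed
  also have "\<dots> = (\<Sum>a<n. \<Sum>b<m. (\<Sum>p<n. \<Sum>q<m. S (u i p * v k q) * (u p a * v q b)) * (S (v b l) * S (u a j)))"
    by (intro sum.cong refl) (simp add: inv)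
  also have "\<dots> = (\<Sum>a<n. \<Sum>b<m. \<Sum>p<n. \<Sum>q<m. S (u i p * v k q) * (u p a * v q b * S (v b l) * S (u a j)))"
    by (simp add: sum_distrib_right mult.assoc)
  also have "\<dots> = (\<Sum>a<n. \<Sum>p<n. \<Sum>b<m. \<Sum>q<m. S (u i p * v k q) * (u p a * v q b * S (v b l) * S (u a j)))"
    by (intro sum.cong refl sum.swap)
  also have "\<dots> = (\<Sum>p<n. \<Sum>a<n. \<Sum>b<m. \<Sum>q<m. S (u i p * v k q) * (u p a * v q b * S (v b l) * S (u a j)))"
    by (rule sum.swap)
  also have "\<dots> = (\<Sum>p<n. \<Sum>a<n. \<Sum>q<m. \<Sum>b<m. S (u i p * v k q) * (u p a * v q b * S (v b l) * S (u a j)))"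
    by (intro sum.cong refl sum.swap)
  also have "\<dots> = (\<Sum>p<n. \<Sum>q<m. \<Sum>a<n. \<Sum>b<m. S (u i p * v k q) * (u p a * v q b * S (v b l) * S (u a j)))"
    by (intro sum.cong refl sum.swap)
  also have "\<dots> = (\<Sum>p<n. \<Sum>q<m. if p = j \<and> q = l then S (u i p * v k q) else 0)"
  proof (intro sum.cong refl)
    fix p q assume pq: "p \<in> {..<n}" "q \<in> {..<m}"
    have "(\<Sum>a<n. \<Sum>b<m. S (u i p * v k q) * (u p a * v q b * S (v b l) * S (u a j))) =
        S (u i p * v k q) * (\<Sum>a<n. u p a * (\<Sum>b<m. v q b * S (v b l)) * S (u a j))"
      by (simp add: sum_distrib_left sum_distrib_right mult.assoc)
    also have "\<dots> = S (u i p * v k q) * (if q = l then (\<Sum>a<n. u p a * S (u a j)) else 0)"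
      using corep_antipode(2)[OF v, of q l] pq ij by simp
    also have "\<dots> = (if p = j \<and> q = l then S (u i p * v k q) else 0)"
    proof -
      have "p < n" using pq by simp
      show ?thesis unfolding corep_antipode(2)[OF u \<open>p < n\<close> ij(2)] by simp
    qed
    finally show "(\<Sum>a<n. \<Sum>b<m. S (u i p * v k q) * (u p a * v q b * S (v b l) * S (u a j))) =
        (if p = j \<and> q = l then S (u i p * v k q) else 0)" .
  qed
  also have "\<dots> = (\<Sum>p<n. if p = j then \<Sum>q<m. if q = l then S (u i p * v k q) else 0 else 0)"
    by (intro sum.cong refl) auto
  also have "\<dots> = S (u i j * v k l)" using ij by simp
  finally show ?thesis by simp
qed

lemma corep_star: "corep n u \<Longrightarrow> corep n (\<lambda>i j. st (u i j))"
  unfolding corep_def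
proof (intro allI impI conjI comult_eqI)
  fix i j \<beta> assume u: "\<forall>i<n. \<forall>j<n. comult H (u i j) = (\<Sum>k<n. elem_tensor H H (u i k) (u k j)) \<and> \<epsilon> (u i j) = (if i = j then 1 else 0)"
    and ij: "i < n" "j < n"
  then show "\<epsilon> (st (u i j)) = (if i = j then 1 else 0)" by (simp add: star_anti)
  assume b: "bil \<beta>"
  then have "bil (\<lambda>a b. cnj (\<beta> (st a) (st b)))" by (auto simp: bil_iff)
  then show "comult H (st (u i j)) \<beta> = (\<Sum>k<n. \<beta> (st (u i k)) (st (u k j)))"
    using corep_comult[OF u[folded corep_def] _ ij] by (simp add: comult_star[OF b])
qed

lemma L_mult_corep:
  assumes u: "corep n u" "i < n" "j < n" and \<phi>: "lin \<phi>"
  shows "L \<phi> (x * u i j) = (\<Sum>k<n. L (\<lambda>a. \<phi> (a * u i k)) x * u k j)"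
    and "R \<phi> (x * u i j) = (\<Sum>k<n. R (\<lambda>b. \<phi> (b * u k j)) x * u i k)"
proof -
  have b: "bil (\<lambda>c d. \<phi> (a * c) * \<psi> (b * d))" if "lin \<phi>" "lin \<psi>" for a b \<phi> \<psi>
    using that by (intro bil_product) auto
  have main: "comult H (x * u i j) (\<lambda>a b. \<phi> a * \<psi> b) = (\<Sum>k<n. comult H x (\<lambda>a b. \<phi> (a * u i k) * \<psi> (b * u k j)))"
    if "lin \<phi>" "lin \<psi>" for \<phi> \<psi>
  proof -
    have "comult H (x * u i j) (\<lambda>a b. \<phi> a * \<psi> b) = comult H x (\<lambda>a b. \<Sum>k<n. \<phi> (a * u i k) * \<psi> (b * u k j))"
      unfolding comult_mult[OF bil_product[OF that]] using corep_comult[OF u(1) b[OF that] u(2,3)] by simp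
    also have "\<dots> = (\<Sum>k<n. comult H x (\<lambda>a b. \<phi> (a * u i k) * \<psi> (b * u k j)))"
      using that by (intro comult_apply_sum bil_product) auto
    finally show ?thesis .
  qed
  show "L \<phi> (x * u i j) = (\<Sum>k<n. L (\<lambda>a. \<phi> (a * u i k)) x * u k j)"
  proof (rule linear_forms_separate_points)
    fix \<psi> assume \<psi>: "lin \<psi>"
    have "\<psi> (L (\<lambda>a. \<phi> (a * u i k)) x * u k j) = comult H x (\<lambda>a b. \<phi> (a * u i k) * \<psi> (b * u k j))" for k
      using L_apply[of "\<lambda>a. \<phi> (a * u i k)" "\<lambda>b. \<psi> (b * u k j)" x] \<phi> \<psi> by auto
    then show "\<psi> (L \<phi> (x * u i j)) = \<psi> (\<Sum>k<n. L (\<lambda>a. \<phi> (a * u i k)) x * u k j)"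
      by (simp add: lin_simps[OF \<psi>] L_apply[OF \<phi> \<psi>] main[OF \<phi> \<psi>])
  qed
  show "R \<phi> (x * u i j) = (\<Sum>k<n. R (\<lambda>b. \<phi> (b * u k j)) x * u i k)"
  proof (rule linear_forms_separate_points)
    fix \<psi> assume \<psi>: "lin \<psi>"
    have "\<psi> (R (\<lambda>b. \<phi> (b * u k j)) x * u i k) = comult H x (\<lambda>a b. \<psi> (a * u i k) * \<phi> (b * u k j))" for k
      using R_apply[of "\<lambda>b. \<phi> (b * u k j)" "\<lambda>b. \<psi> (b * u i k)" x] \<phi> \<psi> by auto
    then show "\<psi> (R \<phi> (x * u i j)) = \<psi> (\<Sum>k<n. R (\<lambda>b. \<phi> (b * u k j)) x * u i k)"
      by (simp add: lin_simps[OF \<psi>] R_apply[OF \<phi> \<psi>] main[OF \<psi> \<phi>])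
  qed
qed

text \<open>
  The condition means \<open>S(u\<^sub>i\<^sub>j) = u\<^sub>j\<^sub>i\<^sup>*\<close>. As the antipode inverts the matrix \<open>u\<close>, it makes \<open>u\<close> a
  unitary matrix over \<open>H\<close>.
\<close>

definition unitary :: "nat \<Rightarrow> (nat \<Rightarrow> nat \<Rightarrow> 'h) \<Rightarrow> bool" where
  "unitary n u \<longleftrightarrow> corep n u \<and> (\<forall>i<n. \<forall>j<n. tau (u i j) = u j i)"

lemma unitary_relations:
  assumes "unitary n u" "i < n" "j < n"
  shows "(\<Sum>k<n. u i k * st (u j k)) = (if i = j then 1 else 0)"
    "(\<Sum>k<n. st (u k i) * u k j) = (if i = j then 1 else 0)"
proof -
  have S: "S (u k l) = st (u l k)" if "k < n" "l < n" for k l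
  proof -
    have "S (u k l) = st (tau (u k l))" by (simp add: tau_def star_anti)
    then show ?thesis using assms that by (simp add: unitary_def)
  qed
  have c: "corep n u" using assms by (simp add: unitary_def)
  show "(\<Sum>k<n. u i k * st (u j k)) = (if i = j then 1 else 0)"
    "(\<Sum>k<n. st (u k i) * u k j) = (if i = j then 1 else 0)"
    using corep_antipode[OF c assms(2,3)] assms(2,3) by (simp_all add: S cong: sum.cong_simp)
qed

text \<open>
  The last clause is the colinearity of the map \<open>x \<mapsto> (\<cdot>,x)\<close> from the conjugate of the right
  coideal \<open>V\<close> to its dual, after an application of the involution.
\<close>

definition compatible :: "('h \<Rightarrow> 'h \<Rightarrow> complex) \<Rightarrow> 'h set \<Rightarrow> bool" where
  "compatible s V \<longleftrightarrow> hermitian s \<and> positive_on s V \<and>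
     (\<forall>x\<in>V. \<forall>y\<in>V. L (\<lambda>a. s a x) y = tau (L (\<lambda>a. s a y) x))"

lemma unitary_of_orthonormal_basis:
  assumes V: "right_coideal V" and s: "compatible s V"
    and e: "orthonormal s n e" "\<And>i. i < n \<Longrightarrow> e i \<in> V" "\<And>v. v \<in> V \<Longrightarrow> v = (\<Sum>i<n. s v (e i) \<cdot> e i)"
  defines "u \<equiv> \<lambda>i j. L (\<lambda>a. s a (e i)) (e j)"
  shows "unitary n u" "\<And>j. j < n \<Longrightarrow> e j = (\<Sum>i<n. \<epsilon> (e i) \<cdot> u i j)"
proof -
  have h: "hermitian s" using s by (simp add: compatible_def)
  note l = hermitian_lin[OF h]
  have "corep n u"
    unfolding u_def using e
    by (intro corep_of_right_coideal[OF V l]) (auto simp: orthonormal_def)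
  moreover have "tau (u i j) = u j i" if "i < n" "j < n" for i j
    using s e(2)[OF that(1)] e(2)[OF that(2)] unfolding u_def compatible_def by metis
  ultimately show "unitary n u" by (simp add: unitary_def)
  fix j assume j: "j < n"
  show "e j = (\<Sum>i<n. \<epsilon> (e i) \<cdot> u i j)"
  proof (rule linear_forms_separate_points)
    fix \<psi> assume \<psi>: "lin \<psi>"
    have "\<psi> (e j) = comult H (e j) (\<lambda>a b. \<epsilon> a * \<psi> b)" by (simp add: comult_counit \<psi>)
    also have "\<dots> = (\<Sum>i<n. \<epsilon> (e i) * \<psi> (u i j))"
      unfolding u_def
      by (rule comult_apply_elem_sum[OF bil_product[OF counit_lin \<psi>]
        right_coideal_expansion[OF V e(2)[OF j] l e(3)]])
    finally show "\<psi> (e j) = \<psi> (\<Sum>i<n. \<epsilon> (e i) \<cdot> u i j)" by (simp add: lin_simps[OF \<psi>])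
  qed
qed

end

locale cqg = hopf_star H for H :: "'h::ring_1 hopf_star_algebra" +
  assumes cqg: "cqg_algebra H"
begin

text \<open>
  Transport a compatible Gram matrix \<open>Q\<close> for the matrix of \<open>V\<close> to \<open>V\<close> along a dual basis. The
  intertwining relation for \<open>Q\<close>, after an application of the involution, is the required
  identity on basis vectors.
\<close>

lemma compatible_form:
  assumes V: "right_coideal V" "findim V"
  obtains s where "compatible s V"
proof -
  obtain n :: nat and e \<phi> where eV: "\<And>i. i < n \<Longrightarrow> e i \<in> V" and \<phi>: "\<And>i. lin (\<phi> i)"
    and dual: "\<And>i j. i < n \<Longrightarrow> j < n \<Longrightarrow> \<phi> i (e j) = (if i = j then 1 else 0)"
    and e: "\<And>v. v \<in> V \<Longrightarrow> v = (\<Sum>i<n. \<phi> i v \<cdot> e i)"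
    by (rule dual_basis[OF V(2)], rule that)
  define u where "u i j = L (\<phi> i) (e j)" for i j
  have u: "corep n u"
    unfolding u_def using V(1) \<phi> eV dual e by (rule corep_of_right_coideal)
  obtain Q where Q: "\<And>i j. i < n \<Longrightarrow> j < n \<Longrightarrow> Q j i = cnj (Q i j)"
    "\<And>c. (\<exists>i<n. c i \<noteq> 0) \<Longrightarrow> 0 < Re (\<Sum>i<n. \<Sum>j<n. c i * cnj (c j) * Q i j)"
    "\<And>i j. i < n \<Longrightarrow> j < n \<Longrightarrow> (\<Sum>k<n. Q i k \<cdot> st (u k j)) = (\<Sum>k<n. Q k j \<cdot> S (u k i))"
    by (rule compatible_matrix[OF cqg u], rule that)
  define s where "s x y = (\<Sum>i<n. \<Sum>j<n. \<phi> i x * cnj (\<phi> j y) * Q i j)" for x y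
  have s_sum: "s x y = (\<Sum>i<n. (\<Sum>j<n. cnj (\<phi> j y) * Q i j) * \<phi> i x)" for x y
    by (simp add: s_def sum_distrib_right sum_distrib_left mult_ac)
  have herm: "hermitian s"
    unfolding hermitian_def
  proof (intro conjI allI)
    show "lin (\<lambda>x. s x y)" for y unfolding s_sum by (intro lin_sum lin_comp(5) \<phi>)
    show "s y x = cnj (s x y)" for x y
    proof -
      have "cnj (s x y) = (\<Sum>i<n. \<Sum>j<n. cnj (\<phi> i x) * \<phi> j y * Q j i)"
        unfolding s_def cnj_sum complex_cnj_mult complex_cnj_cnj
        by (intro sum.cong refl arg_cong2[where f = "(*)"]) (rule Q(1)[symmetric]; simp)
      also have "\<dots> = (\<Sum>j<n. \<Sum>i<n. cnj (\<phi> i x) * \<phi> j y * Q j i)" by (rule sum.swap)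
      finally show ?thesis by (simp add: s_def mult_ac)
    qed
  qed
  have pos: "positive_on s V"
    unfolding positive_on_def
  proof (intro ballI impI)
    fix x assume x: "x \<in> V" "x \<noteq> 0"
    have "\<exists>i<n. \<phi> i x \<noteq> 0"
    proof (rule ccontr)
      assume "\<not> ?thesis"
      then have "(\<Sum>i<n. \<phi> i x \<cdot> e i) = 0" by (intro sum.neutral) auto
      then show False using e[OF x(1)] x(2) by simp
    qed
    then show "0 < Re (s x x)" unfolding s_def by (rule Q(2))
  qed
  have key: "(\<Sum>i<n. Q i j \<cdot> u i b) = (\<Sum>k<n. Q b k \<cdot> tau (u k j))" if "j < n" "b < n" for j b
  proof -
    have "st (\<Sum>k<n. Q j k \<cdot> st (u k b)) = st (\<Sum>k<n. Q k b \<cdot> S (u k j))" using Q(3)[OF that] by simp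
    then have "(\<Sum>k<n. cnj (Q j k) \<cdot> u k b) = (\<Sum>k<n. cnj (Q k b) \<cdot> tau (u k j))"
      by (simp add: star_sum star_anti tau_def)
    moreover have "(\<Sum>k<n. cnj (Q j k) \<cdot> u k b) = (\<Sum>i<n. Q i j \<cdot> u i b)"
      by (intro sum.cong refl arg_cong2[where f = sc]) (rule Q(1)[OF that(1), symmetric]; simp)
    moreover have "(\<Sum>k<n. cnj (Q k b) \<cdot> tau (u k j)) = (\<Sum>k<n. Q b k \<cdot> tau (u k j))"
      by (intro sum.cong refl arg_cong2[where f = sc]) (rule Q(1)[OF _ that(2), symmetric]; simp)
    ultimately show ?thesis by simp
  qed
  have Ls: "L (\<lambda>a. s a x) y = (\<Sum>i<n. \<Sum>j<n. \<Sum>b<n. (cnj (\<phi> j x) * \<phi> b y * Q i j) \<cdot> u i b)" if "y \<in> V" for x y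
  proof -
    have "L (\<lambda>a. s a x) y = (\<Sum>i<n. (\<Sum>j<n. cnj (\<phi> j x) * Q i j) \<cdot> L (\<phi> i) y)"
      unfolding s_sum by (rule L_form_sum) (rule \<phi>)
    also have "\<dots> = (\<Sum>i<n. (\<Sum>j<n. cnj (\<phi> j x) * Q i j) \<cdot> (\<Sum>b<n. \<phi> b y \<cdot> u i b))"
      by (subst (1) e[OF that]) (simp add: L_sum \<phi> L_linear u_def)
    also have "\<dots> = (\<Sum>i<n. \<Sum>j<n. (cnj (\<phi> j x) * Q i j) \<cdot> (\<Sum>b<n. \<phi> b y \<cdot> u i b))"
      by (simp only: scale_sum_left)
    also have "\<dots> = (\<Sum>i<n. \<Sum>j<n. \<Sum>b<n. (cnj (\<phi> j x) * \<phi> b y * Q i j) \<cdot> u i b)"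
      by (simp add: scale_sum_right mult_ac)
    finally show ?thesis .
  qed
  have "L (\<lambda>a. s a x) y = tau (L (\<lambda>a. s a y) x)" if xy: "x \<in> V" "y \<in> V" for x y
  proof -
    have "L (\<lambda>a. s a x) y = (\<Sum>j<n. \<Sum>i<n. \<Sum>b<n. (cnj (\<phi> j x) * \<phi> b y * Q i j) \<cdot> u i b)"
      unfolding Ls[OF xy(2)] by (rule sum.swap)
    also have "\<dots> = (\<Sum>j<n. \<Sum>b<n. \<Sum>i<n. (cnj (\<phi> j x) * \<phi> b y * Q i j) \<cdot> u i b)"
      by (intro sum.cong refl sum.swap)
    also have "\<dots> = (\<Sum>j<n. \<Sum>b<n. (cnj (\<phi> j x) * \<phi> b y) \<cdot> (\<Sum>i<n. Q i j \<cdot> u i b))"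
      by (simp add: scale_sum_right)
    also have "\<dots> = (\<Sum>j<n. \<Sum>b<n. (cnj (\<phi> j x) * \<phi> b y) \<cdot> (\<Sum>k<n. Q b k \<cdot> tau (u k j)))"
      by (intro sum.cong refl) (simp add: key)
    finally have 1: "L (\<lambda>a. s a x) y = (\<Sum>j<n. \<Sum>b<n. \<Sum>k<n. (cnj (\<phi> j x) * \<phi> b y * Q b k) \<cdot> tau (u k j))"
      by (simp add: scale_sum_right)
    have "tau (L (\<lambda>a. s a y) x) = (\<Sum>k<n. \<Sum>b<n. \<Sum>j<n. (\<phi> b y * cnj (\<phi> j x) * Q b k) \<cdot> tau (u k j))"
      unfolding Ls[OF xy(1)] tau_sum tau_linear
      unfolding complex_cnj_mult complex_cnj_cnj
      by (intro sum.cong refl arg_cong2[where f = sc] arg_cong2[where f = "(*)"] mult.commute)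
        (simp_all add: mult.commute Q(1)[symmetric])
    also have "\<dots> = (\<Sum>k<n. \<Sum>j<n. \<Sum>b<n. (\<phi> b y * cnj (\<phi> j x) * Q b k) \<cdot> tau (u k j))"
      by (intro sum.cong refl sum.swap)
    also have "\<dots> = (\<Sum>j<n. \<Sum>k<n. \<Sum>b<n. (\<phi> b y * cnj (\<phi> j x) * Q b k) \<cdot> tau (u k j))"
      by (rule sum.swap)
    also have "\<dots> = (\<Sum>j<n. \<Sum>b<n. \<Sum>k<n. (\<phi> b y * cnj (\<phi> j x) * Q b k) \<cdot> tau (u k j))"
      by (intro sum.cong refl sum.swap)
    finally show ?thesis unfolding 1 by (simp add: mult.commute)
  qed
  then have "compatible s V" unfolding compatible_def using herm pos by blast
  then show thesis by (rule that)
qed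

lemma unitary_basis:
  assumes V: "right_coideal V" "findim V"
  obtains n e u where "unitary n u" "\<And>i. i < n \<Longrightarrow> e i \<in> V" "\<And>j. j < n \<Longrightarrow> e j \<noteq> 0"
    "\<And>j. j < n \<Longrightarrow> e j = (\<Sum>i<n. \<epsilon> (e i) \<cdot> u i j)" "V = span (e ` {..<n})"
    "\<And>i j. i < n \<Longrightarrow> j < n \<Longrightarrow> \<exists>\<phi>. lin \<phi> \<and> u i j = L \<phi> (e j)"
proof -
  obtain s where s: "compatible s V" by (rule compatible_form[OF V])
  have h: "hermitian s" "positive_on s V" using s by (simp_all add: compatible_def)
  obtain n e where e: "orthonormal s n e" "\<And>i. i < n \<Longrightarrow> e i \<in> V" "\<And>v. v \<in> V \<Longrightarrow> v = (\<Sum>i<n. s v (e i) \<cdot> e i)"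
    by (rule orthonormal_basis[OF V(2) h], rule that)
  have "e j \<noteq> 0" if "j < n" for j
    using e(1) that hermitian_simps(3)[OF h(1)] by (metis orthonormal_def zero_neq_one)
  moreover have "V = span (e ` {..<n})"
  proof (rule span_unique[symmetric])
    show "e ` {..<n} \<subseteq> V" "subspace V" using e(2) V(1) by (auto dest: right_coidealD)
    fix T assume T: "e ` {..<n} \<subseteq> T" "subspace T"
    show "V \<subseteq> T"
    proof
      fix v assume "v \<in> V"
      have "(\<Sum>i<n. s v (e i) \<cdot> e i) \<in> T" using T by (intro subspace_sum subspace_scale) auto
      then show "v \<in> T" using e(3)[OF \<open>v \<in> V\<close>] by simp
    qed
  qed
  moreover have "\<exists>\<phi>. lin \<phi> \<and> L (\<lambda>a. s a (e i)) (e j) = L \<phi> (e j)" for i j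
    using hermitian_lin[OF h(1), of "e i"] by blast
  ultimately show thesis
    using unitary_of_orthonormal_basis[OF V(1) s e] e(2)
    by (intro that[of n "\<lambda>i j. L (\<lambda>a. s a (e i)) (e j)" e])
qed

lemma unitary_1: "unitary 1 (\<lambda>i j. 1)"
proof -
  have "comult H 1 = (\<Sum>k<(1::nat). elem_tensor H H 1 1)" by (rule comult_eqI) (simp add: comult_1)
  moreover from antipode_sums(1)[OF this] have "tau 1 = 1" by (simp add: tau_def counit_mult)
  ultimately show ?thesis by (simp add: unitary_def corep_def counit_mult)
qed

lemma tau_1: "tau 1 = 1"
  using unitary_1 by (simp add: unitary_def)

text \<open>
  Every element lies in a finite-dimensional subcoalgebra, and \<open>e\<^sub>j = \<Sum>\<^sub>i \<epsilon>(e\<^sub>i) u\<^sub>i\<^sub>j\<close> there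
  for an orthonormal basis. So identities that are additive and homogeneous may be checked on
  coefficients of unitary matrices, where \<open>\<tau>\<close> is transposition.
\<close>

lemma unitary_induct [case_names coeff add scale]:
  assumes coeff: "\<And>n u i j. unitary n u \<Longrightarrow> i < n \<Longrightarrow> j < n \<Longrightarrow> P (u i j)"
    and add: "\<And>x y. P x \<Longrightarrow> P y \<Longrightarrow> P (x + y)" and scale: "\<And>c x. P x \<Longrightarrow> P (c \<cdot> x)"
  shows "P x"
proof -
  obtain V where V: "findim V" "subcoalgebra V" "x \<in> V" by (rule finite_subcoalgebra)
  then have rc: "right_coideal V" by (simp add: subcoalgebra_def)
  obtain n e u where u: "unitary n u" and e: "\<And>j. j < n \<Longrightarrow> e j = (\<Sum>i<n. \<epsilon> (e i) \<cdot> u i j)" and sp: "V = span (e ` {..<n})"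
    by (rule unitary_basis[OF rc V(1)], rule that)
  have P0: "P 0"
    using scale[OF coeff[OF unitary_1, of 0 0], of 0] by simp
  then have sub: "subspace {x. P x}"
    by (intro subspaceI) (auto intro: add scale)
  have "e ` {..<n} \<subseteq> {x. P x}"
  proof (intro image_subsetI)
    fix j assume j: "j \<in> {..<n}"
    have "(\<Sum>i<n. \<epsilon> (e i) \<cdot> u i j) \<in> {x. P x}"
      using coeff[OF u] j by (intro subspace_sum[OF sub] subspace_scale[OF sub]) auto
    then show "e j \<in> {x. P x}" using e[of j] j by simp
  qed
  then have "V \<subseteq> {x. P x}" unfolding sp using sub by (rule span_minimal)
  then show ?thesis using V(3) by auto
qed

lemma tau_tau: "tau (tau x) = x"
  by (induction x rule: unitary_induct) (auto simp: tau_linear unitary_def)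

lemma antipode_mult: "S (x * y) = S y * S x"
proof (induction x rule: unitary_induct)
  case (coeff n u i j)
  note u = coeff
  show ?case
  proof (induction y rule: unitary_induct)
    case (coeff m v k l)
    show ?case by (rule antipode_mult_corep) (use u coeff in \<open>auto simp: unitary_def\<close>)
  qed (auto simp: antipode_linear distrib_left distrib_right)
qed (auto simp: antipode_linear distrib_left distrib_right)

lemma tau_mult: "tau (x * y) = tau x * tau y"
  by (simp add: tau_def star_anti antipode_mult)

lemma comult_tau:
  assumes b: "bil \<beta>"
  shows "comult H (tau x) \<beta> = cnj (comult H x (\<lambda>a b. cnj (\<beta> (tau b) (tau a))))"
proof (induction x rule: unitary_induct)
  case (coeff n u i j)
  have b': "bil (\<lambda>a b. cnj (\<beta> (tau b) (tau a)))"
    using b by (auto simp: bil_iff lin_def tau_linear)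
  have cu: "corep n u" and tu: "\<And>i j. i < n \<Longrightarrow> j < n \<Longrightarrow> tau (u i j) = u j i" using coeff by (auto simp: unitary_def)
  show ?case
    unfolding tu[OF coeff(2,3)] corep_comult[OF cu b coeff(3,2)] corep_comult[OF cu b' coeff(2,3)] cnj_sum complex_cnj_cnj
    using coeff by (intro sum.cong refl) (simp add: tu)
qed (simp_all add: tau_linear lin_simps(1,2)[OF comult_lin])


section \<open>The Haar functional\<close>

lemma right_coideal_one: "right_coideal (span {1})" "findim (span {1})"
  by (auto intro!: right_coideal_span findim_span span_scale simp: LR_one intro: span_base)

text \<open>
  Right invariance of \<open>f\<close> means that \<open>f\<close> kills \<open>J = {R \<psi> x - \<psi>(1) x}\<close>, so it suffices that \<open>1\<close> is not
  in the span of \<open>J\<close>. Otherwise finitely many \<open>x\<close> would be involved, all of them in one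
  finite-dimensional right coideal that contains \<open>1\<close>. But there the form \<open>(\<cdot>,1)\<close> of a compatible
  inner product is right invariant, by compatibility with \<open>1\<close>, and it is positive at \<open>1\<close>.
\<close>

lemma right_invariant_exists:
  obtains f where "lin f" "f 1 = 1" "\<And>x. L f x = f x \<cdot> 1"
proof -
  define P where "P z \<longleftrightarrow> (\<exists>V. findim V \<and> right_coideal V \<and>
    (\<forall>f. lin f \<longrightarrow> (\<forall>y\<in>V. L f y = f y \<cdot> 1) \<longrightarrow> f z = 0))" for z
  have Padd: "P (x + y)" if P: "P x" "P y" for x y
  proof -
    obtain V W where V: "findim V" "right_coideal V" "\<And>f. lin f \<Longrightarrow> (\<forall>y\<in>V. L f y = f y \<cdot> 1) \<Longrightarrow> f x = 0"
      and W: "findim W" "right_coideal W" "\<And>f. lin f \<Longrightarrow> (\<forall>y\<in>W. L f y = f y \<cdot> 1) \<Longrightarrow> f y = 0"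
      using P unfolding P_def by blast
    have sub: "V \<subseteq> span (V \<union> W)" "W \<subseteq> span (V \<union> W)" using span_superset by blast+
    have "f (x + y) = 0" if f: "lin f" "\<forall>y\<in>span (V \<union> W). L f y = f y \<cdot> 1" for f
    proof -
      have "f x = 0" "f y = 0" using V(3) W(3) f sub by blast+
      then show ?thesis by (simp add: lin_simps[OF f(1)])
    qed
    then show ?thesis
      unfolding P_def using findim_span_Un[OF V(1) W(1)] right_coideal_Un[OF V(2) W(2)] by blast
  qed
  have Pscale: "P (c \<cdot> x)" if "P x" for c x
    using that unfolding P_def by (metis lin_simps(2) mult_zero_right)
  have P0: "P 0"
    unfolding P_def using right_coideal_one by (auto simp: lin_simps)
  define J where "J = {R \<psi> x - \<psi> 1 \<cdot> x | \<psi> x. lin \<psi>}"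
  have "J \<subseteq> {z. P z}"
  proof
    fix z assume "z \<in> J"
    then obtain \<psi> x where z: "z = R \<psi> x - \<psi> 1 \<cdot> x" "lin \<psi>" by (auto simp: J_def)
    obtain V where V: "findim V" "subcoalgebra V" "x \<in> V" by (rule finite_subcoalgebra)
    have "f z = 0" if f: "lin f" "\<forall>y\<in>V. L f y = f y \<cdot> 1" for f
    proof -
      have "f (R \<psi> x) = \<psi> (L f x)" by (rule LR_swap[symmetric]) fact+
      then show ?thesis using f V(3) by (simp add: z lin_simps lin_simps[OF z(2)])
    qed
    then show "z \<in> {z. P z}" unfolding P_def using V by (auto simp: subcoalgebra_def)
  qed
  then have sub: "span J \<subseteq> {z. P z}"
    by (rule span_minimal) (auto intro!: subspaceI Padd Pscale P0)
  have "1 \<notin> span J"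
  proof
    assume "1 \<in> span J"
    then obtain V where V: "findim V" "right_coideal V" "\<And>f. lin f \<Longrightarrow> (\<forall>y\<in>V. L f y = f y \<cdot> 1) \<Longrightarrow> f 1 = 0"
      using sub unfolding P_def by blast
    define W where "W = span (V \<union> span {1})"
    have W: "findim W" "right_coideal W" unfolding W_def
      by (intro findim_span_Un right_coideal_Un V right_coideal_one)+
    have VW: "V \<subseteq> W" "1 \<in> W" using span_superset[of "V \<union> span {1}"] span_base[of 1 "{1}"] by (auto simp: W_def)
    obtain s where s: "compatible s W" by (rule compatible_form[OF W(2,1)])
    then have h: "hermitian s" "positive_on s W" by (simp_all add: compatible_def)
    have "L (\<lambda>a. s a 1) y = s y 1 \<cdot> 1" if "y \<in> W" for y
    proof -
      have "L (\<lambda>a. s a 1) y = tau (L (\<lambda>a. s a y) 1)"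
        using s VW(2) that unfolding compatible_def by blast
      also have "\<dots> = cnj (s 1 y) \<cdot> 1" by (simp add: LR_one hermitian_lin[OF h(1)] tau_linear tau_1)
      finally show ?thesis using hermitian_sym[OF h(1), of y 1] by simp
    qed
    then have "s 1 1 = 0" using V(3)[OF hermitian_lin[OF h(1)], of 1] VW(1) by blast
    moreover have "(1::'h) \<noteq> 0" using counit_mult(1) lin_simps(3)[OF counit_lin] by auto
    ultimately show False using h(2) VW(2) by (force simp: positive_on_def)
  qed
  then obtain f where f: "lin f" "\<And>k. k \<in> span J \<Longrightarrow> f k = 0" "f 1 = 1"
    using linear_form_separates[of "span J" 1] by auto
  have "L f x = f x \<cdot> 1" for x
  proof (rule linear_forms_separate_points)
    fix \<psi> assume \<psi>: "lin \<psi>"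
    have "R \<psi> x - \<psi> 1 \<cdot> x \<in> span J" using \<psi> by (intro span_base) (auto simp: J_def)
    then have "f (R \<psi> x - \<psi> 1 \<cdot> x) = 0" by (rule f(2))
    then have "f (R \<psi> x) = \<psi> 1 * f x" by (simp add: lin_simps[OF f(1)])
    then show "\<psi> (L f x) = \<psi> (f x \<cdot> 1)" by (simp add: LR_swap[OF f(1) \<psi>] lin_simps[OF \<psi>])
  qed
  then show thesis using that f by blast
qed

text \<open>
  Both sides are equal to \<open>f(x\<^sub>1) g(x\<^sub>2)\<close>.
\<close>

lemma invariants_unique:
  assumes f: "lin f" "f 1 = 1" "\<And>x. L f x = f x \<cdot> 1" and g: "lin g" "g 1 = 1" "\<And>x. R g x = g x \<cdot> 1"
  shows "f x = g x"
  using LR_swap[OF f(1) g(1), of x] by (simp add: f g lin_simps)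

definition haar :: "'h \<Rightarrow> complex" where
  "haar = (SOME f. lin f \<and> f 1 = 1 \<and> (\<forall>x. L f x = f x \<cdot> 1))"

lemma haar_lin [simp]: "lin haar" and haar_1 [simp]: "haar 1 = 1" and haar_L: "L haar x = haar x \<cdot> 1"
proof -
  have "\<exists>f. lin f \<and> f 1 = 1 \<and> (\<forall>x. L f x = f x \<cdot> 1)" using right_invariant_exists by metis
  then have "lin haar \<and> haar 1 = 1 \<and> (\<forall>x. L haar x = haar x \<cdot> 1)" unfolding haar_def by (rule someI_ex)
  then show "lin haar" "haar 1 = 1" "L haar x = haar x \<cdot> 1" by auto
qed

lemma lin_tau: "lin \<phi> \<Longrightarrow> lin (\<lambda>x. cnj (\<phi> (tau x)))"
  by (auto simp: lin_def tau_linear)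

text \<open>
  As \<open>\<tau>\<close> reverses the comultiplication, \<open>x \<mapsto> cnj (h(\<tau>(x)))\<close> is left invariant; by uniqueness it is
  \<open>h\<close>.
\<close>

lemma haar_R: "R haar x = haar x \<cdot> 1"
proof -
  define g where "g x = cnj (haar (tau x))" for x
  have g: "lin g" "g 1 = 1" unfolding g_def using lin_tau[OF haar_lin] by (auto simp: tau_1)
  have gR: "R g x = g x \<cdot> 1" for x
  proof (rule linear_forms_separate_points)
    fix \<psi> assume \<psi>: "lin \<psi>"
    define \<psi>' where "\<psi>' y = cnj (\<psi> (tau y))" for y
    have \<psi>': "lin \<psi>'" unfolding \<psi>'_def using \<psi> by (rule lin_tau)
    have "\<psi>' (L haar (tau x)) = comult H (tau x) (\<lambda>a b. haar a * \<psi>' b)" by (simp add: L_apply \<psi>')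
    also have "\<dots> = cnj (comult H x (\<lambda>a b. \<psi> a * g b))"
      unfolding comult_tau[OF bil_product[OF haar_lin \<psi>']] by (simp add: \<psi>'_def tau_tau g_def mult.commute)
    also have "comult H x (\<lambda>a b. \<psi> a * g b) = \<psi> (R g x)" by (simp add: R_apply \<psi> g)
    finally have "cnj (\<psi> (R g x)) = haar (tau x) * \<psi>' 1" by (simp add: haar_L lin_simps[OF \<psi>'])
    then have "\<psi> (R g x) = cnj (haar (tau x) * \<psi>' 1)" by (metis complex_cnj_cnj)
    then show "\<psi> (R g x) = \<psi> (g x \<cdot> 1)" by (simp add: \<psi>'_def tau_1 g_def lin_simps[OF \<psi>])
  qed
  have "haar y = g y" for y by (rule invariants_unique[OF haar_lin haar_1 haar_L g gR])
  then have "haar = g" by blast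
  then show ?thesis using gR by simp
qed

text \<open>
  The functional \<open>x \<mapsto> cnj (h(x\<^sup>*))\<close> is again right invariant, so it is \<open>h\<close> by uniqueness.
\<close>

lemma haar_star: "haar (st x) = cnj (haar x)"
proof -
  define f where "f x = cnj (haar (st x))" for x
  have f: "lin f" "f 1 = 1" unfolding f_def using lin_comp(4)[OF haar_lin] by auto
  have "L f x = f x \<cdot> 1" for x
  proof (rule linear_forms_separate_points)
    fix \<psi> assume \<psi>: "lin \<psi>"
    define \<psi>' where "\<psi>' y = cnj (\<psi> (st y))" for y
    have \<psi>': "lin \<psi>'" unfolding \<psi>'_def using \<psi> by (rule lin_comp(4))
    have "\<psi>' (L haar (st x)) = comult H (st x) (\<lambda>a b. haar a * \<psi>' b)" by (simp add: L_apply \<psi>')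
    also have "\<dots> = cnj (comult H x (\<lambda>a b. f a * \<psi> b))"
      unfolding comult_star[OF bil_product[OF haar_lin \<psi>']] by (simp add: \<psi>'_def star_anti f_def)
    also have "comult H x (\<lambda>a b. f a * \<psi> b) = \<psi> (L f x)" by (simp add: L_apply \<psi> f)
    finally have "cnj (\<psi> (L f x)) = haar (st x) * \<psi>' 1" by (simp add: haar_L lin_simps[OF \<psi>'])
    then have "\<psi> (L f x) = cnj (haar (st x) * \<psi>' 1)" by (metis complex_cnj_cnj)
    then show "\<psi> (L f x) = \<psi> (f x \<cdot> 1)" by (simp add: \<psi>'_def f_def lin_simps[OF \<psi>])
  qed
  from invariants_unique[OF f this haar_lin haar_1 haar_R] have "f x = haar x" .
  then show ?thesis by (metis complex_cnj_cnj f_def)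
qed

text \<open>
  In Sweedler notation, \<open>h(x\<^sub>1 z) x\<^sub>2 = h(x\<^sub>1 z\<^sub>1) x\<^sub>2 z\<^sub>2 S(z\<^sub>3) = h(x z\<^sub>1) S(z\<^sub>2)\<close>; the second
  step is right invariance.
\<close>

lemma strong_invariance: "L (\<lambda>a. haar (a * z)) x = S (L (\<lambda>b. haar (x * b)) z)"
proof (induction z rule: unitary_induct)
  case (coeff n u i j)
  then have u: "corep n u" by (simp add: unitary_def)
  have l: "lin (\<lambda>b. haar (x * b))" "lin (\<lambda>a. haar (a * z))" for z by auto
  have "L (\<lambda>b. haar (x * b)) (u i j) = (\<Sum>k<n. haar (x * u i k) \<cdot> u k j)"
  proof (rule linear_forms_separate_points)
    fix \<psi> assume \<psi>: "lin \<psi>"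
    show "\<psi> (L (\<lambda>b. haar (x * b)) (u i j)) = \<psi> (\<Sum>k<n. haar (x * u i k) \<cdot> u k j)"
      using corep_comult[OF u bil_product[OF l(1) \<psi>] coeff(2,3)] by (simp add: L_apply[OF l(1) \<psi>] lin_simps[OF \<psi>])
  qed
  then have "S (L (\<lambda>b. haar (x * b)) (u i j)) = (\<Sum>k<n. haar (x * u i k) \<cdot> S (u k j))"
    by (simp add: antipode_sum antipode_linear)
  also have "\<dots> = (\<Sum>k<n. L haar (x * u i k) * S (u k j))" by (simp add: haar_L)
  also have "\<dots> = (\<Sum>k<n. (\<Sum>p<n. L (\<lambda>a. haar (a * u i p)) x * u p k) * S (u k j))"
    using L_mult_corep(1)[OF u coeff(2) _ haar_lin] by (intro sum.cong refl) simp
  also have "\<dots> = (\<Sum>k<n. \<Sum>p<n. L (\<lambda>a. haar (a * u i p)) x * (u p k * S (u k j)))"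
    by (simp add: sum_distrib_right mult.assoc)
  also have "\<dots> = (\<Sum>p<n. L (\<lambda>a. haar (a * u i p)) x * (\<Sum>k<n. u p k * S (u k j)))"
    by (subst sum.swap) (simp add: sum_distrib_left)
  also have "\<dots> = (\<Sum>p<n. if p = j then L (\<lambda>a. haar (a * u i p)) x else 0)"
    using corep_antipode(2)[OF u _ coeff(3)] by (intro sum.cong refl) simp
  also have "\<dots> = L (\<lambda>a. haar (a * u i j)) x" using coeff(3) by simp
  finally show ?case by simp
next
  case (add z w)
  have "L (\<lambda>a. haar (a * (z + w))) x = L (\<lambda>a. haar (a * z)) x + L (\<lambda>a. haar (a * w)) x"
  proof (rule linear_forms_separate_points)
    fix \<psi> assume \<psi>: "lin \<psi>"
    have l: "lin (\<lambda>a. haar (a * z))" for z by auto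
    show "\<psi> (L (\<lambda>a. haar (a * (z + w))) x) = \<psi> (L (\<lambda>a. haar (a * z)) x + L (\<lambda>a. haar (a * w)) x)"
      unfolding lin_simps(1)[OF \<psi>] LR_swap[OF l \<psi>] by (simp add: distrib_left lin_simps[OF haar_lin])
  qed
  moreover have "lin (\<lambda>b. haar (x * b))" by auto
  ultimately show ?case using add by (simp add: L_linear antipode_linear)
next
  case (scale c z)
  have "L (\<lambda>a. haar (a * (c \<cdot> z))) x = c \<cdot> L (\<lambda>a. haar (a * z)) x"
  proof (rule linear_forms_separate_points)
    fix \<psi> assume \<psi>: "lin \<psi>"
    have l: "lin (\<lambda>a. haar (a * z))" for z by auto
    show "\<psi> (L (\<lambda>a. haar (a * (c \<cdot> z))) x) = \<psi> (c \<cdot> L (\<lambda>a. haar (a * z)) x)"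
      unfolding lin_simps(2)[OF \<psi>] LR_swap[OF l \<psi>] by (simp add: lin_simps[OF haar_lin])
  qed
  moreover have "lin (\<lambda>b. haar (x * b))" by auto
  ultimately show ?case using scale by (simp add: L_linear antipode_linear)
qed

lemma L_star:
  assumes \<phi>: "lin \<phi>" shows "L (\<lambda>a. cnj (\<phi> (st a))) x = st (L \<phi> (st x))"
proof (rule linear_forms_separate_points)
  fix \<psi> assume \<psi>: "lin \<psi>"
  define \<psi>' where "\<psi>' y = cnj (\<psi> (st y))" for y
  have \<psi>': "lin \<psi>'" unfolding \<psi>'_def using \<psi> by (rule lin_comp(4))
  have "\<psi>' (L \<phi> (st x)) = comult H (st x) (\<lambda>a b. \<phi> a * \<psi>' b)" by (simp add: L_apply \<psi>' \<phi>)
  also have "\<dots> = cnj (comult H x (\<lambda>a b. cnj (\<phi> (st a)) * \<psi> b))"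
    unfolding comult_star[OF bil_product[OF \<phi> \<psi>']] by (simp add: \<psi>'_def star_anti)
  also have "comult H x (\<lambda>a b. cnj (\<phi> (st a)) * \<psi> b) = \<psi> (L (\<lambda>a. cnj (\<phi> (st a))) x)"
    using L_apply[OF lin_comp(4)[OF \<phi>] \<psi>] by simp
  finally have "cnj (\<psi> (st (L \<phi> (st x)))) = cnj (\<psi> (L (\<lambda>a. cnj (\<phi> (st a))) x))" by (simp add: \<psi>'_def)
  then show "\<psi> (L (\<lambda>a. cnj (\<phi> (st a))) x) = \<psi> (st (L \<phi> (st x)))" by (metis complex_cnj_cnj)
qed

lemma R_star:
  assumes \<phi>: "lin \<phi>" shows "R \<phi> (st x) = st (R (\<lambda>a. cnj (\<phi> (st a))) x)"
proof (rule linear_forms_separate_points)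
  fix \<psi> assume \<psi>: "lin \<psi>"
  define \<psi>' where "\<psi>' y = cnj (\<psi> (st y))" for y
  have \<psi>': "lin \<psi>'" unfolding \<psi>'_def using \<psi> by (rule lin_comp(4))
  have "\<psi> (R \<phi> (st x)) = comult H (st x) (\<lambda>a b. \<psi> a * \<phi> b)" by (simp add: R_apply \<psi> \<phi>)
  also have "\<dots> = cnj (comult H x (\<lambda>a b. \<psi>' a * cnj (\<phi> (st b))))"
    unfolding comult_star[OF bil_product[OF \<psi> \<phi>]] by (simp add: \<psi>'_def)
  also have "comult H x (\<lambda>a b. \<psi>' a * cnj (\<phi> (st b))) = \<psi>' (R (\<lambda>a. cnj (\<phi> (st a))) x)"
    using R_apply[OF lin_comp(4)[OF \<phi>] \<psi>'] by simp
  finally show "\<psi> (R \<phi> (st x)) = \<psi> (st (R (\<lambda>a. cnj (\<phi> (st a))) x))" by (simp add: \<psi>'_def)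
qed

end

section \<open>Positivity of the Haar functional\<close>

context cqg
begin

lemma star_right_coideal:
  assumes V: "right_coideal V" "findim V"
  shows "right_coideal (st ` V)" "findim (st ` V)"
proof -
  have sV: "subspace V" using V(1) by (rule right_coidealD)
  have sub: "subspace (st ` V)"
  proof (rule subspaceI)
    show "0 \<in> st ` V" using subspace_0[OF sV] star_0 by force
    show "x + y \<in> st ` V" if "x \<in> st ` V" "y \<in> st ` V" for x y
      using that subspace_add[OF sV] by (auto simp: star_anti(1)[symmetric])
    show "c \<cdot> x \<in> st ` V" if x: "x \<in> st ` V" for c x
    proof -
      obtain y where y: "y \<in> V" "x = st y" using x by blast
      then have "c \<cdot> x = st (cnj c \<cdot> y)" by (simp add: star_anti)
      then show ?thesis using subspace_scale[OF sV y(1)] by blast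
    qed
  qed
  then show "right_coideal (st ` V)"
    unfolding right_coideal_def
  proof (intro conjI allI impI)
    fix \<psi> x assume \<psi>: "lin \<psi>" and "x \<in> st ` V"
    then obtain y where y: "y \<in> V" "x = st y" by blast
    have "R \<psi> x = st (R (\<lambda>a. cnj (\<psi> (st a))) y)" unfolding y(2) by (rule R_star[OF \<psi>])
    moreover have "R (\<lambda>a. cnj (\<psi> (st a))) y \<in> V" by (rule right_coidealD(1)[OF V(1) lin_comp(4)[OF \<psi>] y(1)])
    ultimately show "R \<psi> x \<in> st ` V" by blast
  qed
  obtain B where B: "finite B" "V \<subseteq> span B" using V(2) by (auto simp: findim_def)
  have "st ` V \<subseteq> span (st ` B)"
  proof (rule image_subsetI)
    fix x assume "x \<in> V"
    then have "x \<in> span B" using B by auto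
    then show "st x \<in> span (st ` B)"
      by (induction rule: span_induct_alt) (auto simp: star_anti intro!: span_zero span_add span_scale intro: span_base)
  qed
  then show "findim (st ` V)" using B(1) sub by (auto simp: findim_def)
qed

definition haar_form :: "'h \<Rightarrow> 'h \<Rightarrow> complex" where "haar_form x y = haar (x * st y)"

lemma haar_form_hermitian: "hermitian haar_form"
  unfolding hermitian_def haar_form_def
proof (intro conjI allI)
  show "lin (\<lambda>x. haar (x * st y))" for y by auto
  show "haar (y * st x) = cnj (haar (x * st y))" for x y
    using haar_star[of "x * st y"] by (simp add: star_anti)
qed

text \<open>
  For an orthonormal basis of \<open>V\<close> one has \<open>e\<^sub>j = \<Sum>\<^sub>i \<epsilon>(e\<^sub>i) u\<^sub>i\<^sub>j\<close>, and \<open>\<Sum>\<^sub>j u\<^sub>i\<^sub>j u\<^sub>k\<^sub>j\<^sup>* = \<delta>\<^sub>i\<^sub>k\<close>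
  gives \<open>N = \<Sum> |\<epsilon>(e\<^sub>i)|\<^sup>2\<close>. This is positive since \<open>e = 0\<close> otherwise.
\<close>

lemma orthonormal_sum:
  assumes V: "right_coideal V" "findim V" and x: "x \<in> V" "x \<noteq> 0"
  obtains n :: nat and e and N :: real where "N > 0" "(\<Sum>j<n. e j * st (e j)) = of_real N \<cdot> 1"
    "\<And>j. j < n \<Longrightarrow> e j \<in> V" "\<And>j. j < n \<Longrightarrow> e j \<noteq> 0"
proof -
  obtain n e u where u: "unitary n u" and e: "\<And>i. i < n \<Longrightarrow> e i \<in> V" "\<And>j. j < n \<Longrightarrow> e j \<noteq> 0"
    "\<And>j. j < n \<Longrightarrow> e j = (\<Sum>i<n. \<epsilon> (e i) \<cdot> u i j)" "V = span (e ` {..<n})"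
    by (rule unitary_basis[OF V], rule that)
  define N where "N = (\<Sum>i<n. (cmod (\<epsilon> (e i)))\<^sup>2)"
  have n: "n \<noteq> 0" using x e(4) by (intro notI) simp
  have "N > 0"
  proof (rule ccontr)
    assume "\<not> N > 0"
    then have "N = 0" unfolding N_def using sum_nonneg[of "{..<n}" "\<lambda>i. (cmod (\<epsilon> (e i)))\<^sup>2"] by simp
    then have "\<epsilon> (e i) = 0" if "i < n" for i
      using that unfolding N_def by (subst (asm) sum_nonneg_eq_0_iff) auto
    then have "e 0 = 0" using e(3)[of 0] n by simp
    then show False using e(2)[of 0] n by simp
  qed
  moreover have "(\<Sum>j<n. e j * st (e j)) = of_real N \<cdot> 1"
  proof -
    have "(\<Sum>j<n. e j * st (e j)) = (\<Sum>j<n. (\<Sum>i<n. \<epsilon> (e i) \<cdot> u i j) * st (\<Sum>i<n. \<epsilon> (e i) \<cdot> u i j))"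
      using e(3) by (intro sum.cong refl arg_cong2[where f = "(*)"] arg_cong[where f = st]) simp_all
    also have "\<dots> = (\<Sum>j<n. \<Sum>i<n. \<Sum>k<n. (\<epsilon> (e i) * cnj (\<epsilon> (e k))) \<cdot> (u i j * st (u k j)))"
      by (simp only: star_sum sum_product) (simp add: star_anti mult.commute)
    also have "\<dots> = (\<Sum>i<n. \<Sum>j<n. \<Sum>k<n. (\<epsilon> (e i) * cnj (\<epsilon> (e k))) \<cdot> (u i j * st (u k j)))"
      by (rule sum.swap)
    also have "\<dots> = (\<Sum>i<n. \<Sum>k<n. \<Sum>j<n. (\<epsilon> (e i) * cnj (\<epsilon> (e k))) \<cdot> (u i j * st (u k j)))"
      by (intro sum.cong refl sum.swap)
    also have "\<dots> = (\<Sum>i<n. \<Sum>k<n. (\<epsilon> (e i) * cnj (\<epsilon> (e k))) \<cdot> (\<Sum>j<n. u i j * st (u k j)))"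
      by (simp add: scale_sum_right)
    also have "\<dots> = (\<Sum>i<n. \<Sum>k<n. if i = k then of_real ((cmod (\<epsilon> (e i)))\<^sup>2) \<cdot> 1 else 0)"
      by (intro sum.cong refl) (simp add: unitary_relations(1)[OF u] complex_norm_square del: of_real_power)
    also have "\<dots> = of_real N \<cdot> 1"
      by (simp add: N_def scale_sum_left)
    finally show ?thesis .
  qed
  ultimately show thesis by (rule that) (use e in auto)
qed

text \<open>
  A compatible inner product \<open>s'\<close> on \<open>V\<^sup>*\<close> gives the inner product \<open>s(x,y) = s'(y\<^sup>*,x\<^sup>*)\<close> on \<open>V\<close>. Let
  \<open>\<mu>\<close> be the least eigenvalue of \<open>h(x y\<^sup>*)\<close> with respect to \<open>s\<close>. Both forms satisfy the same strong
  invariance, so the eigenspace \<open>W\<close> of \<open>\<mu>\<close> is a right coideal. By the previous lemma \<open>W\<close> contains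
  nonzero \<open>e\<^sub>j\<close> with \<open>\<Sum> e\<^sub>j e\<^sub>j\<^sup>* = N > 0\<close>; applying \<open>h\<close> yields \<open>N = \<mu> \<Sum> s(e\<^sub>j,e\<^sub>j)\<close>. Hence \<open>\<mu> > 0\<close>. Two
  different compatible inner products are involved, one on \<open>V\<^sup>*\<close> and one on \<open>W\<close>: this is what
  makes the sign come out.
\<close>

lemma haar_form_positive: 
  assumes V: "right_coideal V" "findim V"
  shows "positive_on haar_form V"
  unfolding positive_on_def
proof (intro ballI impI)
  fix x assume x: "x \<in> V" "x \<noteq> 0"
  define V' where "V' = st ` V"
  have V': "right_coideal V'" "findim V'" unfolding V'_def by (rule star_right_coideal[OF V])+
  obtain s' where s': "compatible s' V'" by (rule compatible_form[OF V'])
  then have h': "hermitian s'" "positive_on s' V'" by (simp_all add: compatible_def)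
  define s where "s x y = cnj (s' (st x) (st y))" for x y
  have s: "hermitian s" "positive_on s V"
  proof -
    show "hermitian s"
      unfolding hermitian_def s_def
    proof (intro conjI allI)
      show "lin (\<lambda>x. cnj (s' (st x) (st y)))" for y by (rule lin_comp(4)[OF hermitian_lin[OF h'(1)]])
      show "cnj (s' (st y) (st x)) = cnj (cnj (s' (st x) (st y)))" for x y
        using hermitian_sym[OF h'(1), of "st y" "st x"] by simp
    qed
    have "st x \<noteq> 0" if "x \<noteq> 0" for x using that star_anti(3)[of x] by force
    then show "positive_on s V"
      using h'(2) unfolding positive_on_def s_def V'_def by auto
  qed
  obtain \<mu> x0 where m: "x0 \<in> V" "x0 \<noteq> 0" "\<And>y. y \<in> V \<Longrightarrow> haar_form x0 y = of_real \<mu> * s x0 y"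
    "\<And>x. x \<in> V \<Longrightarrow> \<mu> * Re (s x x) \<le> Re (haar_form x x)"
    by (rule least_eigenvalue[OF V(2) s haar_form_hermitian x], rule that)
  define W where "W = {x \<in> V. \<forall>y\<in>V. haar_form x y = of_real \<mu> * s x y}"
  have sV: "subspace V" using V(1) by (rule right_coidealD)
  have subW: "subspace W"
    using sV by (intro subspaceI)
      (auto simp: W_def subspace_0 subspace_add subspace_scale hermitian_simps(1,2,3)[OF s(1)]
        hermitian_simps(1,2,3)[OF haar_form_hermitian] algebra_simps)
  have "right_coideal W"
    unfolding right_coideal_def
  proof (intro conjI allI impI subW)
    fix \<psi> x assume \<psi>: "lin \<psi>" and xW: "x \<in> W"
    have xV: "x \<in> V" using xW by (simp add: W_def)
    have "haar_form (R \<psi> x) y = of_real \<mu> * s (R \<psi> x) y" if y: "y \<in> V" for y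
    proof -
      define z where "z = st y"
      have zV: "z \<in> V'" "st x \<in> V'" using y xV by (auto simp: V'_def z_def)
      define \<phi> where "\<phi> b = haar (x * b)" for b
      define \<chi> where "\<chi> b = s' b (st x)" for b
      have \<phi>: "lin \<phi>" and \<chi>: "lin \<chi>" unfolding \<phi>_def \<chi>_def using hermitian_lin[OF h'(1)] by auto
      have "haar_form (R \<psi> x) y = \<psi> (L (\<lambda>a. haar (a * z)) x)"
        unfolding haar_form_def z_def by (subst LR_swap) (auto simp: \<psi>)
      also have "\<dots> = \<psi> (S (L \<phi> z))" unfolding strong_invariance \<phi>_def by simp
      finally have 1: "haar_form (R \<psi> x) y = \<psi> (S (L \<phi> z))" .
      have sl: "lin (\<lambda>a. s' a z)" by (rule hermitian_lin[OF h'(1)])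
      have "s (R \<psi> x) y = \<psi> (L (\<lambda>a. cnj (s' (st a) z)) x)"
        unfolding s_def z_def using LR_swap[OF lin_comp(4)[OF hermitian_lin[OF h'(1), of "st y"]] \<psi>] by simp
      also have "\<dots> = \<psi> (st (L (\<lambda>a. s' a z) (st x)))" by (simp add: L_star[OF sl])
      also have "L (\<lambda>a. s' a z) (st x) = tau (L \<chi> z)"
        using s' zV unfolding compatible_def \<chi>_def by blast
      finally have 2: "s (R \<psi> x) y = \<psi> (S (L \<chi> z))" by (simp add: tau_def star_anti)
      have "L \<phi> z = of_real \<mu> \<cdot> L \<chi> z"
      proof (rule linear_forms_separate_points)
        fix \<theta> assume \<theta>: "lin \<theta>"
        have "R \<theta> z \<in> V'" by (rule right_coidealD(1)[OF V'(1) \<theta> zV(1)])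
        then obtain v where v: "v \<in> V" "R \<theta> z = st v" by (auto simp: V'_def)
        have "\<phi> (R \<theta> z) = haar_form x v" by (simp add: \<phi>_def v haar_form_def)
        also have "\<dots> = of_real \<mu> * s x v" using xW v(1) by (simp add: W_def)
        also have "s x v = \<chi> (R \<theta> z)"
          using hermitian_sym[OF h'(1), of "st v" "st x"] by (simp add: s_def \<chi>_def v(2))
        finally show "\<theta> (L \<phi> z) = \<theta> (of_real \<mu> \<cdot> L \<chi> z)"
          by (simp add: LR_swap \<phi> \<chi> \<theta> lin_simps[OF \<theta>])
      qed
      then show ?thesis unfolding 1 2 by (simp add: antipode_linear lin_simps[OF \<psi>])
    qed
    then show "R \<psi> x \<in> W" using right_coidealD(1)[OF V(1) \<psi> xV] by (simp add: W_def)
  qed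
  note rcW = this
  have fW: "findim W" by (rule findim_subset[OF V(2) subW]) (auto simp: W_def)
  have x0W: "x0 \<in> W" using m by (simp add: W_def)
  obtain n e N where e: "N > 0" "(\<Sum>j<n. e j * st (e j)) = of_real N \<cdot> 1"
    "\<And>j. j < n \<Longrightarrow> e j \<in> W" "\<And>j. j < (n::nat) \<Longrightarrow> e j \<noteq> 0"
    by (rule orthonormal_sum[OF rcW fW x0W m(2)], rule that)
  have "of_real N = haar (\<Sum>j<n. e j * st (e j))" by (simp add: e(2) lin_simps[OF haar_lin])
  also have "\<dots> = (\<Sum>j<n. haar_form (e j) (e j))" by (simp add: lin_simps[OF haar_lin] haar_form_def)
  also have "\<dots> = (\<Sum>j<n. of_real \<mu> * s (e j) (e j))" using e(3) by (intro sum.cong) (auto simp: W_def)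
  also have "\<dots> = of_real (\<mu> * (\<Sum>j<n. Re (s (e j) (e j))))"
    by (subst hermitian_simps(12)[OF s(1)]) (simp add: sum_distrib_left)
  finally have "N = \<mu> * (\<Sum>j<n. Re (s (e j) (e j)))" by (simp only: of_real_eq_iff)
  moreover have "(\<Sum>j<n. Re (s (e j) (e j))) \<ge> 0"
    using e(3,4) s(2) by (intro sum_nonneg) (auto simp: W_def positive_on_def intro: less_imp_le)
  ultimately have "\<mu> > 0" using e(1) by (metis mult_nonpos_nonneg not_le)
  moreover have "Re (s x x) > 0" using s(2) x by (simp add: positive_on_def)
  ultimately show "0 < Re (haar_form x x)" using m(4)[OF x(1)] by (smt (verit) mult_pos_pos)
qed

lemma haar_form_definite:
  assumes "haar_form x x = 0" shows "x = 0"
proof (rule ccontr)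
  assume "x \<noteq> 0"
  obtain V where V: "findim V" "subcoalgebra V" "x \<in> V" by (rule finite_subcoalgebra)
  then have "positive_on haar_form V" by (intro haar_form_positive) (auto simp: subcoalgebra_def)
  then show False using V(3) \<open>x \<noteq> 0\<close> assms by (auto simp: positive_on_def)
qed

text \<open>
  If \<open>z \<bottom> V\<close> and \<open>u\<close> is a unitary matrix with entries in \<open>V\<close>, then left invariance applied to
  \<open>h(z u\<^sub>i\<^sub>j\<^sup>*) = 0\<close> gives \<open>\<Sum>\<^sub>k z\<^sub>1 u\<^sub>i\<^sub>k\<^sup>* h(z\<^sub>2 u\<^sub>k\<^sub>j\<^sup>*) = 0\<close>, and unitarity removes the factors
  \<open>u\<^sub>i\<^sub>k\<^sup>*\<close>.
\<close>

lemma subcoalgebra_complement: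
  assumes V: "subcoalgebra V" "findim V" and z: "\<And>w. w \<in> V \<Longrightarrow> haar_form z w = 0" and \<psi>: "lin \<psi>" and w: "w \<in> V"
  shows "haar_form (L \<psi> z) w = 0"
proof -
  have rc: "right_coideal V" using V by (simp add: subcoalgebra_def)
  obtain n e u where u: "unitary n u" and e: "\<And>i. i < n \<Longrightarrow> e i \<in> V"
    "\<And>j. j < n \<Longrightarrow> e j = (\<Sum>i<n. \<epsilon> (e i) \<cdot> u i j)" "V = span (e ` {..<n})"
    "\<And>i j. i < n \<Longrightarrow> j < n \<Longrightarrow> \<exists>\<phi>. lin \<phi> \<and> u i j = L \<phi> (e j)"
    by (rule unitary_basis[OF rc V(2)], rule that)
  have uV: "u i j \<in> V" if "i < n" "j < n" for i j
    using e(4)[OF that] e(1)[OF that(2)] V(1) unfolding subcoalgebra_def by metis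
  have c: "corep n (\<lambda>i j. st (u i j))" using u by (intro corep_star) (simp add: unitary_def)
  have key: "haar_form (L \<psi> z) (u m j) = 0" if mj: "m < n" "j < n" for m j
  proof -
    define r where "r k = R (\<lambda>b. haar (b * st (u k j))) z" for k
    have "(\<Sum>k<n. r k * st (u i k)) = 0" if i: "i < n" for i
    proof -
      have "(\<Sum>k<n. r k * st (u i k)) = R haar (z * st (u i j))"
        unfolding r_def by (rule L_mult_corep(2)[OF c i mj(2) haar_lin, symmetric])
      also have "\<dots> = haar_form z (u i j) \<cdot> 1" by (simp add: haar_R haar_form_def)
      finally show ?thesis using z[OF uV[OF i mj(2)]] by simp
    qed
    then have "0 = (\<Sum>i<n. (\<Sum>k<n. r k * st (u i k)) * u i m)" by simp
    also have "\<dots> = (\<Sum>k<n. \<Sum>i<n. r k * (st (u i k) * u i m))"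
      by (subst sum.swap) (simp add: sum_distrib_right mult.assoc)
    also have "\<dots> = (\<Sum>k<n. r k * (\<Sum>i<n. st (u i k) * u i m))" by (simp add: sum_distrib_left)
    also have "\<dots> = (\<Sum>k<n. if k = m then r k else 0)"
      using unitary_relations(2)[OF u _ mj(1)] by (intro sum.cong refl) simp
    also have "\<dots> = r m" using mj by simp
    finally have "\<psi> (R (\<lambda>b. haar (b * st (u m j))) z) = 0" by (simp add: r_def lin_simps[OF \<psi>])
    then show ?thesis
      unfolding haar_form_def using LR_swap[OF \<psi> lin_comp(1)[OF haar_lin], of z "st (u m j)"] by simp
  qed
  have ej: "haar_form (L \<psi> z) (e j) = 0" if "j < n" for j
    by (subst e(2)[OF that]) (simp add: hermitian_simps(10,7)[OF haar_form_hermitian] key that)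
  have "w \<in> span (e ` {..<n})" using w e(3) by simp
  then show ?thesis
    by (induction rule: span_induct_alt) (auto simp: hermitian_simps(6,7,8)[OF haar_form_hermitian] ej)
qed


section \<open>Orthogonal complements of right coideals\<close>

definition star_coideal_algebra :: "'h set \<Rightarrow> bool" where
  "star_coideal_algebra A \<longleftrightarrow> right_coideal A \<and> 1 \<in> A \<and> (\<forall>x\<in>A. \<forall>y\<in>A. x * y \<in> A) \<and> (\<forall>x\<in>A. st x \<in> A)"

text \<open>
  The first legs of \<open>\<Delta>(x)\<close> can be chosen in \<open>A\<close> iff all \<open>R \<psi> x\<close> lie in \<open>A\<close>.
\<close>

lemma star_coideal_algebra_iff: "right_coideal_star_subalgebra H A \<longleftrightarrow> star_coideal_algebra A"
proof
  assume A: "right_coideal_star_subalgebra H A"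
  then have "0 \<cdot> 1 \<in> A" unfolding right_coideal_star_subalgebra_def by blast
  then have sub: "subspace A"
    using A by (intro subspaceI) (auto simp: right_coideal_star_subalgebra_def)
  then show "star_coideal_algebra A"
    using A comult_in_subtensor_iff[OF sub]
    by (auto simp: star_coideal_algebra_def right_coideal_star_subalgebra_def right_coideal_def)
next
  assume A: "star_coideal_algebra A"
  then have sub: "subspace A" by (simp add: star_coideal_algebra_def right_coideal_def)
  then show "right_coideal_star_subalgebra H A"
    using A comult_in_subtensor_iff[OF sub] subspace_add[OF sub] subspace_scale[OF sub]
    by (auto simp: star_coideal_algebra_def right_coideal_star_subalgebra_def right_coideal_def)
qed

text \<open>
  Project \<open>x\<close> orthogonally to \<open>A \<inter> V\<close>, where \<open>V\<close> is a finite-dimensional subcoalgebra that contains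
  \<open>x\<close>. The remainder lies in \<open>V\<close> and is orthogonal to \<open>A \<inter> V\<close>; it is orthogonal to all of \<open>A\<close> because
  the orthogonal projection onto \<open>V\<close> maps \<open>A\<close> into itself.
\<close>

lemma coideal_decomposition:
  assumes A: "right_coideal A"
  obtains a where "a \<in> A" "\<And>b. b \<in> A \<Longrightarrow> haar_form (x - a) b = 0"
proof -
  obtain V where V: "findim V" "subcoalgebra V" "x \<in> V" by (rule finite_subcoalgebra)
  have rc: "right_coideal V" and sV: "subspace V" using V by (auto simp: subcoalgebra_def right_coideal_def)
  have sA: "subspace A" using A by (rule right_coidealD)
  have pV: "positive_on haar_form V" by (rule haar_form_positive[OF rc V(1)])
  have "findim (A \<inter> V)" by (rule findim_subset[OF V(1) subspace_inter[OF sA sV]]) simp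
  moreover have "positive_on haar_form (A \<inter> V)" using pV by (auto simp: positive_on_def)
  ultimately obtain a where a: "a \<in> A \<inter> V" "\<And>w. w \<in> A \<inter> V \<Longrightarrow> haar_form (x - a) w = 0"
    using orthogonal_projection[OF _ haar_form_hermitian] by metis
  have "haar_form (x - a) b = 0" if b: "b \<in> A" for b
  proof -
    have "\<exists>v. v \<in> V \<and> (\<forall>w\<in>V. haar_form (y - v) w = 0)" for y
      by (rule orthogonal_projection[OF V(1) haar_form_hermitian pV, of y]) blast
    then obtain P where P: "\<And>y. P y \<in> V" "\<And>y w. w \<in> V \<Longrightarrow> haar_form (y - P y) w = 0" by metis
    have uniq: "P y = v" if "v \<in> V" "\<And>w. w \<in> V \<Longrightarrow> haar_form (y - v) w = 0" for y v
    proof -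
      have d: "P y - v \<in> V" using P(1) that(1) sV by (simp add: subspace_diff)
      have "haar_form (P y - v) w = haar_form (y - v) w - haar_form (y - P y) w" for w
        by (simp add: hermitian_simps(4)[OF haar_form_hermitian])
      then have "haar_form (P y - v) (P y - v) = 0" using P(2)[OF d] that(2)[OF d] by simp
      then show ?thesis using haar_form_definite by fastforce
    qed
    have Plin: "P (y + y') = P y + P y'" "P (c \<cdot> y) = c \<cdot> P y" for y y' c
    proof -
      show "P (y + y') = P y + P y'"
      proof (rule uniq)
        show "P y + P y' \<in> V" using P(1) sV by (simp add: subspace_add)
        show "haar_form (y + y' - (P y + P y')) w = 0" if "w \<in> V" for w
          using P(2)[OF that, of y] P(2)[OF that, of y'] by (simp add: hermitian_simps(1,4)[OF haar_form_hermitian])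
      qed
      show "P (c \<cdot> y) = c \<cdot> P y"
      proof (rule uniq)
        show "c \<cdot> P y \<in> V" using P(1) sV by (simp add: subspace_scale)
        show "haar_form (c \<cdot> y - c \<cdot> P y) w = 0" if "w \<in> V" for w
          using P(2)[OF that, of y] by (simp add: hermitian_simps(2,4)[OF haar_form_hermitian])
      qed
    qed
    \<comment> \<open>\<open>P\<close> commutes with all \<open>L \<psi>\<close>, so it is convolution with \<open>p = \<epsilon> \<circ> P\<close> and preserves right coideals.\<close>
    define p where "p y = \<epsilon> (P y)" for y
    have p: "lin p" by (simp add: lin_def p_def Plin lin_simps[OF counit_lin])
    have PL: "P (L \<psi> y) = L \<psi> (P y)" if \<psi>: "lin \<psi>" for \<psi> y
    proof (rule uniq)
      show "L \<psi> (P y) \<in> V" using V(2) P(1) \<psi> by (simp add: subcoalgebra_def)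
      show "haar_form (L \<psi> y - L \<psi> (P y)) w = 0" if "w \<in> V" for w
        using subcoalgebra_complement[OF V(2,1) P(2) \<psi> that, of y] by (simp add: LR_diff \<psi>)
    qed
    have "P b = R p b"
    proof (rule linear_forms_separate_points)
      fix \<psi> assume \<psi>: "lin \<psi>"
      have "\<psi> (R p b) = p (L \<psi> b)" by (simp add: LR_swap p \<psi>)
      also have "\<dots> = \<psi> (P b)" by (simp add: p_def PL \<psi> counit_LR)
      finally show "\<psi> (P b) = \<psi> (R p b)" by simp
    qed
    then have "P b \<in> A \<inter> V" using P(1)[of b] right_coidealD(1)[OF A p b] by (metis IntI)
    then have 1: "haar_form (x - a) (P b) = 0" by (rule a(2))
    have "x - a \<in> V" using V(3) a(1) sV by (simp add: subspace_diff)
    then have "haar_form (b - P b) (x - a) = 0" by (rule P(2))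
    then have "haar_form (x - a) (b - P b) = 0" using hermitian_sym[OF haar_form_hermitian, of "x - a" "b - P b"] by simp
    then show ?thesis using 1 by (simp add: hermitian_simps(9)[OF haar_form_hermitian])
  qed
  then show thesis using that a(1) by blast
qed

end

section \<open>Right coideal *-subalgebras and kernels\<close>

context cqg
begin

lemma lin_kills: "lin \<phi> \<Longrightarrow> x - c \<cdot> y \<in> K \<Longrightarrow> (\<And>k. k \<in> K \<Longrightarrow> \<phi> k = 0) \<Longrightarrow> \<phi> x = c * \<phi> y"
  using lin_simps(5)[of \<phi> x "c \<cdot> y"] lin_simps(2)[of \<phi> c y] by (metis eq_iff_diff_eq_0)

lemma left_ideal_of_induct [consumes 1, case_names zero add mult]:
  assumes "x \<in> left_ideal_of H A" and "P 0" and "\<And>x y. P x \<Longrightarrow> P y \<Longrightarrow> P (x + y)"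
    and "\<And>h a. a \<in> A \<Longrightarrow> \<epsilon> a = 0 \<Longrightarrow> P (h * a)"
  shows "P x"
proof -
  obtain xs where xs: "x = (\<Sum>(h, a)\<leftarrow>xs. h * a)" "set xs \<subseteq> UNIV \<times> augmentation_part H A"
    using assms(1) by (auto simp: left_ideal_of_def)
  show ?thesis unfolding xs(1) using xs(2)
    by (induction xs) (auto simp: augmentation_part_def intro: assms(2-4))
qed

lemma left_ideal_of_base: "a \<in> A \<Longrightarrow> \<epsilon> a = 0 \<Longrightarrow> h * a \<in> left_ideal_of H A"
  by (auto simp: left_ideal_of_def augmentation_part_def intro!: exI[of _ "[(h, a)]"])

lemma left_ideal_of_subspace: "subspace (left_ideal_of H A)"
proof (rule subspaceI)
  show z: "0 \<in> left_ideal_of H A" by (auto simp: left_ideal_of_def intro!: exI[of _ "[]"])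
  show add: "x + y \<in> left_ideal_of H A" if "x \<in> left_ideal_of H A" "y \<in> left_ideal_of H A" for x y
  proof -
    obtain xs ys where "x = (\<Sum>(h, a)\<leftarrow>xs. h * a)" "set xs \<subseteq> UNIV \<times> augmentation_part H A"
      "y = (\<Sum>(h, a)\<leftarrow>ys. h * a)" "set ys \<subseteq> UNIV \<times> augmentation_part H A"
      using \<open>x \<in> left_ideal_of H A\<close> \<open>y \<in> left_ideal_of H A\<close> by (auto simp: left_ideal_of_def)
    then show ?thesis by (auto simp: left_ideal_of_def intro!: exI[of _ "xs @ ys"])
  qed
  show "c \<cdot> x \<in> left_ideal_of H A" if "x \<in> left_ideal_of H A" for c x
    using that
  proof (induction rule: left_ideal_of_induct)
    case (mult h a)
    then show ?case using left_ideal_of_base[of a A "c \<cdot> h"] by simp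
  qed (simp_all add: scale_right_distrib add z)
qed

lemma left_ideal_of_mult: "x \<in> left_ideal_of H A \<Longrightarrow> h * x \<in> left_ideal_of H A"
proof (induction rule: left_ideal_of_induct)
  case (mult k a)
  then show ?case using left_ideal_of_base[of a A "h * k"] by (simp add: mult.assoc)
qed (auto simp: distrib_left intro: subspace_add[OF left_ideal_of_subspace] subspace_0[OF left_ideal_of_subspace])

text \<open>
  The fourth condition says that \<open>K\<close> is a coideal: \<open>\<Delta>(K)\<close> is killed by the products of forms that
  vanish on \<open>K\<close>.
\<close>

definition quotient_kernel :: "'h set \<Rightarrow> bool" where
  "quotient_kernel K \<longleftrightarrow> subspace K \<and> (\<forall>h x. x \<in> K \<longrightarrow> h * x \<in> K) \<and> (\<forall>x\<in>K. \<epsilon> x = 0) \<and>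
     (\<forall>\<phi> \<psi> x. lin \<phi> \<longrightarrow> lin \<psi> \<longrightarrow> (\<forall>k\<in>K. \<phi> k = 0 \<and> \<psi> k = 0) \<longrightarrow> x \<in> K \<longrightarrow>
        comult H x (\<lambda>a b. \<phi> a * \<psi> b) = 0) \<and>
     (\<forall>x\<in>K. tau x \<in> K)"

text \<open>
  The coinvariants of \<open>H/K\<close>, tested against linear forms in the second leg.
\<close>

definition coinv :: "'h set \<Rightarrow> 'h set" where
  "coinv K = {x. \<forall>\<psi>. lin \<psi> \<longrightarrow> R \<psi> x - \<psi> x \<cdot> 1 \<in> K}"

lemma quotient_kernelD:
  assumes "quotient_kernel K"
  shows "subspace K" "x \<in> K \<Longrightarrow> h * x \<in> K" "x \<in> K \<Longrightarrow> \<epsilon> x = 0" "x \<in> K \<Longrightarrow> tau x \<in> K"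
    "lin \<phi> \<Longrightarrow> (\<And>k. k \<in> K \<Longrightarrow> \<phi> k = 0) \<Longrightarrow> x \<in> K \<Longrightarrow> R \<phi> x \<in> K"
proof -
  show K: "subspace K" "x \<in> K \<Longrightarrow> h * x \<in> K" "x \<in> K \<Longrightarrow> \<epsilon> x = 0" "x \<in> K \<Longrightarrow> tau x \<in> K"
    using assms unfolding quotient_kernel_def by blast+
  assume \<phi>: "lin \<phi>" "\<And>k. k \<in> K \<Longrightarrow> \<phi> k = 0" "x \<in> K"
  show "R \<phi> x \<in> K"
  proof (rule in_subspace_if_linear_forms[OF K(1)])
    fix \<psi> assume \<psi>: "lin \<psi>" "\<And>k. k \<in> K \<Longrightarrow> \<psi> k = 0"
    have "\<forall>\<phi> \<psi> x. lin \<phi> \<longrightarrow> lin \<psi> \<longrightarrow> (\<forall>k\<in>K. \<phi> k = 0 \<and> \<psi> k = 0) \<longrightarrow> x \<in> K \<longrightarrow>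
        comult H x (\<lambda>a b. \<phi> a * \<psi> b) = 0"
      using assms by (simp add: quotient_kernel_def)
    from this[rule_format, OF \<psi>(1) \<phi>(1) _ \<phi>(3)] \<phi>(2) \<psi>(2)
    have "comult H x (\<lambda>a b. \<psi> a * \<phi> b) = 0" by simp
    then show "\<psi> (R \<phi> x) = 0" by (simp add: R_apply \<phi> \<psi>)
  qed
qed

lemma comult_expansion_counit:
  obtains n :: nat and e \<chi> where "\<And>i. lin (\<chi> i)" "comult H x = (\<Sum>i<n. elem_tensor H H (R (\<chi> i) x) (e i))"
    "x = (\<Sum>i<n. \<epsilon> (R (\<chi> i) x) \<cdot> e i)"
proof -
  obtain n :: nat and e \<chi> where e: "\<And>i. lin (\<chi> i)" "comult H x = (\<Sum>i<n. elem_tensor H H (R (\<chi> i) x) (e i))"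
    by (rule comult_expansion[where x = x], rule that)
  have "x = (\<Sum>i<n. \<epsilon> (R (\<chi> i) x) \<cdot> e i)"
  proof (rule linear_forms_separate_points)
    fix \<psi> assume \<psi>: "lin \<psi>"
    show "\<psi> x = \<psi> (\<Sum>i<n. \<epsilon> (R (\<chi> i) x) \<cdot> e i)"
      using comult_apply_elem_sum[OF bil_product[OF counit_lin \<psi>] e(2)] comult_counit(1)[OF \<psi>, of x]
      by (simp add: lin_simps[OF \<psi>])
  qed
  then show thesis by (rule that[OF e])
qed

lemma counit_sub: "\<epsilon> (x - \<epsilon> x \<cdot> 1) = 0"
  by (simp add: lin_simps[OF counit_lin] counit_mult)

text \<open>
  Let \<open>a \<in> A\<close> with \<open>\<epsilon>(a) = 0\<close>, so that \<open>a\<^sub>1 \<otimes> a\<^sub>2 \<in> A \<otimes> H\<close>. Modulo \<open>K = HA\<^sup>+\<close> one may replace \<open>a\<^sub>1\<close> by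
  \<open>\<epsilon>(a\<^sub>1)\<close> after multiplication from the left, which proves that \<open>K\<close> is a coideal. For \<open>\<tau>(a) \<in> K\<close>,
  apply the involution to \<open>a\<^sub>1 S(a\<^sub>2) = 0\<close>: it gives \<open>\<tau>(a\<^sub>2) a\<^sub>1\<^sup>* = 0\<close>, whence
  \<open>\<tau>(a) = - \<tau>(a\<^sub>2) (a\<^sub>1\<^sup>* - \<epsilon>(a\<^sub>1\<^sup>*))\<close>.
\<close>

lemma left_ideal_quotient_kernel:
  assumes A: "star_coideal_algebra A"
  shows "quotient_kernel (left_ideal_of H A)"
proof -
  define K where "K = left_ideal_of H A"
  note K = left_ideal_of_subspace[of A, folded K_def]
  have mK: "h * x \<in> K" if "x \<in> K" for h x using left_ideal_of_mult[of x A h] that by (simp add: K_def)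
  have AD: "right_coideal A" "1 \<in> A" "\<And>x. x \<in> A \<Longrightarrow> st x \<in> A" and sA: "subspace A"
    using A by (auto simp: star_coideal_algebra_def right_coideal_def)
  have Aplus: "h * (a - \<epsilon> a \<cdot> 1) \<in> K" if "a \<in> A" for a h
    unfolding K_def using that AD(2) sA by (intro left_ideal_of_base counit_sub subspace_diff subspace_scale)
  have counit: "\<epsilon> x = 0" if "x \<in> K" for x
    using that unfolding K_def
    by (induction rule: left_ideal_of_induct) (auto simp: lin_simps counit_mult)
  have coideal: "comult H x (\<lambda>a b. \<phi> a * \<psi> b) = 0"
    if \<phi>: "lin \<phi>" "\<And>k. k \<in> K \<Longrightarrow> \<phi> k = 0" and \<psi>: "lin \<psi>" "\<And>k. k \<in> K \<Longrightarrow> \<psi> k = 0" and x: "x \<in> K" for \<phi> \<psi> x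
    using x unfolding K_def
  proof (induction rule: left_ideal_of_induct)
    case (mult h a)
    have "comult H a (\<lambda>c d. \<phi> (p * c) * \<psi> (q * d)) = 0" for p q
    proof -
      have l: "lin (\<lambda>c. \<phi> (p * c))" "lin (\<lambda>d. \<psi> (q * d))" using \<phi> \<psi> by auto
      obtain n :: nat and e \<chi> where e: "\<And>i. lin (\<chi> i)" "comult H a = (\<Sum>i<n. elem_tensor H H (R (\<chi> i) a) (e i))"
        by (rule comult_expansion[where x = a], rule that)
      have "\<phi> (p * c) = \<epsilon> c * \<phi> p" if "c \<in> A" for c
      proof (rule lin_kills[OF \<phi>(1)])
        show "p * c - \<epsilon> c \<cdot> p \<in> K" using Aplus[OF that, of p] by (simp add: right_diff_distrib)
      qed (rule \<phi>(2))
      then have "comult H a (\<lambda>c d. \<phi> (p * c) * \<psi> (q * d)) = (\<Sum>i<n. \<epsilon> (R (\<chi> i) a) * \<phi> p * \<psi> (q * e i))"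
        using comult_apply_elem_sum[OF bil_product[OF l] e(2)] right_coidealD(1)[OF AD(1) e(1) mult(1)] by simp
      also have "\<dots> = \<phi> p * (\<Sum>i<n. \<epsilon> (R (\<chi> i) a) * \<psi> (q * e i))" by (simp add: sum_distrib_left mult_ac)
      also have "(\<Sum>i<n. \<epsilon> (R (\<chi> i) a) * \<psi> (q * e i)) = \<psi> (q * a)"
        using comult_apply_elem_sum[OF bil_product[OF counit_lin l(2)] e(2)] comult_counit(1)[OF l(2), of a] by simp
      also have "\<psi> (q * a) = 0" using mult by (intro \<psi>(2)) (auto simp: K_def intro: left_ideal_of_base)
      finally show ?thesis by simp
    qed
    then show ?case by (simp add: comult_mult bil_product \<phi> \<psi>)
  qed (simp_all add: lin_simps[OF comult_lin])
  have tauA: "tau a \<in> K" if a: "a \<in> A" "\<epsilon> a = 0" for a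
  proof -
    obtain n :: nat and e \<chi> where e: "\<And>i. lin (\<chi> i)" "comult H a = (\<Sum>i<n. elem_tensor H H (R (\<chi> i) a) (e i))"
      "a = (\<Sum>i<n. \<epsilon> (R (\<chi> i) a) \<cdot> e i)"
      by (rule comult_expansion_counit[where x = a], rule that)
    define c where "c i = st (R (\<chi> i) a)" for i
    have cA: "c i \<in> A" for i unfolding c_def by (intro AD(3) right_coidealD(1)[OF AD(1) e(1) a(1)])
    have "st (\<Sum>i<n. R (\<chi> i) a * S (e i)) = 0" using antipode_sums(2)[OF e(2)] a(2) by simp
    then have 0: "(\<Sum>i<n. tau (e i) * c i) = 0" by (simp add: star_sum star_anti tau_def c_def)
    have "tau a = (\<Sum>i<n. cnj (\<epsilon> (R (\<chi> i) a)) \<cdot> tau (e i))"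
      by (subst e(3)) (simp add: tau_sum tau_linear)
    also have "\<dots> = (\<Sum>i<n. \<epsilon> (c i) \<cdot> tau (e i))" by (simp add: c_def star_anti)
    also have "\<dots> = - (\<Sum>i<n. tau (e i) * (c i - \<epsilon> (c i) \<cdot> 1))"
      using 0 by (simp add: right_diff_distrib sum_subtractf)
    also have "\<dots> \<in> K" using Aplus[OF cA] by (intro subspace_neg[OF K] subspace_sum[OF K])
    finally show ?thesis .
  qed
  have "tau x \<in> K" if "x \<in> K" for x
    using that unfolding K_def
  proof (induction rule: left_ideal_of_induct)
    case (mult h a)
    then show ?case using mK[OF tauA] by (simp add: tau_mult K_def)
  next
    case (add x y) then show ?case using subspace_add[OF K] by (simp add: tau_linear K_def)
  qed (use subspace_0[OF K] in \<open>auto simp: tau_linear K_def\<close>)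
  then show ?thesis
    unfolding K_def[symmetric] quotient_kernel_def using K mK counit coideal by auto
qed

lemma coinvD: "x \<in> coinv K \<Longrightarrow> lin \<psi> \<Longrightarrow> R \<psi> x - \<psi> x \<cdot> 1 \<in> K"
  unfolding coinv_def by blast

lemma coinv_sub_counit: "x \<in> coinv K \<Longrightarrow> x - \<epsilon> x \<cdot> 1 \<in> K"
  using coinvD[of x K \<epsilon>] by simp

lemma coinv_subspace: "subspace K \<Longrightarrow> subspace (coinv K)"
  unfolding coinv_def
proof (intro subspaceI; clarsimp)
  assume K: "subspace K"
  fix \<psi> assume \<psi>: "lin \<psi>"
  show "R \<psi> 0 - \<psi> 0 \<cdot> 1 \<in> K" using K by (simp add: LR_zero \<psi> lin_simps[OF \<psi>] subspace_0)
  show "R \<psi> (x + y) - \<psi> (x + y) \<cdot> 1 \<in> K"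
    if "\<forall>\<psi>. lin \<psi> \<longrightarrow> R \<psi> x - \<psi> x \<cdot> 1 \<in> K" "\<forall>\<psi>. lin \<psi> \<longrightarrow> R \<psi> y - \<psi> y \<cdot> 1 \<in> K" for x y
  proof -
    have "R \<psi> (x + y) - \<psi> (x + y) \<cdot> 1 = (R \<psi> x - \<psi> x \<cdot> 1) + (R \<psi> y - \<psi> y \<cdot> 1)"
      by (simp add: R_linear \<psi> lin_simps[OF \<psi>] scale_left_distrib)
    then show ?thesis using that \<psi> K by (simp add: subspace_add)
  qed
  show "R \<psi> (c \<cdot> x) - \<psi> (c \<cdot> x) \<cdot> 1 \<in> K" if "\<forall>\<psi>. lin \<psi> \<longrightarrow> R \<psi> x - \<psi> x \<cdot> 1 \<in> K" for c x
  proof -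
    have "R \<psi> (c \<cdot> x) - \<psi> (c \<cdot> x) \<cdot> 1 = c \<cdot> (R \<psi> x - \<psi> x \<cdot> 1)"
      by (simp add: R_linear \<psi> lin_simps[OF \<psi>] scale_right_diff_distrib)
    then show ?thesis using that \<psi> K by (simp add: subspace_scale)
  qed
qed

text \<open>
  Decompose a coinvariant \<open>x = a + y\<close> with \<open>a \<in> A\<close> and \<open>y \<bottom> A\<close>. The complement \<open>A\<^sup>\<bottom>\<close> is stable under
  \<open>R \<psi>\<close> and under right multiplication by \<open>A\<close>, so \<open>HA\<^sup>+ \<subseteq> A\<^sup>\<bottom> + A\<^sup>+\<close>. Since \<open>y\<close> is coinvariant too,
  \<open>\<psi>(y) 1\<close> is in \<open>A\<^sup>\<bottom> + A\<^sup>+\<close>. Thus there is \<open>c \<in> A\<^sup>+\<close> such that \<open>\<psi>(y) 1 + c\<close> is in \<open>A \<inter> A\<^sup>\<bottom> = 0\<close>, and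
  applying the counit gives \<open>\<psi>(y) = 0\<close>.
\<close>

lemma coinv_left_ideal:
  assumes A: "star_coideal_algebra A"
  shows "coinv (left_ideal_of H A) = A"
proof
  define K where "K = left_ideal_of H A"
  note K = left_ideal_of_subspace[of A, folded K_def]
  have AD: "right_coideal A" "1 \<in> A" "\<And>x. x \<in> A \<Longrightarrow> st x \<in> A" "\<And>x y. x \<in> A \<Longrightarrow> y \<in> A \<Longrightarrow> x * y \<in> A" and sA: "subspace A"
    using A by (auto simp: star_coideal_algebra_def right_coideal_def)
  show AK: "A \<subseteq> coinv (left_ideal_of H A)"
    unfolding K_def[symmetric]
  proof
    fix x assume x: "x \<in> A"
    have "R \<psi> x - \<psi> x \<cdot> 1 \<in> K" if \<psi>: "lin \<psi>" for \<psi>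
    proof -
      have "R \<psi> x \<in> A" by (rule right_coidealD(1)[OF AD(1) \<psi> x])
      then have "1 * (R \<psi> x - \<epsilon> (R \<psi> x) \<cdot> 1) \<in> K"
        unfolding K_def using sA AD(2) by (intro left_ideal_of_base counit_sub subspace_diff subspace_scale)
      then show ?thesis by (simp add: counit_LR \<psi>)
    qed
    then show "x \<in> coinv K" by (simp add: coinv_def)
  qed
  show "coinv (left_ideal_of H A) \<subseteq> A"
    unfolding K_def[symmetric]
  proof
    fix x assume x: "x \<in> coinv K"
    define perp where "perp y \<longleftrightarrow> (\<forall>b\<in>A. haar (y * b) = 0)" for y
    have perpI: "perp y" if "\<And>b. b \<in> A \<Longrightarrow> haar_form y b = 0" for y
      unfolding perp_def using that[OF AD(3)] by (simp add: haar_form_def star_anti)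
    obtain a where a: "a \<in> A" "\<And>b. b \<in> A \<Longrightarrow> haar_form (x - a) b = 0"
      by (rule coideal_decomposition[OF AD(1), of x], rule that)
    define y where "y = x - a"
    have y: "perp y" unfolding y_def by (rule perpI) (rule a(2))
    have yK: "y \<in> coinv K" unfolding y_def
      using x a(1) AK by (intro subspace_diff coinv_subspace K) (auto simp: K_def)
    have perp_R: "perp (R \<psi> y)" if \<psi>: "lin \<psi>" for \<psi>
      unfolding perp_def
    proof
      fix b assume b: "b \<in> A"
      define \<theta> where "\<theta> c = haar (y * c)" for c
      have \<theta>: "lin \<theta>" unfolding \<theta>_def by auto
      have "L \<theta> b = 0"
      proof (rule linear_forms_separate_points)
        fix \<chi> assume \<chi>: "lin \<chi>"
        have "\<theta> (R \<chi> b) = 0" using y right_coidealD(1)[OF AD(1) \<chi> b] by (simp add: perp_def \<theta>_def)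
        then show "\<chi> (L \<theta> b) = \<chi> 0" by (simp add: LR_swap \<theta> \<chi> lin_simps[OF \<chi>])
      qed
      then have "\<psi> (L (\<lambda>a. haar (a * b)) y) = 0"
        unfolding strong_invariance \<theta>_def[symmetric] by (simp add: lin_simps[OF \<psi>])
      then show "haar (R \<psi> y * b) = 0"
        using LR_swap[OF lin_comp(1)[OF haar_lin] \<psi>, of b y] by simp
    qed
    have dec: "\<exists>z c. k = z + c \<and> perp z \<and> c \<in> A \<and> \<epsilon> c = 0" if "k \<in> K" for k
      using that unfolding K_def
    proof (induction rule: left_ideal_of_induct)
      case zero
      show ?case by (intro exI[of _ 0]) (auto simp: perp_def lin_simps subspace_0[OF sA])
    next
      case (add k k')
      then obtain z c z' c' where "k = z + c" "perp z" "c \<in> A" "\<epsilon> c = 0" "k' = z' + c'" "perp z'" "c' \<in> A" "\<epsilon> c' = 0" by blast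
      then show ?case
        by (intro exI[of _ "z + z'"] exI[of _ "c + c'"])
          (auto simp: perp_def distrib_right lin_simps subspace_add[OF sA])
    next
      case (mult h b)
      obtain g where g: "g \<in> A" "\<And>b. b \<in> A \<Longrightarrow> haar_form (h - g) b = 0"
        by (rule coideal_decomposition[OF AD(1), of h], rule that)
      have "perp (h - g)" by (rule perpI) (rule g(2))
      then have "perp ((h - g) * b)" using mult(1) AD(4) by (simp add: perp_def mult.assoc)
      then show ?case using mult g(1) AD(4)
        by (intro exI[of _ "(h - g) * b"] exI[of _ "g * b"]) (auto simp: left_diff_distrib counit_mult)
    qed
    have "\<psi> y = 0" if \<psi>: "lin \<psi>" for \<psi>
    proof -
      have "R \<psi> y - \<psi> y \<cdot> 1 \<in> K" using yK \<psi> by (simp add: coinv_def)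
      then obtain z c where zc: "R \<psi> y - \<psi> y \<cdot> 1 = z + c" "perp z" "c \<in> A" "\<epsilon> c = 0" using dec by blast
      define w where "w = \<psi> y \<cdot> 1 + c"
      have wA: "w \<in> A" unfolding w_def using zc(3) AD(2) by (intro subspace_add[OF sA] subspace_scale[OF sA])
      have "w = R \<psi> y - z" unfolding w_def using zc(1) by (simp add: algebra_simps)
      then have "perp w" using perp_R[OF \<psi>] zc(2) by (simp add: perp_def left_diff_distrib lin_simps)
      then have "haar_form w w = 0" using AD(3)[OF wA] by (simp add: perp_def haar_form_def)
      then have "w = 0" by (rule haar_form_definite)
      then have "\<epsilon> w = 0" by (simp add: lin_simps)
      then show ?thesis using zc(4) by (simp add: w_def lin_simps counit_mult)
    qed
    then have "y = 0" by (intro linear_forms_separate_points) (simp add: lin_simps)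
    then show "x \<in> A" using a(1) by (simp add: y_def)
  qed
qed

text \<open>
  For products, \<open>x\<^sub>1 y\<^sub>1 \<otimes> x\<^sub>2 y\<^sub>2 \<equiv> x\<^sub>1 \<otimes> x\<^sub>2 y \<equiv> 1 \<otimes> x y\<close> because \<open>K\<close> is a left ideal. For the
  involution, \<open>S(c\<^sub>1) c\<^sub>2 = \<epsilon>(c)\<close> gives \<open>c\<^sub>2\<^sup>* \<tau>(c\<^sub>1) = cnj \<epsilon>(c)\<close>, and \<open>\<tau>(c\<^sub>1) \<equiv> cnj \<epsilon>(c\<^sub>1)\<close> because
  \<open>K\<close> is stable under \<open>\<tau>\<close>; so \<open>c\<^sup>* \<equiv> cnj \<epsilon>(c)\<close>. Apply this to \<open>c = R \<psi> b\<close>.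
\<close>

lemma coinv_star_coideal_algebra:
  assumes K: "quotient_kernel K"
  shows "star_coideal_algebra (coinv K)"
proof -
  note KD = quotient_kernelD[OF K]
  note sK = KD(1)
  have sA: "subspace (coinv K)" using sK by (rule coinv_subspace)
  have rc: "right_coideal (coinv K)"
    unfolding right_coideal_def
  proof (intro conjI allI impI sA)
    fix \<psi> x assume \<psi>: "lin \<psi>" and x: "x \<in> coinv K"
    show "R \<psi> x \<in> coinv K"
      unfolding coinv_def
    proof (intro CollectI allI impI)
      fix \<chi> assume \<chi>: "lin \<chi>"
      show "R \<chi> (R \<psi> x) - \<chi> (R \<psi> x) \<cdot> 1 \<in> K"
      proof -
        have "R (\<lambda>y. \<chi> (R \<psi> y)) x - \<chi> (R \<psi> x) \<cdot> 1 \<in> K"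
          by (rule coinvD[OF x R_lin[OF \<psi> \<chi>]])
        then show ?thesis by (simp add: R_R \<chi> \<psi>)
      qed
    qed
  qed
  have one: "1 \<in> coinv K" by (simp add: coinv_def LR_one subspace_0[OF sK])
  note sub_counit = coinv_sub_counit
  have mult: "x * y \<in> coinv K" if x: "x \<in> coinv K" and y: "y \<in> coinv K" for x y
    unfolding coinv_def
  proof (intro CollectI allI impI in_subspace_if_linear_forms[OF sK])
    fix \<psi> \<phi> assume \<psi>: "lin \<psi>" and \<phi>: "lin \<phi>" "\<And>k. k \<in> K \<Longrightarrow> \<phi> k = 0"
    have inner: "comult H y (\<lambda>c d. \<phi> (a * c) * \<psi> (b * d)) = \<phi> a * \<psi> (b * y)" for a b
    proof -
      have l: "lin (\<lambda>c. \<phi> (a * c))" "lin (\<lambda>d. \<psi> (b * d))" using \<phi> \<psi> by auto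
      have "comult H y (\<lambda>c d. \<phi> (a * c) * \<psi> (b * d)) = \<phi> (a * R (\<lambda>d. \<psi> (b * d)) y)"
        using R_apply[OF l(2,1)] by simp
      also have "\<dots> = \<psi> (b * y) * \<phi> a"
      proof (rule lin_kills[OF \<phi>(1)])
        have "R (\<lambda>d. \<psi> (b * d)) y - \<psi> (b * y) \<cdot> 1 \<in> K" by (rule coinvD[OF y l(2)])
        from KD(2)[OF this, of a] show "a * R (\<lambda>d. \<psi> (b * d)) y - \<psi> (b * y) \<cdot> a \<in> K" by (simp add: right_diff_distrib)
      qed (rule \<phi>(2))
      finally show ?thesis by simp
    qed
    have l: "lin (\<lambda>b. \<psi> (b * y))" using \<psi> by auto
    have "\<phi> (R \<psi> (x * y)) = comult H x (\<lambda>a b. \<phi> a * \<psi> (b * y))"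
      by (simp add: R_apply \<phi> \<psi> comult_mult bil_product inner)
    also have "\<dots> = \<phi> (R (\<lambda>b. \<psi> (b * y)) x)" using R_apply[OF l \<phi>(1)] by simp
    also have "\<dots> = \<psi> (x * y) * \<phi> 1"
    proof (rule lin_kills[OF \<phi>(1)])
      show "R (\<lambda>b. \<psi> (b * y)) x - \<psi> (x * y) \<cdot> 1 \<in> K" by (rule coinvD[OF x l])
    qed (rule \<phi>(2))
    finally show "\<phi> (R \<psi> (x * y) - \<psi> (x * y) \<cdot> 1) = 0" by (simp add: lin_simps[OF \<phi>(1)])
  qed
  have star1: "st c - cnj (\<epsilon> c) \<cdot> 1 \<in> K" if c: "c \<in> coinv K" for c
  proof -
    obtain n :: nat and e \<chi> where e: "\<And>i. lin (\<chi> i)" "comult H c = (\<Sum>i<n. elem_tensor H H (R (\<chi> i) c) (e i))"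
      "c = (\<Sum>i<n. \<epsilon> (R (\<chi> i) c) \<cdot> e i)"
      by (rule comult_expansion_counit[where x = c], rule that)
    have "st (\<Sum>i<n. S (R (\<chi> i) c) * e i) = cnj (\<epsilon> c) \<cdot> 1" using antipode_sums(1)[OF e(2)] by (simp add: star_anti)
    then have 1: "(\<Sum>i<n. st (e i) * tau (R (\<chi> i) c)) = cnj (\<epsilon> c) \<cdot> 1" by (simp add: star_sum star_anti tau_def)
    have 2: "st c = (\<Sum>i<n. cnj (\<epsilon> (R (\<chi> i) c)) \<cdot> st (e i))"
      by (subst e(3)) (simp add: star_sum star_anti)
    have "tau (R (\<chi> i) c - \<epsilon> (R (\<chi> i) c) \<cdot> 1) \<in> K" for i
      by (intro KD(4) sub_counit right_coidealD(1)[OF rc e(1) c])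
    moreover have "tau (x - b \<cdot> 1) = tau x - cnj b \<cdot> 1" for x b
      using tau_linear(1)[of "x - b \<cdot> 1" "b \<cdot> 1"] by (simp add: tau_linear(2) tau_1 algebra_simps)
    ultimately have "(\<Sum>i<n. st (e i) * (tau (R (\<chi> i) c) - cnj (\<epsilon> (R (\<chi> i) c)) \<cdot> 1)) \<in> K"
      by (intro subspace_sum[OF sK] KD(2)) simp
    then have "cnj (\<epsilon> c) \<cdot> 1 - st c \<in> K"
      by (simp add: right_diff_distrib sum_subtractf 1 2[symmetric])
    then show ?thesis using subspace_neg[OF sK] by fastforce
  qed
  have "st b \<in> coinv K" if b: "b \<in> coinv K" for b
    unfolding coinv_def
  proof (intro CollectI allI impI)
    fix \<psi> assume \<psi>: "lin \<psi>"
    note l = lin_comp(4)[OF \<psi>]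
    have "st (R (\<lambda>a. cnj (\<psi> (st a))) b) - cnj (\<epsilon> (R (\<lambda>a. cnj (\<psi> (st a))) b)) \<cdot> 1 \<in> K"
      by (intro star1 right_coidealD(1)[OF rc l b])
    then show "R \<psi> (st b) - \<psi> (st b) \<cdot> 1 \<in> K"
      by (simp add: counit_LR l R_star[OF \<psi>])
  qed
  then show ?thesis using rc one mult by (simp add: star_coideal_algebra_def)
qed

text \<open>
  Start with an orthonormal basis of \<open>V \<inter> K\<close>. If a form \<open>\<chi>\<close> vanishes on \<open>K\<close> and \<open>k \<in> V \<inter> K\<close>, then
  \<open>R \<chi> k\<close> is in \<open>V \<inter> K\<close> and therefore orthogonal to the remaining basis vectors \<open>e\<^sub>i\<close>; so \<open>\<chi>\<close> kills
  \<open>L (\<cdot>,e\<^sub>i) k\<close>.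
\<close>

lemma adapted_orthonormal_basis:
  assumes K: "quotient_kernel K" and rc: "right_coideal V" and V: "findim V"
  obtains s r n e where "compatible s V" "r \<le> n" "orthonormal s n e" "\<And>i. i < n \<Longrightarrow> e i \<in> V"
    "\<And>v. v \<in> V \<Longrightarrow> v = (\<Sum>i<n. s v (e i) \<cdot> e i)" "\<And>i. i < r \<Longrightarrow> e i \<in> K"
    "\<And>k. k \<in> V \<Longrightarrow> k \<in> K \<Longrightarrow> k = (\<Sum>i<r. s k (e i) \<cdot> e i)"
    "\<And>k i. k \<in> V \<Longrightarrow> k \<in> K \<Longrightarrow> r \<le> i \<Longrightarrow> i < n \<Longrightarrow> L (\<lambda>a. s a (e i)) k \<in> K"
proof -
  note KD = quotient_kernelD[OF K]
  note sK = KD(1)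
  define N where "N = V \<inter> K"
  have fN: "findim N"
    unfolding N_def by (rule findim_subset[OF V subspace_inter[OF right_coidealD(2)[OF rc] sK]]) simp
  obtain s where s: "compatible s V" by (rule compatible_form[OF rc V])
  have h: "hermitian s" "positive_on s V" using s by (simp_all add: compatible_def)
  have hN: "positive_on s N" using h(2) by (auto simp: positive_on_def N_def)
  obtain r e0 where e0: "orthonormal s r e0" "\<And>i. i < r \<Longrightarrow> e0 i \<in> N" "\<And>v. v \<in> N \<Longrightarrow> v = (\<Sum>i<r. s v (e0 i) \<cdot> e0 i)"
    by (rule orthonormal_basis[OF fN h(1) hN], rule that)
  obtain n e where e: "r \<le> n" "\<And>i. i < r \<Longrightarrow> e i = e0 i" "orthonormal s n e"
    "\<And>i. i < n \<Longrightarrow> e i \<in> V" "\<And>v. v \<in> V \<Longrightarrow> v = (\<Sum>i<n. s v (e i) \<cdot> e i)"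
    by (rule orthonormal_basis_extension[OF V h e0(1)], use e0(2) N_def in blast, rule that)
  have eK: "e i \<in> K" if "i < r" for i using e0(2)[OF that] e(2)[OF that] by (simp add: N_def)
  have expN: "k = (\<Sum>i<r. s k (e i) \<cdot> e i)" if "k \<in> V" "k \<in> K" for k
    using e0(3)[of k] that e(2) by (simp add: N_def)
  have "L (\<lambda>a. s a (e i)) k \<in> K" if k: "k \<in> V" "k \<in> K" and i: "r \<le> i" "i < n" for k i
  proof (rule in_subspace_if_linear_forms[OF sK])
    fix \<chi> assume \<chi>: "lin \<chi>" "\<And>k. k \<in> K \<Longrightarrow> \<chi> k = 0"
    have "R \<chi> k = (\<Sum>j<r. s (R \<chi> k) (e j) \<cdot> e j)"
      by (rule expN[OF right_coidealD(1)[OF rc \<chi>(1) k(1)] KD(5)[OF \<chi> k(2)]])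
    then have "s (R \<chi> k) (e i) = s (\<Sum>j<r. s (R \<chi> k) (e j) \<cdot> e j) (e i)" by simp
    also have "\<dots> = (\<Sum>j<r. s (R \<chi> k) (e j) * s (e j) (e i))" by (simp add: hermitian_simps(5,2)[OF h(1)])
    also have "\<dots> = 0" using e(1,3) i by (intro sum.neutral) (auto simp: orthonormal_def)
    finally show "\<chi> (L (\<lambda>a. s a (e i)) k) = 0" by (simp add: LR_swap[OF hermitian_lin[OF h(1)] \<chi>(1)])
  qed
  then show thesis using that[OF s e(1,3,4,5) eK expN] by blast
qed

text \<open>
  Let \<open>u\<close> be the unitary matrix of an orthonormal basis \<open>e\<close> of a finite-dimensional subcoalgebra
  \<open>V\<close>, adapted to \<open>K\<close>. Modulo \<open>K\<close> it is block diagonal, so \<open>a\<^sub>j\<^sub>l = \<Sum>\<^sub>i\<^sub><\<^sub>r u\<^sub>i\<^sub>j\<^sup>* u\<^sub>i\<^sub>l\<close> is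
  coinvariant, with \<open>\<epsilon>(a\<^sub>j\<^sub>l) = \<delta>\<^sub>j\<^sub>l\<close> for \<open>l < r\<close>. For \<open>m \<ge> r\<close> unitarity gives \<open>\<Sum>\<^sub>j u\<^sub>m\<^sub>j a\<^sub>j\<^sub>l = 0\<close>,
  so \<open>u\<^sub>m\<^sub>l = - \<Sum>\<^sub>j u\<^sub>m\<^sub>j (a\<^sub>j\<^sub>l - \<epsilon>(a\<^sub>j\<^sub>l))\<close> is in the left ideal, and so is
  \<open>e\<^sub>l = \<Sum>\<^sub>m \<epsilon>(e\<^sub>m) u\<^sub>m\<^sub>l\<close>, as \<open>\<epsilon>(e\<^sub>m) = 0\<close> for \<open>m < r\<close>.
\<close>

lemma left_ideal_coinv:
  assumes K: "quotient_kernel K"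
  shows "left_ideal_of H (coinv K) = K"
proof
  note KD = quotient_kernelD[OF K]
  note sK = KD(1)
  define A where "A = coinv K"
  have A: "star_coideal_algebra A" unfolding A_def by (rule coinv_star_coideal_algebra[OF K])
  then have sA: "subspace A" and oneA: "1 \<in> A" by (auto simp: star_coideal_algebra_def right_coideal_def)
  note sub_counit = coinv_sub_counit[of _ K, folded A_def]
  show "left_ideal_of H (coinv K) \<subseteq> K"
    unfolding A_def[symmetric]
  proof
    fix x assume "x \<in> left_ideal_of H A"
    then show "x \<in> K"
    proof (induction rule: left_ideal_of_induct)
      case (mult h a)
      then show ?case using sub_counit[of a] by (intro KD(2)) simp
    qed (auto intro: subspace_add[OF sK] subspace_0[OF sK])
  qed
  define I where "I = left_ideal_of H A"
  have sI: "subspace I" unfolding I_def by (rule left_ideal_of_subspace)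
  show "K \<subseteq> left_ideal_of H (coinv K)"
    unfolding A_def[symmetric] I_def[symmetric]
  proof
    fix k assume k: "k \<in> K"
    obtain V where V: "findim V" "subcoalgebra V" "k \<in> V" by (rule finite_subcoalgebra)
    have rc: "right_coideal V" using V by (simp add: subcoalgebra_def)
    obtain s r n e where s: "compatible s V" and e: "r \<le> n" "orthonormal s n e" "\<And>i. i < n \<Longrightarrow> e i \<in> V"
      "\<And>v. v \<in> V \<Longrightarrow> v = (\<Sum>i<n. s v (e i) \<cdot> e i)" "\<And>i. i < r \<Longrightarrow> e i \<in> K"
      "\<And>k. k \<in> V \<Longrightarrow> k \<in> K \<Longrightarrow> k = (\<Sum>i<r. s k (e i) \<cdot> e i)"
      "\<And>k i. k \<in> V \<Longrightarrow> k \<in> K \<Longrightarrow> r \<le> i \<Longrightarrow> i < n \<Longrightarrow> L (\<lambda>a. s a (e i)) k \<in> K"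
      by (rule adapted_orthonormal_basis[OF K rc V(1)], rule that)
    define u where "u i j = L (\<lambda>a. s a (e i)) (e j)" for i j
    have u: "unitary n u" and eu: "\<And>j. j < n \<Longrightarrow> e j = (\<Sum>i<n. \<epsilon> (e i) \<cdot> u i j)"
      unfolding u_def by (rule unitary_of_orthonormal_basis[OF rc s e(2,3,4)]; assumption)+
    have cu: "corep n u" and tu: "\<And>i j. i < n \<Longrightarrow> j < n \<Longrightarrow> tau (u i j) = u j i" using u by (auto simp: unitary_def)
    \<comment> \<open>Modulo \<open>K\<close> the matrix is block diagonal.\<close>
    have uK: "u i j \<in> K" if "r \<le> i" "i < n" "j < r" for i j
      unfolding u_def using e(1) that by (intro e(7) e(3,5)) auto
    have uK': "u i j \<in> K" if "r \<le> j" "j < n" "i < r" for i j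
      using KD(4)[OF uK[OF that]] tu[of j i] that e(1) by simp
    define a where "a j l = (\<Sum>i<r. st (u i j) * u i l)" for j l
    have aA: "a j l \<in> A" if jl: "j < n" "l < n" for j l
      unfolding A_def coinv_def
    proof (intro CollectI allI impI in_subspace_if_linear_forms[OF sK])
      fix \<psi> \<phi> assume \<psi>: "lin \<psi>" and \<phi>: "lin \<phi>" "\<And>k. k \<in> K \<Longrightarrow> \<phi> k = 0"
      have block: "(\<Sum>i<r. \<phi> (st (u i k) * u i q)) = (if k = q \<and> q < r then \<phi> 1 else 0)" if kq: "k < n" "q < n" for k q
      proof (cases "q < r")
        case False
        then show ?thesis using kq uK'[of q] KD(2) by (auto intro!: sum.neutral \<phi>(2))
      next
        case True
        have "(\<Sum>i<n. \<phi> (st (u i k) * u i q)) = (\<Sum>i<r. \<phi> (st (u i k) * u i q))"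
          using e(1) uK[OF _ _ True] KD(2) by (intro sum.mono_neutral_right) (auto intro!: \<phi>(2))
        moreover have "(\<Sum>i<n. \<phi> (st (u i k) * u i q)) = \<phi> (if k = q then 1 else 0)"
          using unitary_relations(2)[OF u kq] by (simp flip: lin_simps(6)[OF \<phi>(1)])
        ultimately have "(\<Sum>i<r. \<phi> (st (u i k) * u i q)) = \<phi> (if k = q then 1 else 0)" by simp
        also have "\<dots> = (if k = q \<and> q < r then \<phi> 1 else 0)" using True by (simp add: lin_simps(3)[OF \<phi>(1)])
        finally show ?thesis .
      qed
      have cs: "corep n (\<lambda>i j. st (u i j))" by (rule corep_star[OF cu])
      have bl: "bil (\<lambda>c d. \<phi> (x * c) * \<psi> (y * d))" "bil (\<lambda>c d. \<phi> (c * x) * \<psi> (d * y))" for x y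
        using \<phi> \<psi> by (auto intro!: bil_product)
      have bs: "bil (\<lambda>x y. \<Sum>q<n. \<phi> (x * u i q) * \<psi> (y * u q l))" for i
        using bl(2) by (auto simp: bil_iff intro!: lin_sum)
      have "\<phi> (R \<psi> (a j l)) = (\<Sum>i<r. comult H (st (u i j) * u i l) (\<lambda>c d. \<phi> c * \<psi> d))"
        by (simp add: R_apply \<phi> \<psi> a_def lin_simps(6)[OF comult_lin])
      also have "\<dots> = (\<Sum>i<r. \<Sum>k<n. \<Sum>q<n. \<phi> (st (u i k) * u i q) * \<psi> (st (u k j) * u q l))"
      proof (rule sum.cong[OF refl])
        fix i assume "i \<in> {..<r}"
        then have i: "i < n" using e(1) by simp
        have "comult H (st (u i j) * u i l) (\<lambda>c d. \<phi> c * \<psi> d) =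
            comult H (st (u i j)) (\<lambda>x y. \<Sum>q<n. \<phi> (x * u i q) * \<psi> (y * u q l))"
          unfolding comult_mult[OF bil_product[OF \<phi>(1) \<psi>]] using corep_comult[OF cu bl(1) i jl(2)] by simp
        also have "\<dots> = (\<Sum>k<n. \<Sum>q<n. \<phi> (st (u i k) * u i q) * \<psi> (st (u k j) * u q l))"
          by (rule corep_comult[OF cs bs i jl(1)])
        finally show "comult H (st (u i j) * u i l) (\<lambda>c d. \<phi> c * \<psi> d) =
            (\<Sum>k<n. \<Sum>q<n. \<phi> (st (u i k) * u i q) * \<psi> (st (u k j) * u q l))" .
      qed
      also have "\<dots> = (\<Sum>k<n. \<Sum>i<r. \<Sum>q<n. \<phi> (st (u i k) * u i q) * \<psi> (st (u k j) * u q l))"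
        by (rule sum.swap)
      also have "\<dots> = (\<Sum>k<n. \<Sum>q<n. \<Sum>i<r. \<phi> (st (u i k) * u i q) * \<psi> (st (u k j) * u q l))"
        by (intro sum.cong refl sum.swap)
      also have "\<dots> = (\<Sum>k<n. \<Sum>q<n. if k = q then (if k < r then \<phi> 1 * \<psi> (st (u k j) * u k l) else 0) else 0)"
        by (intro sum.cong refl) (auto simp: block simp flip: sum_distrib_right)
      also have "\<dots> = (\<Sum>k<n. if k < r then \<phi> 1 * \<psi> (st (u k j) * u k l) else 0)" by simp
      also have "\<dots> = (\<Sum>k<r. \<phi> 1 * \<psi> (st (u k j) * u k l))"
        using e(1) by (intro sum.mono_neutral_cong_right) auto
      also have "\<dots> = \<phi> (\<psi> (a j l) \<cdot> 1)" by (simp add: a_def lin_simps[OF \<psi>] lin_simps[OF \<phi>(1)] sum_distrib_left mult.commute)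
      finally show "\<phi> (R \<psi> (a j l) - \<psi> (a j l) \<cdot> 1) = 0" by (simp add: lin_simps[OF \<phi>(1)])
    qed
    have uI: "u m l \<in> I" if m: "r \<le> m" "m < n" and l: "l < r" for m l
    proof -
      have ln: "l < n" using l e(1) by simp
      have eps: "\<epsilon> (a j l) = (if j = l then 1 else 0)" if "j < n" for j
      proof -
        have "\<epsilon> (a j l) = (\<Sum>i<r. if i = l then (if j = l then 1 else 0) else 0)"
          unfolding a_def lin_simps(6)[OF counit_lin] using cu that ln e(1)
          by (intro sum.cong refl) (auto simp: counit_mult star_anti corep_def)
        then show ?thesis using l by simp
      qed
      have "(\<Sum>j<n. u m j * a j l) = (\<Sum>j<n. \<Sum>i<r. u m j * st (u i j) * u i l)"
        by (simp add: a_def sum_distrib_left mult.assoc)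
      also have "\<dots> = (\<Sum>i<r. (\<Sum>j<n. u m j * st (u i j)) * u i l)"
        by (subst sum.swap) (simp add: sum_distrib_right)
      also have "\<dots> = 0"
        using m e(1) by (intro sum.neutral ballI) (simp add: unitary_relations(1)[OF u])
      finally have 1: "(\<Sum>j<n. u m j * a j l) = 0" .
      have "(\<Sum>j<n. u m j * (a j l - \<epsilon> (a j l) \<cdot> 1)) = (\<Sum>j<n. u m j * a j l) - (\<Sum>j<n. if j = l then u m l else 0)"
        unfolding sum_subtractf[symmetric] by (intro sum.cong refl) (auto simp: eps right_diff_distrib)
      also have "\<dots> = - u m l" using ln by (simp add: 1)
      finally have 2: "u m l = - (\<Sum>j<n. u m j * (a j l - \<epsilon> (a j l) \<cdot> 1))" by simp
      have "u m j * (a j l - \<epsilon> (a j l) \<cdot> 1) \<in> I" if "j < n" for j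
        unfolding I_def using aA[OF that ln] oneA
        by (intro left_ideal_of_base counit_sub subspace_diff[OF sA] subspace_scale[OF sA])
      then show ?thesis by (subst 2) (auto intro!: subspace_neg[OF sI] subspace_sum[OF sI])
    qed
    have "e l \<in> I" if l: "l < r" for l
    proof -
      have "\<epsilon> (e m) = 0" if "m < r" for m using e(5)[OF that] KD(3) by simp
      then have "\<epsilon> (e m) \<cdot> u m l \<in> I" if "m < n" for m
        using uI[OF _ that l] subspace_scale[OF sI] subspace_0[OF sI] by (cases "m < r") auto
      then have "(\<Sum>m<n. \<epsilon> (e m) \<cdot> u m l) \<in> I" by (intro subspace_sum[OF sI]) simp
      then show ?thesis using eu[of l] l e(1) by simp
    qed
    then have "(\<Sum>i<r. s k (e i) \<cdot> e i) \<in> I" by (intro subspace_sum[OF sI] subspace_scale[OF sI]) simp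
    then show "k \<in> I" using e(6)[OF V(3) k] by simp
  qed
qed

end

context cqg
begin

section \<open>Quotient coalgebras and their kernels\<close>

lemma linear_between_zero:
  assumes "cvector_space V" "cvector_space W" "linear_between V W f"
  shows "f \<zero>\<^bsub>V\<^esub> = \<zero>\<^bsub>W\<^esub>"
proof -
  have "f (0 \<odot>\<^bsub>V\<^esub> \<zero>\<^bsub>V\<^esub>) = 0 \<odot>\<^bsub>W\<^esub> f \<zero>\<^bsub>V\<^esub>" "f \<zero>\<^bsub>V\<^esub> \<in> carrier W"
    using assms cspace_closed(3)[OF assms(1)] by (auto simp: linear_between_def)
  then show ?thesis
    using cspace_smult_zero[OF assms(1) cspace_closed(3)[OF assms(1)]] cspace_smult_zero[OF assms(2)] by simp
qed

lemma projection_eq_iff: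
  assumes C: "cvector_space C" and \<pi>: "linear_between H C \<pi>"
  shows "\<pi> x = \<pi> y \<longleftrightarrow> \<pi> (x - y) = \<zero>\<^bsub>C\<^esub>"
proof -
  interpret C: Module.module complex_ring C by (rule C)
  have add: "\<pi> (a + b) = \<pi> a \<oplus>\<^bsub>C\<^esub> \<pi> b" and cl: "\<pi> a \<in> carrier C" for a b
    using \<pi> by (auto simp: linear_between_def)
  have z: "\<pi> 0 = \<zero>\<^bsub>C\<^esub>" using linear_between_zero[OF cspace_H C \<pi>] by simp
  show ?thesis
  proof
    assume "\<pi> x = \<pi> y"
    then have "\<pi> (x - y) = \<pi> y \<oplus>\<^bsub>C\<^esub> \<pi> (- y)" using add[of x "- y"] by simp
    then show "\<pi> (x - y) = \<zero>\<^bsub>C\<^esub>" using add[of y "- y"] z by simp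
  next
    assume "\<pi> (x - y) = \<zero>\<^bsub>C\<^esub>"
    then show "\<pi> x = \<pi> y" using add[of "x - y" y] cl C.l_zero by simp
  qed
qed

text \<open>
  With this, forms on \<open>C\<close> and forms on \<open>H\<close> that vanish on the kernel are interchangeable.
\<close>

lemma descend_linear_form:
  assumes C: "cvector_space C" and \<pi>: "linear_between H C \<pi>" "range \<pi> = carrier C"
    and \<phi>: "lin \<phi>" "\<And>k. \<pi> k = \<zero>\<^bsub>C\<^esub> \<Longrightarrow> \<phi> k = 0"
  obtains \<phi>' where "linear_form C \<phi>'" "\<And>x. \<phi>' (\<pi> x) = \<phi> x"
proof -
  define \<phi>' where "\<phi>' c = \<phi> (SOME x. \<pi> x = c)" for c
  have ap: "\<phi>' (\<pi> x) = \<phi> x" for x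
  proof -
    have "\<pi> (SOME y. \<pi> y = \<pi> x) = \<pi> x" by (rule someI[of "\<lambda>y. \<pi> y = \<pi> x"]) simp
    then have "\<phi> ((SOME y. \<pi> y = \<pi> x) - x) = 0" using projection_eq_iff[OF C \<pi>(1)] \<phi>(2) by blast
    then show ?thesis by (simp add: \<phi>'_def lin_simps[OF \<phi>(1)])
  qed
  have "\<phi>' (c \<oplus>\<^bsub>C\<^esub> d) = \<phi>' c + \<phi>' d" "\<phi>' (a \<odot>\<^bsub>C\<^esub> c) = a * \<phi>' c"
    if cd: "c \<in> carrier C" "d \<in> carrier C" for a c d
  proof -
    obtain x y where xy: "c = \<pi> x" "d = \<pi> y" using cd \<pi>(2) by blast
    have "\<pi> (x + y) = c \<oplus>\<^bsub>C\<^esub> d" "\<pi> (a \<cdot> x) = a \<odot>\<^bsub>C\<^esub> c" using \<pi>(1) by (auto simp: xy linear_between_def)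
    then show "\<phi>' (c \<oplus>\<^bsub>C\<^esub> d) = \<phi>' c + \<phi>' d" "\<phi>' (a \<odot>\<^bsub>C\<^esub> c) = a * \<phi>' c"
      using ap lin_simps[OF \<phi>(1)] xy by metis+
  qed
  then have "linear_form C \<phi>'" unfolding linear_form_iff by blast
  then show thesis using that ap by blast
qed

lemma linear_form_comp: "linear_form C \<phi> \<Longrightarrow> linear_between H C \<pi> \<Longrightarrow> lin (\<lambda>x. \<phi> (\<pi> x))"
  by (auto simp: linear_form_iff linear_between_def lin_def Pi_iff)

text \<open>
  All axioms of the quotient are evaluated at forms on \<open>C\<close>. For the inclusion of \<open>coinv K\<close> in the
  coinvariants, the first legs of \<open>\<Delta>(x) = \<Sum> R \<chi>\<^sub>i x \<otimes> e\<^sub>i\<close> may be replaced by the scalars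
  \<open>\<chi>\<^sub>i(x) = \<epsilon>(R \<chi>\<^sub>i x)\<close> modulo \<open>K\<close>.
\<close>

lemma kernel_of_quotient:
  fixes C :: "('h, 'c) module_star_coalgebra"
  assumes q: "quotient_left_module_star_coalgebra H C \<pi>"
  defines "K \<equiv> a_kernel H C \<pi>"
  shows "quotient_kernel K" "coinvariants H C \<pi> = coinv K"
proof -
  have lm: "left_module_coalgebra H C" and rng: "range \<pi> = carrier C" and cm: "coalgebra_map H C \<pi>"
    and mod: "\<And>h x. \<pi> (h * x) = act C h (\<pi> x)" and sc: "star_coalgebra C"
    and cs: "\<And>x. \<pi> (st (S x)) = costar C (\<pi> x)"
    using q by (auto simp: quotient_left_module_star_coalgebra_def quotient_left_module_coalgebra_def)
  have co: "is_coalgebra C" using lm by (simp add: left_module_coalgebra_def)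
  then have C: "cvector_space C" and dl: "linear_between C (tensor_space C C) (comult C)" and cl: "linear_form C (counit C)"
    by (auto simp: is_coalgebra_def)
  have \<pi>: "linear_between H C \<pi>" using cm by (simp add: coalgebra_map_def)
  have \<pi>C: "\<pi> x \<in> carrier C" for x using rng by blast
  have K_iff: "x \<in> K \<longleftrightarrow> \<pi> x = \<zero>\<^bsub>C\<^esub>" for x
    by (simp add: K_def a_kernel_def kernel_def)
  have \<pi>0: "\<pi> 0 = \<zero>\<^bsub>C\<^esub>" using linear_between_zero[OF cspace_H C \<pi>] by simp
  have sK: "subspace K"
  proof (rule subspaceI)
    show "0 \<in> K" by (simp add: K_iff \<pi>0)
    have ps: "\<pi> (x + y) = \<pi> x \<oplus>\<^bsub>C\<^esub> \<pi> y" "\<pi> (c \<cdot> x) = c \<odot>\<^bsub>C\<^esub> \<pi> x" for x y c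
      using \<pi> by (auto simp: linear_between_def)
    show "x + y \<in> K" if "x \<in> K" "y \<in> K" for x y
      using that ps(1)[of x y] ps(1)[of 0 0] by (simp add: K_iff \<pi>0)
    show "c \<cdot> x \<in> K" if "x \<in> K" for c x
      using that ps(2)[of c x] ps(2)[of c 0] by (simp add: K_iff \<pi>0)
  qed
  have comult: "comult C (\<pi> x) \<beta> = comult H x (\<lambda>a b. \<beta> (\<pi> a) (\<pi> b))" if "bilinear_form C C \<beta>" for x \<beta>
    using cm that by (simp add: coalgebra_map_def tensor_map_apply[OF comult_tens' \<pi> \<pi>])
  have desc: "\<exists>\<phi>'. linear_form C \<phi>' \<and> (\<forall>x. \<phi>' (\<pi> x) = \<phi> x)" if "lin \<phi>" "\<And>k. k \<in> K \<Longrightarrow> \<phi> k = 0" for \<phi>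
    by (rule descend_linear_form[OF C \<pi> rng that(1)]) (use that(2) K_iff in blast)+
  show "quotient_kernel K"
    unfolding quotient_kernel_def
  proof (intro conjI allI impI ballI)
    show "subspace K" by (rule sK)
    show "h * x \<in> K" if "x \<in> K" for h x
    proof -
      have "linear_between C C (act C h)" using lm by (simp add: left_module_coalgebra_def)
      from linear_between_zero[OF C C this] show ?thesis using that by (simp add: K_iff mod)
    qed
    show "\<epsilon> x = 0" if "x \<in> K" for x
    proof -
      have "\<epsilon> x = counit C (\<pi> x)" using cm by (simp add: coalgebra_map_def)
      also have "\<dots> = counit C (\<pi> 0)" using that by (simp add: K_iff \<pi>0)
      also have "\<dots> = 0" using cm lin_simps(3)[OF counit_lin] by (simp add: coalgebra_map_def)
      finally show ?thesis .
    qed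
    show "tau x \<in> K" if "x \<in> K" for x
    proof -
      have "\<pi> (tau x) = costar C (\<pi> 0)" using that by (simp add: tau_def cs K_iff \<pi>0)
      also have "\<dots> = \<pi> (tau 0)" by (simp only: tau_def cs)
      finally have "\<pi> (tau x) = \<pi> (tau 0)" .
      then show ?thesis by (simp add: K_iff tau_linear \<pi>0)
    qed
    fix \<phi> \<psi> x assume \<phi>: "lin \<phi>" and \<psi>: "lin \<psi>" and kill: "\<forall>k\<in>K. \<phi> k = 0 \<and> \<psi> k = 0" and x: "x \<in> K"
    obtain \<phi>' where \<phi>': "linear_form C \<phi>'" "\<And>x. \<phi>' (\<pi> x) = \<phi> x" using desc[OF \<phi>] kill by blast
    obtain \<psi>' where \<psi>': "linear_form C \<psi>'" "\<And>x. \<psi>' (\<pi> x) = \<psi> x" using desc[OF \<psi>] kill by blast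
    have b: "bilinear_form C C (\<lambda>a b. \<phi>' a * \<psi>' b)"
      using \<phi>'(1) \<psi>'(1) by (auto simp: bilinear_form_iff linear_form_iff algebra_simps)
    have "comult H x (\<lambda>a b. \<phi> a * \<psi> b) = comult C (\<pi> x) (\<lambda>a b. \<phi>' a * \<psi>' b)"
      by (simp add: comult[OF b] \<phi>' \<psi>')
    also have "\<pi> x = \<pi> 0" using x by (simp add: K_iff \<pi>0)
    also have "comult C (\<pi> 0) (\<lambda>a b. \<phi>' a * \<psi>' b) = 0"
      unfolding comult[OF b] by (rule lin_simps(3)[OF comult_lin])
    finally show "comult H x (\<lambda>a b. \<phi> a * \<psi> b) = 0" .
  qed
  have mem: "tensor_map H H C H \<pi> id (comult H x) \<in> tens C H" "elem_tensor C H (\<pi> 1) x \<in> tens C H" for x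
    using tensor_map_in[OF comult_tens' \<pi> linear_between_id] \<pi>C by (auto intro!: elem_tensor_in_subtensor)
  show "coinvariants H C \<pi> = coinv K"
  proof (intro subset_antisym subsetI)
    fix x assume "x \<in> coinvariants H C \<pi>"
    then have eq: "tensor_map H H C H \<pi> id (comult H x) = elem_tensor C H (\<pi> 1) x" by (simp add: coinvariants_def)
    show "x \<in> coinv K"
      unfolding coinv_def
    proof (intro CollectI allI impI in_subspace_if_linear_forms[OF sK])
      fix \<psi> \<phi> assume \<psi>: "lin \<psi>" and \<phi>: "lin \<phi>" "\<And>k. k \<in> K \<Longrightarrow> \<phi> k = 0"
      obtain \<phi>' where \<phi>': "linear_form C \<phi>'" "\<And>x. \<phi>' (\<pi> x) = \<phi> x" using desc[OF \<phi>] by blast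
      have b: "bilinear_form C H (\<lambda>a b. \<phi>' a * \<psi> b)"
        using \<phi>'(1) lin_simps[OF \<psi>] by (auto simp: bilinear_form_iff linear_form_iff algebra_simps)
      have "\<phi> (R \<psi> x) = \<phi> 1 * \<psi> x"
        using fun_cong[OF eq, of "\<lambda>a b. \<phi>' a * \<psi> b"] b
        by (simp add: tensor_map_apply[OF comult_tens' \<pi> linear_between_id] elem_tensor_apply \<phi>'(2) R_apply \<psi> \<phi>(1))
      then show "\<phi> (R \<psi> x - \<psi> x \<cdot> 1) = 0" by (simp add: lin_simps[OF \<phi>(1)])
    qed
  next
    fix x assume x: "x \<in> coinv K"
    have "tensor_map H H C H \<pi> id (comult H x) = elem_tensor C H (\<pi> 1) x"
    proof (rule tensor_eqI[OF mem])
      fix \<beta> assume b: "bilinear_form C H \<beta>"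
      have bl: "bil (\<lambda>a h. \<beta> (\<pi> a) h)" by (rule bilinear_form_comp(1)[OF b \<pi>])
      obtain n :: nat and e \<chi> where e: "\<And>i. lin (\<chi> i)" "comult H x = (\<Sum>i<n. elem_tensor H H (R (\<chi> i) x) (e i))"
        "x = (\<Sum>i<n. \<epsilon> (R (\<chi> i) x) \<cdot> e i)"
        by (rule comult_expansion_counit[where x = x], rule that)
      have l: "lin (\<lambda>h. \<beta> (\<pi> a) h)" "lin (\<lambda>a. \<beta> (\<pi> a) h)" for a h using bl by (auto simp: bil_iff)
      have \<pi>R: "\<pi> (R (\<chi> i) x) = \<pi> (\<chi> i x \<cdot> 1)" for i
        using coinvD[OF x e(1)] unfolding projection_eq_iff[OF C \<pi>] K_iff .
      have "tensor_map H H C H \<pi> id (comult H x) \<beta> = comult H x (\<lambda>a h. \<beta> (\<pi> a) h)"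
        using b by (simp add: tensor_map_apply[OF comult_tens' \<pi> linear_between_id])
      also have "\<dots> = (\<Sum>i<n. \<beta> (\<pi> (R (\<chi> i) x)) (e i))" by (rule comult_apply_elem_sum[OF bl e(2)])
      also have "\<dots> = (\<Sum>i<n. \<epsilon> (R (\<chi> i) x) * \<beta> (\<pi> 1) (e i))"
        by (simp add: \<pi>R lin_simps(2)[OF l(2)] counit_LR e(1))
      also have "\<dots> = \<beta> (\<pi> 1) (\<Sum>i<n. \<epsilon> (R (\<chi> i) x) \<cdot> e i)" by (simp add: lin_simps(6,2)[OF l(1)])
      also have "\<dots> = \<beta> (\<pi> 1) x" by (simp only: e(3)[symmetric])
      also have "\<dots> = elem_tensor C H (\<pi> 1) x \<beta>" using b by (simp add: elem_tensor_apply)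
      finally show "tensor_map H H C H \<pi> id (comult H x) \<beta> = elem_tensor C H (\<pi> 1) x \<beta>" .
    qed
    then show "x \<in> coinvariants H C \<pi>" by (simp add: coinvariants_def)
  qed
qed

text \<open>
  Every element of \<open>C\<close> is of the form \<open>\<pi> x\<close> and every form on \<open>C\<close> pulls back to \<open>H\<close>, so each axiom of
  \<open>C\<close> is the pulled back axiom of \<open>H\<close>. The involution of \<open>C\<close> reverses the comultiplication because \<open>\<tau>\<close>
  does.
\<close>

lemma transported_quotient:
  fixes C :: "('h, 'c) module_star_coalgebra"
  assumes rng: "carrier C = range \<pi>"
    and ps: "\<And>x y. \<pi> x \<oplus>\<^bsub>C\<^esub> \<pi> y = \<pi> (x + y)" "\<And>c x. c \<odot>\<^bsub>C\<^esub> \<pi> x = \<pi> (c \<cdot> x)" "\<zero>\<^bsub>C\<^esub> = \<pi> 0"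
    and cm: "\<And>x. comult C (\<pi> x) = tensor_map H H C C \<pi> \<pi> (comult H x)"
    and cu: "\<And>x. counit C (\<pi> x) = \<epsilon> x" and ac: "\<And>h x. act C h (\<pi> x) = \<pi> (h * x)"
    and cs: "\<And>x. costar C (\<pi> x) = \<pi> (tau x)"
  shows "quotient_left_module_star_coalgebra H C \<pi>"
proof -
  have \<pi>: "linear_between H C \<pi>" by (auto simp: linear_between_def rng ps)
  have C: "cvector_space C"
  proof (rule cspaceI)
    show "abelian_group C"
    proof (rule abelian_groupI)
      fix c assume "c \<in> carrier C"
      then obtain x where "c = \<pi> x" by (auto simp: rng)
      then show "\<exists>d\<in>carrier C. d \<oplus>\<^bsub>C\<^esub> c = \<zero>\<^bsub>C\<^esub>"
        by (intro bexI[of _ "\<pi> (- x)"]) (auto simp: ps rng)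
    qed (auto simp: rng ps algebra_simps)
  qed (auto simp: rng ps scale_left_distrib scale_right_distrib)
  have cmt: "comult C (\<pi> x) \<in> tens C C" for x unfolding cm by (rule tensor_map_in[OF comult_tens' \<pi> \<pi>])
  have cC: "comult C (\<pi> x) \<beta> = comult H x (\<lambda>a b. \<beta> (\<pi> a) (\<pi> b))" if "bilinear_form C C \<beta>" for x \<beta>
    using that by (simp add: cm tensor_map_apply[OF comult_tens' \<pi> \<pi>])
  have cC0: "comult C (\<pi> x) \<beta> = 0" if "\<not> bilinear_form C C \<beta>" for x \<beta>
    by (rule tensor_nonbilinear[OF cmt that])
  have dl: "linear_between C (tensor_space C C) (comult C)"
  proof -
    have "comult C (\<pi> (x + y)) = comult C (\<pi> x) + comult C (\<pi> y)" "comult C (\<pi> (c \<cdot> x)) = (\<lambda>\<beta>. c * comult C (\<pi> x) \<beta>)" for x y c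
    proof -
      show "comult C (\<pi> (x + y)) = comult C (\<pi> x) + comult C (\<pi> y)"
      proof
        fix \<beta> show "comult C (\<pi> (x + y)) \<beta> = (comult C (\<pi> x) + comult C (\<pi> y)) \<beta>"
          by (cases "bilinear_form C C \<beta>") (simp_all add: cC cC0 lin_simps[OF comult_lin])
      qed
      show "comult C (\<pi> (c \<cdot> x)) = (\<lambda>\<beta>. c * comult C (\<pi> x) \<beta>)"
      proof
        fix \<beta> show "comult C (\<pi> (c \<cdot> x)) \<beta> = c * comult C (\<pi> x) \<beta>"
          by (cases "bilinear_form C C \<beta>") (simp_all add: cC cC0 lin_simps[OF comult_lin])
      qed
    qed
    then show ?thesis using cmt by (auto simp: linear_between_def rng ps)
  qed
  have cl: "linear_form C (counit C)" by (auto simp: linear_form_iff rng ps cu lin_simps)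
  have coassoc: "comult C (\<pi> x) (\<lambda>m h. comult C m (\<lambda>a b. \<gamma> a b h)) = comult C (\<pi> x) (\<lambda>m h. comult C h (\<gamma> m))"
    if tri: "trilinear_form C C C \<gamma>" for \<gamma> x
  proof -
    note b = bilinear_of_trilinear[OF C C tri]
    have b1: "bilinear_form C C (\<lambda>a b. \<gamma> a b (\<pi> h))" "bilinear_form C C (\<gamma> (\<pi> h))" for h
      using tri rng by (auto simp: trilinear_form_def linear_form_iff bilinear_form_iff)
    have tH: "trilinear_form H H H (\<lambda>a b c. \<gamma> (\<pi> a) (\<pi> b) (\<pi> c))"
    proof -
      have "lin (\<lambda>a. \<gamma> (\<pi> a) (\<pi> b) (\<pi> c))" for b c
        using tri rng by (intro linear_form_comp[OF _ \<pi>]) (auto simp: trilinear_form_def)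
      moreover have "bil (\<lambda>b c. \<gamma> (\<pi> a) (\<pi> b) (\<pi> c))" for a by (rule bilinear_form_comp2[OF b1(2) \<pi> \<pi>])
      ultimately show ?thesis by (simp add: trilinear_form_def)
    qed
    have "comult C (\<pi> x) (\<lambda>m h. comult C m (\<lambda>a b. \<gamma> a b h)) =
        comult H x (\<lambda>m h. comult H m (\<lambda>a b. \<gamma> (\<pi> a) (\<pi> b) (\<pi> h)))"
      by (subst cC[OF bilinear_form_comp(1)[OF b(2) dl]]) (simp add: cC b1)
    also have "\<dots> = comult H x (\<lambda>m h. comult H h (\<lambda>a b. \<gamma> (\<pi> m) (\<pi> a) (\<pi> b)))"
      by (rule coassociativity[OF tH])
    also have "\<dots> = comult C (\<pi> x) (\<lambda>m h. comult C h (\<gamma> m))"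
      by (subst cC[OF bilinear_form_comp(2)[OF b(1) dl]]) (simp add: cC b1)
    finally show ?thesis .
  qed
  have counits: "comult C (\<pi> x) (\<lambda>a b. counit C a * \<psi> b) = \<psi> (\<pi> x)" "comult C (\<pi> x) (\<lambda>a b. \<psi> a * counit C b) = \<psi> (\<pi> x)"
    if \<psi>: "linear_form C \<psi>" for \<psi> x
  proof -
    have "bilinear_form C C (\<lambda>a b. counit C a * \<psi> b)" "bilinear_form C C (\<lambda>a b. \<psi> a * counit C b)"
      using cl \<psi> by (auto simp: bilinear_form_iff linear_form_iff algebra_simps)
    then show "comult C (\<pi> x) (\<lambda>a b. counit C a * \<psi> b) = \<psi> (\<pi> x)" "comult C (\<pi> x) (\<lambda>a b. \<psi> a * counit C b) = \<psi> (\<pi> x)"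
      using comult_counit[OF linear_form_comp[OF \<psi> \<pi>], of x] by (simp_all add: cC cu)
  qed
  have co: "is_coalgebra C"
    unfolding is_coalgebra_def
  proof (intro conjI ballI)
    fix c assume "c \<in> carrier C"
    then obtain x where x: "c = \<pi> x" by (auto simp: rng)
    have xC: "\<pi> x \<in> carrier C" by (simp add: rng)
    show "tensor_assoc C C C (tensor_map C C (tensor_space C C) C (comult C) id (comult C c)) =
        tensor_map C C C (tensor_space C C) id (comult C) (comult C c)"
      unfolding x coassociative_iff[OF C C dl dl cmt] using coassoc by blast
    show "tensor_map C C complex_space C (counit C) id (comult C c) = elem_tensor complex_space C 1 c"
      unfolding x counit_left_iff[OF C C cl cmt xC] using counits by blast
    show "tensor_map C C C complex_space id (counit C) (comult C c) = elem_tensor C complex_space c 1"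
      unfolding x counit_right_iff[OF C C cl cmt xC] using counits by blast
  qed (rule C dl cl)+
  have al: "linear_between C C (act C h)" for h
    by (auto simp: linear_between_def rng ps ac distrib_left)
  have act_comult: "comult C (act C h c) = tensor_lift H H (\<lambda>h\<^sub>1 h\<^sub>2.
            tensor_map C C C C (act C h\<^sub>1) (act C h\<^sub>2) (comult C c)) (comult H h)"
    if "c \<in> carrier C" for h c
  proof -
    obtain x where x: "c = \<pi> x" using \<open>c \<in> carrier C\<close> by (auto simp: rng)
    define T where "T p q = tensor_map C C C C (act C p) (act C q) (comult C c)" for p q
    have T: "T p q \<gamma> = (if bilinear_form C C \<gamma> then comult H x (\<lambda>a b. \<gamma> (\<pi> (p * a)) (\<pi> (q * b))) else 0)" for p q \<gamma>
      using cC[OF bilinear_form_comp2[OF _ al al], of \<gamma> x p q]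
      by (simp add: T_def x tensor_map_apply[OF cmt al al] ac)
    have bT: "bil (\<lambda>p q. T p q \<gamma>)" for \<gamma>
    proof (cases "bilinear_form C C \<gamma>")
      case True
      show ?thesis unfolding T using True bil_comult_mult[OF bilinear_form_comp2[OF True \<pi> \<pi>], of x] by simp
    qed (simp add: T)
    have "comult C (act C h c) = tensor_lift H H T (comult H h)"
    proof
      fix \<gamma>
      have "tensor_lift H H T (comult H h) \<gamma> = comult H h (\<lambda>p q. T p q \<gamma>)"
        by (rule tensor_lift_apply[OF comult_tens' bT])
      then show "comult C (act C h c) \<gamma> = tensor_lift H H T (comult H h) \<gamma>"
        by (cases "bilinear_form C C \<gamma>") (simp_all add: x ac cC cC0 T comult_mult[OF bilinear_form_comp2[OF _ \<pi> \<pi>]])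
    qed
    then show ?thesis unfolding T_def .
  qed
  have lm: "left_module_coalgebra H C"
    unfolding left_module_coalgebra_def
  proof (intro conjI allI ballI co al act_comult)
    fix c assume "c \<in> carrier C"
    then obtain x where x: "c = \<pi> x" by (auto simp: rng)
    show "linear_between H C (\<lambda>h. act C h c)"
      by (auto simp: linear_between_def rng ps ac x distrib_right)
    show "act C 1 c = c" by (simp add: x ac)
    show "act C (h * k) c = act C h (act C k c)" for h k by (simp add: x ac mult.assoc)
    show "counit C (act C h c) = \<epsilon> h * counit C c" for h by (simp add: x ac cu counit_mult)
  qed
  have sl: "antilinear_between C C (costar C)"
    by (auto simp: antilinear_between_def rng ps cs tau_linear)
  have sm: "comult C (costar C c) = tensor_lift C C (\<lambda>a b. elem_tensor C C (costar C b) (costar C a)) (comult C c)"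
    if "c \<in> carrier C" for c
  proof
    fix \<gamma>
    obtain x where x: "c = \<pi> x" using \<open>c \<in> carrier C\<close> by (auto simp: rng)
    have be: "bilinear_form C C (\<lambda>a b. cnj (\<gamma> (costar C b) (costar C a)))" if "bilinear_form C C \<gamma>" for \<gamma>
      using that sl by (auto simp: bilinear_form_iff antilinear_between_def Pi_iff)
    have b0: "bilinear_form C C (\<lambda>a b. 0)" by (auto simp: bilinear_form_iff)
    have bc: "bilinear_form C C (\<lambda>a b. cnj (elem_tensor C C (costar C b) (costar C a) \<gamma>))" for \<gamma>
      using be[of \<gamma>] b0 by (cases "bilinear_form C C \<gamma>") (simp_all add: elem_tensor_apply)
    have r: "tensor_lift C C (\<lambda>a b. elem_tensor C C (costar C b) (costar C a)) (comult C c) \<gamma> =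
        cnj (comult C c (\<lambda>a b. cnj (elem_tensor C C (costar C b) (costar C a) \<gamma>)))"
      unfolding x by (rule tensor_lift_antilinear[OF cmt bc])
    show "comult C (costar C c) \<gamma> = tensor_lift C C (\<lambda>a b. elem_tensor C C (costar C b) (costar C a)) (comult C c) \<gamma>"
    proof (cases "bilinear_form C C \<gamma>")
      case True
      have "comult C (costar C c) \<gamma> = comult H (tau x) (\<lambda>a b. \<gamma> (\<pi> a) (\<pi> b))" by (simp add: x cs cC True)
      also have "\<dots> = cnj (comult H x (\<lambda>a b. cnj (\<gamma> (\<pi> (tau b)) (\<pi> (tau a)))))"
        by (rule comult_tau[OF bilinear_form_comp2[OF True \<pi> \<pi>]])
      also have "\<dots> = cnj (comult C c (\<lambda>a b. cnj (\<gamma> (costar C b) (costar C a))))"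
        by (simp add: x cC[OF be[OF True]] cs)
      finally show ?thesis unfolding r using True by (simp add: elem_tensor_apply)
    next
      case False
      have "comult C c (\<lambda>a b. 0) = 0" by (simp add: x cC[OF b0])
      then show ?thesis unfolding r using False by (simp add: elem_tensor_apply x cs cC0)
    qed
  qed
  have sc: "star_coalgebra C"
    unfolding star_coalgebra_def using co sl sm by (auto simp: rng cs tau_tau)
  show ?thesis
    unfolding quotient_left_module_star_coalgebra_def quotient_left_module_coalgebra_def coalgebra_map_def
    using lm sc \<pi> by (auto simp: rng cm cu ac cs tau_def)
qed

text \<open>
  In an orthonormal basis of a subcoalgebra adapted to \<open>K\<close>, each term of
  \<open>\<Delta>(k) = \<Sum> e\<^sub>i \<otimes> L (\<cdot>,e\<^sub>i) k\<close> has a leg in \<open>K\<close>. So the coideal condition, which speaks of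
  products of forms, extends to all bilinear forms; this makes the comultiplication of \<open>H/K\<close>
  well defined.
\<close>

lemma quotient_kernel_comult:
  assumes K: "quotient_kernel K" and b: "bil \<beta>" and l: "\<And>k y. k \<in> K \<Longrightarrow> \<beta> k y = 0" and r: "\<And>k y. k \<in> K \<Longrightarrow> \<beta> y k = 0"
    and k: "k \<in> K"
  shows "comult H k \<beta> = 0"
proof -
  note KD = quotient_kernelD[OF K]
  note sK = KD(1)
  obtain V where V: "findim V" "subcoalgebra V" "k \<in> V" by (rule finite_subcoalgebra)
  have rc: "right_coideal V" using V by (simp add: subcoalgebra_def)
  obtain s r n e where s: "compatible s V" and e: "r \<le> n" "orthonormal s n e" "\<And>i. i < n \<Longrightarrow> e i \<in> V"
      "\<And>v. v \<in> V \<Longrightarrow> v = (\<Sum>i<n. s v (e i) \<cdot> e i)" "\<And>i. i < r \<Longrightarrow> e i \<in> K"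
      "\<And>k. k \<in> V \<Longrightarrow> k \<in> K \<Longrightarrow> k = (\<Sum>i<r. s k (e i) \<cdot> e i)"
      "\<And>k i. k \<in> V \<Longrightarrow> k \<in> K \<Longrightarrow> r \<le> i \<Longrightarrow> i < n \<Longrightarrow> L (\<lambda>a. s a (e i)) k \<in> K"
      by (rule adapted_orthonormal_basis[OF K rc V(1)], rule that)
  have h: "hermitian s" using s by (simp add: compatible_def)
  have "comult H k \<beta> = (\<Sum>i<n. \<beta> (e i) (L (\<lambda>a. s a (e i)) k))"
    by (rule comult_apply_elem_sum[OF b right_coideal_expansion[OF rc V(3) hermitian_lin[OF h] e(4)]])
  also have "\<dots> = 0"
  proof (intro sum.neutral ballI)
    fix i assume i: "i \<in> {..<n}"
    then show "\<beta> (e i) (L (\<lambda>a. s a (e i)) k) = 0"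
      using l[OF e(5)] r[OF e(7)[OF V(3) k]] by (cases "i < r") auto
  qed
  finally show ?thesis .
qed

lemma quotient_coalgebra_of_kernel:
  assumes K: "quotient_kernel K"
  shows "(quotient_coalgebra H K, \<lambda>x. K +>\<^bsub>H\<^esub> x) \<in> quotients H"
    and "a_kernel H (quotient_coalgebra H K) (\<lambda>x. K +>\<^bsub>H\<^esub> x) = K"
proof -
  note KD = quotient_kernelD[OF K]
  note sK = KD(1)
  let ?C = "quotient_coalgebra H K" and ?Q = "quotient_space H K"
  define p where "p x = K +>\<^bsub>H\<^esub> x" for x
  have p: "p x = (\<lambda>k. k + x) ` K" for x
    by (auto simp: p_def a_r_coset_def r_coset_def)
  have p_eq: "p x = p y \<longleftrightarrow> x - y \<in> K" for x y
  proof
    assume "p x = p y"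
    moreover have "x \<in> p x" unfolding p using subspace_0[OF sK] by force
    ultimately show "x - y \<in> K" unfolding p by auto
  next
    assume xy: "x - y \<in> K"
    have "k + x \<in> p y" if "k \<in> K" for k
      unfolding p using subspace_add[OF sK that xy] by (intro image_eqI[of _ _ "k + (x - y)"]) auto
    moreover have "k + y \<in> p x" if "k \<in> K" for k
      unfolding p using subspace_diff[OF sK that xy] by (intro image_eqI[of _ _ "k - (x - y)"]) auto
    ultimately show "p x = p y" unfolding p[of x] p[of y] by (auto simp: p)
  qed
  have desc: "descend f (p x) = f x" if "\<And>y. y - x \<in> K \<Longrightarrow> f y = f x" for f :: "'h \<Rightarrow> 'z" and x
  proof -
    have "f ` p x = {f x}"
    proof
      show "f ` p x \<subseteq> {f x}" unfolding p using that by auto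
      show "{f x} \<subseteq> f ` p x" unfolding p using subspace_0[OF sK] by force
    qed
    then show ?thesis by (simp add: descend_def)
  qed
  have car: "carrier ?Q = range p" by (auto simp: quotient_space_def A_RCOSETS_def RCOSETS_def p_def a_r_coset_def)
  have add: "p x \<oplus>\<^bsub>?Q\<^esub> p y = p (x + y)" for x y
  proof -
    have "p x <+>\<^bsub>H\<^esub> p y = {a + b | a b. a \<in> p x \<and> b \<in> p y}" by (auto simp: set_add_def set_mult_def)
    also have "\<dots> = p (x + y)"
    proof (intro subset_antisym subsetI)
      fix z assume "z \<in> {a + b | a b. a \<in> p x \<and> b \<in> p y}"
      then obtain k l where "k \<in> K" "l \<in> K" "z = (k + x) + (l + y)" by (auto simp: p)
      then show "z \<in> p (x + y)" unfolding p using subspace_add[OF sK, of k l]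
        by (intro image_eqI[of _ _ "k + l"]) (auto simp: algebra_simps)
    next
      fix z assume "z \<in> p (x + y)"
      then obtain k where "k \<in> K" "z = k + (x + y)" by (auto simp: p)
      then have "z = (k + x) + (0 + y)" "k + x \<in> p x" "0 + y \<in> p y" using subspace_0[OF sK] by (auto simp: p add.assoc intro: image_eqI[of _ _ 0])
      then show "z \<in> {a + b | a b. a \<in> p x \<and> b \<in> p y}" by blast
    qed
    finally show ?thesis by (simp add: quotient_space_def)
  qed
  have smult: "c \<odot>\<^bsub>?Q\<^esub> p x = p (c \<cdot> x)" for c x
  proof -
    have "descend (\<lambda>x. p (c \<cdot> x)) (p x) = p (c \<cdot> x)"
      by (rule desc) (simp add: p_eq subspace_scale[OF sK] flip: scale_right_diff_distrib)
    then show ?thesis by (simp add: quotient_space_def p_def[symmetric])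
  qed
  have zero: "\<zero>\<^bsub>?Q\<^esub> = p 0" by (simp add: quotient_space_def p)
  have Cs: "carrier ?C = carrier ?Q" "add ?C = add ?Q" "smult ?C = smult ?Q" "zero ?C = zero ?Q"
    by (simp_all add: quotient_coalgebra_def)
  have bQ: "bilinear_form ?Q ?Q = bilinear_form ?C ?C"
    by (auto simp: fun_eq_iff bilinear_form_iff Cs)
  have eQ: "elem_tensor ?Q ?Q = elem_tensor ?C ?C" by (auto simp: fun_eq_iff elem_tensor_def bQ)
  have mQ: "tensor_map H H ?Q ?Q p p = tensor_map H H ?C ?C p p" by (simp add: tensor_map_def eQ)
  have \<pi>: "linear_between H ?C p" by (auto simp: linear_between_def Cs car add smult)
  have cmC: "comult ?C (p x) = tensor_map H H ?C ?C p p (comult H x)" for x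
  proof -
    have "descend (\<lambda>x. tensor_map H H ?C ?C p p (comult H x)) (p x) = tensor_map H H ?C ?C p p (comult H x)"
    proof (rule desc)
      fix y assume yx: "y - x \<in> K"
      show "tensor_map H H ?C ?C p p (comult H y) = tensor_map H H ?C ?C p p (comult H x)"
      proof
        fix \<beta> show "tensor_map H H ?C ?C p p (comult H y) \<beta> = tensor_map H H ?C ?C p p (comult H x) \<beta>"
        proof (cases "bilinear_form ?C ?C \<beta>")
          case True
          have b: "bil (\<lambda>a b. \<beta> (p a) (p b))" by (rule bilinear_form_comp2[OF True \<pi> \<pi>])
          then have l: "lin (\<lambda>a. \<beta> (p a) (p b))" "lin (\<lambda>b. \<beta> (p a) (p b))" for a b by (auto simp: bil_iff)
          have pk: "p k = p 0" if "k \<in> K" for k using that by (simp add: p_eq)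
          have "comult H (y - x) (\<lambda>a b. \<beta> (p a) (p b)) = 0"
            by (rule quotient_kernel_comult[OF K b _ _ yx])
              (simp_all add: pk lin_simps(3)[OF l(1)] lin_simps(3)[OF l(2)])
          then have "comult H y (\<lambda>a b. \<beta> (p a) (p b)) = comult H x (\<lambda>a b. \<beta> (p a) (p b))"
            by (simp add: lin_simps(5)[OF comult_lin])
          then show ?thesis by (simp add: tensor_map_apply[OF comult_tens' \<pi> \<pi>])
        qed (simp add: tensor_map_apply[OF comult_tens' \<pi> \<pi>])
      qed
    qed
    moreover have "comult ?C = descend (\<lambda>x. tensor_map H H ?Q ?Q p p (comult H x))"
      by (simp add: quotient_coalgebra_def p_def[abs_def])
    ultimately show ?thesis unfolding mQ by (rule trans[OF fun_cong, rotated])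
  qed
  have cuC: "counit ?C (p x) = \<epsilon> x" for x
  proof -
    have "descend \<epsilon> (p x) = \<epsilon> x"
      by (rule desc) (use KD(3) lin_simps(5)[OF counit_lin] in fastforce)
    then show ?thesis by (simp add: quotient_coalgebra_def)
  qed
  have acC: "act ?C h (p x) = p (h * x)" for h x
  proof -
    have "descend (\<lambda>x. p (h * x)) (p x) = p (h * x)"
      by (rule desc) (simp add: p_eq KD(2) flip: right_diff_distrib)
    then show ?thesis by (simp add: quotient_coalgebra_def p_def[symmetric])
  qed
  have csC: "costar ?C (p x) = p (tau x)" for x
  proof -
    have td: "tau a - tau b = tau (a - b)" for a b using tau_linear(1)[of "a - b" b] by (simp add: algebra_simps)
    have "descend (\<lambda>x. p (tau x)) (p x) = p (tau x)"
      by (rule desc) (simp add: p_eq td KD(4))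
    then show ?thesis by (simp add: quotient_coalgebra_def p_def[symmetric] tau_def)
  qed
  have "quotient_left_module_star_coalgebra H ?C p"
    by (rule transported_quotient) (simp_all add: Cs car add smult zero cmC cuC acC csC)
  then show "(?C, \<lambda>x. K +>\<^bsub>H\<^esub> x) \<in> quotients H" by (simp add: quotients_def p_def[abs_def])
  have "a_kernel H ?C p = {x. p x = p 0}" by (auto simp: a_kernel_def kernel_def Cs zero)
  also have "\<dots> = K" by (simp add: p_eq)
  finally show "a_kernel H ?C (\<lambda>x. K +>\<^bsub>H\<^esub> x) = K" by (simp add: p_def[abs_def])
qed


section \<open>The correspondence\<close>

definition class_of_kernel :: "'h set \<Rightarrow> (('h, 'h set) module_star_coalgebra \<times> ('h \<Rightarrow> 'h set)) set" where
  "class_of_kernel K = {(C, \<pi>). (C, \<pi>) \<in> quotients H \<and> a_kernel H C \<pi> = K}"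

lemma class_of_kernel_member:
  "quotient_kernel K \<Longrightarrow> (quotient_coalgebra H K, \<lambda>x. K +>\<^bsub>H\<^esub> x) \<in> class_of_kernel K"
  using quotient_coalgebra_of_kernel by (simp add: class_of_kernel_def)

lemma same_kernel_class: "(C, \<pi>) \<in> quotients H \<Longrightarrow> same_kernel H `` {(C, \<pi>)} = class_of_kernel (a_kernel H C \<pi>)"
  by (auto simp: same_kernel_def class_of_kernel_def)

lemma quotient_classes_eq: "quotient_classes H = class_of_kernel ` {K. quotient_kernel K}"
proof (intro subset_antisym subsetI)
  fix X assume "X \<in> quotient_classes H"
  then obtain C \<pi> where C: "(C, \<pi>) \<in> quotients H" "X = same_kernel H `` {(C, \<pi>)}"
    by (auto simp: quotient_classes_def quotient_def)
  then show "X \<in> class_of_kernel ` {K. quotient_kernel K}"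
    using kernel_of_quotient(1)[of C \<pi>] same_kernel_class by (auto simp: quotients_def)
next
  fix X assume "X \<in> class_of_kernel ` {K. quotient_kernel K}"
  then obtain K where K: "quotient_kernel K" "X = class_of_kernel K" by blast
  note q = quotient_coalgebra_of_kernel[OF K(1)]
  have "X = same_kernel H `` {(quotient_coalgebra H K, \<lambda>x. K +>\<^bsub>H\<^esub> x)}"
    using same_kernel_class[OF q(1)] q(2) K(2) by simp
  then show "X \<in> quotient_classes H" using q(1) unfolding quotient_classes_def quotient_def by blast
qed

lemma quotient_class_of_eq:
  assumes "star_coideal_algebra A"
  shows "quotient_class_of H A = class_of_kernel (left_ideal_of H A)"
proof -
  note q = quotient_coalgebra_of_kernel[OF left_ideal_quotient_kernel[OF assms]]
  show ?thesis
    unfolding quotient_class_of_def quotient_of_def using same_kernel_class[OF q(1)] q(2) by simp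
qed

lemma coinvariants_of_class_eq:
  assumes "quotient_kernel K"
  shows "coinvariants_of_class H (class_of_kernel K) = coinv K"
proof -
  have "(\<lambda>(C, \<pi>). coinvariants H C \<pi>) ` class_of_kernel K = {coinv K}"
  proof
    show "(\<lambda>(C, \<pi>). coinvariants H C \<pi>) ` class_of_kernel K \<subseteq> {coinv K}"
      using kernel_of_quotient(2) by (auto simp: class_of_kernel_def quotients_def)
    then show "{coinv K} \<subseteq> (\<lambda>(C, \<pi>). coinvariants H C \<pi>) ` class_of_kernel K"
      using class_of_kernel_member[OF assms] by blast
  qed
  then show ?thesis by (simp add: coinvariants_of_class_def)
qed

end

theorem theorem3p2:
  fixes H :: "'h::ring_1 hopf_star_algebra"
  assumes "cqg_algebra H"
  shows
    "(\<lambda>(C, \<pi>). coinvariants H C \<pi>) respects same_kernel H \<and>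
     bij_betw (quotient_class_of H) (right_coideal_star_subalgebras H) (quotient_classes H) \<and>
     bij_betw (coinvariants_of_class H) (quotient_classes H) (right_coideal_star_subalgebras H) \<and>
     (\<forall>A\<in>right_coideal_star_subalgebras H.
        coinvariants_of_class H (quotient_class_of H A) = A) \<and>
     (\<forall>X\<in>quotient_classes H.
        quotient_class_of H (coinvariants_of_class H X) = X) \<and>
     (\<forall>(C :: ('h, 'c) module_star_coalgebra) \<pi>.
        quotient_left_module_star_coalgebra H C \<pi> \<longrightarrow>
        (\<exists>(D, \<rho>)\<in>quotients H.
           a_kernel H D \<rho> = a_kernel H C \<pi> \<and> coinvariants H D \<rho> = coinvariants H C \<pi>))"
proof -
  interpret cqg H
    using assms by unfold_locales (auto simp: cqg_algebra_def)
  let ?A = "right_coideal_star_subalgebras H" and ?X = "quotient_classes H"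
  have A: "A \<in> ?A \<longleftrightarrow> star_coideal_algebra A" for A
    by (simp add: right_coideal_star_subalgebras_def star_coideal_algebra_iff)
  have 1: "quotient_class_of H A \<in> ?X \<and> coinvariants_of_class H (quotient_class_of H A) = A" if "A \<in> ?A" for A
    using that left_ideal_quotient_kernel[of A]
    by (simp add: A quotient_class_of_eq coinvariants_of_class_eq coinv_left_ideal quotient_classes_eq)
  have 2: "coinvariants_of_class H X \<in> ?A \<and> quotient_class_of H (coinvariants_of_class H X) = X" if X: "X \<in> ?X" for X
  proof -
    obtain K where K: "quotient_kernel K" "X = class_of_kernel K" using X by (auto simp: quotient_classes_eq)
    then show ?thesis
      using coinv_star_coideal_algebra[OF K(1)]
      by (simp add: A coinvariants_of_class_eq quotient_class_of_eq left_ideal_coinv)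
  qed
  have 3: "(\<lambda>(C, \<pi>). coinvariants H C \<pi>) respects same_kernel H"
    by (auto simp: congruent_def same_kernel_def quotients_def kernel_of_quotient(2))
  have 4: "\<exists>(D, \<rho>)\<in>quotients H. a_kernel H D \<rho> = a_kernel H C \<pi> \<and> coinvariants H D \<rho> = coinvariants H C \<pi>"
    if q: "quotient_left_module_star_coalgebra H C \<pi>" for C :: "('h, 'c) module_star_coalgebra" and \<pi>
  proof -
    note k = kernel_of_quotient[OF q]
    note c = quotient_coalgebra_of_kernel[OF k(1)]
    have "coinvariants H (quotient_coalgebra H (a_kernel H C \<pi>)) (\<lambda>x. a_kernel H C \<pi> +>\<^bsub>H\<^esub> x) = coinvariants H C \<pi>"
      using kernel_of_quotient(2)[of "quotient_coalgebra H (a_kernel H C \<pi>)" "\<lambda>x. a_kernel H C \<pi> +>\<^bsub>H\<^esub> x"] c k(2)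
      by (simp add: quotients_def)
    then show ?thesis using c by (intro bexI[OF _ c(1)]) simp
  qed
  have "bij_betw (quotient_class_of H) ?A ?X" "bij_betw (coinvariants_of_class H) ?X ?A"
    using 1 2 by (auto intro!: bij_betw_byWitness[where f' = "coinvariants_of_class H"]
      bij_betw_byWitness[where f' = "quotient_class_of H"])
  then show ?thesis using 1 2 3 4 by blast
qed

end
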